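(* Let $n\ge 1$ and let $F$ be a non-constant analytic function in the complex unit ball $B_c(0,1)\subset\mathbb{C}^n$ such that $\sup_{B_c(0,1)}|F|\le 1$ and $F(0)\neq 0$. Let $0<\varepsilon\le\frac14$, let $B$ be any real ball contained in $B(0,1-\varepsilon)\subset\mathbb{R}^n$, and let $M_B(F)$ be a (unique) positive number such that $$\mathrm{Vol}_B\{|F|\ge M_B(F)\}=\frac1e .$$ Put $C=8$ and $\sigma=48\,\varepsilon^{-3}\log\frac{1}{|F(0)|}$. Then, for every $\lambda>1$, $$\mathrm{Vol}_B\{|F|\le (C\lambda)^{-\sigma}M_B(F)\}\le\frac1\lambda$$ and $$\mathrm{Vol}_B\{|F|\ge (C\lambda)^{\sigma}M_B(F)\}\le e^{-\lambda}.$$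
   Context: $B_c(w,r)=\{z\in\mathbb{C}^n:|z-w|<r\}$ denotes a complex ball and $B(u,r)=\{x\in\mathbb{R}^n:|x-u|<r\}$ a real ball (Euclidean norms, $r>0$); $\mathbb{R}^n$ is regarded as a subset of $\mathbb{C}^n$ in the usual way. For a real ball $B\subset\mathbb{R}^n$, $\mathrm{Vol}_B$ denotes the normalized volume $\mathrm{Vol}_B(E)=\frac{\mathrm{Vol}(B\cap E)}{\mathrm{Vol}(B)}$, where $\mathrm{Vol}$ is $n$-dimensional Lebesgue measure on $\mathbb{R}^n$. The notation $\{|F|\ge c\}$ (and similarly with $\le$) means the set of real points $x\in B(0,1)$ with $|F(x)|\ge c$. The logarithm is natural. *)

theory Defs
  imports "HOL-Analysis.Analysis"
begin

text \<open>
  \<open>\<complex>\<^sup>n\<close> and \<open>\<real>\<^sup>n\<close> are \<open>complex ^ 'n\<close> and \<open>real ^ 'n\<close> with \<open>n = CARD('n)\<close>; their norms are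
  the Euclidean ones, so \<^const>\<open>ball\<close> gives both the complex and the real balls.
\<close>

definition of_real_vec :: "real ^ 'n \<Rightarrow> complex ^ 'n"
  where "of_real_vec x = (\<chi> i. complex_of_real (x $ i))"

text \<open>
  Analyticity in several complex variables: around every point of \<open>S\<close> the function is the sum of
  a power series. Multi-indices are functions \<open>\<alpha> :: 'n \<Rightarrow> nat\<close>, and the sum over them is
  unconditional (equivalently, absolute).
\<close>

definition analytic_vec_on :: "(complex ^ 'n \<Rightarrow> complex) \<Rightarrow> (complex ^ 'n) set \<Rightarrow> bool"
  where "analytic_vec_on F S \<longleftrightarrow>
    (\<forall>w\<in>S. \<exists>r>0. \<exists>c :: ('n \<Rightarrow> nat) \<Rightarrow> complex. \<forall>z\<in>ball w r.
       ((\<lambda>\<alpha>. c \<alpha> * (\<Prod>i\<in>UNIV. (z $ i - w $ i) ^ \<alpha> i)) has_sum F z) UNIV)"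

definition normalized_vol :: "(real ^ 'n) set \<Rightarrow> (real ^ 'n) set \<Rightarrow> real"
  where "normalized_vol B E = measure lebesgue (B \<inter> E) / measure lebesgue B"

definition superlevel :: "(complex ^ 'n \<Rightarrow> complex) \<Rightarrow> real \<Rightarrow> (real ^ 'n) set"
  where "superlevel F c = {x \<in> ball 0 1. cmod (F (of_real_vec x)) \<ge> c}"

definition sublevel :: "(complex ^ 'n \<Rightarrow> complex) \<Rightarrow> real \<Rightarrow> (real ^ 'n) set"
  where "sublevel F c = {x \<in> ball 0 1. cmod (F (of_real_vec x)) \<le> c}"

end

theory Submission
  imports Defs "HOL-Complex_Analysis.Complex_Analysis" "HOL-Probability.Probability"
begin

text \<open>
The proof compares values of \<open>F\<close> along curves. On a real segment through the ball nothing is known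
about \<open>F\<close>, since the only given lower bound is at \<open>0\<close>. Therefore points are written as \<open>bend e y\<close>,
where \<open>bend e\<close> multiplies \<open>y\<close> by \<open>shrink e s = (1 - e - s) / (1 + e - s)\<close> with \<open>s = norm y ^ 2\<close>. On a
real line \<open>p + x q\<close> with \<open>p\<close> orthogonal to the unit vector \<open>q\<close> one has \<open>s = norm p ^ 2 + x ^ 2\<close>, which
is a polynomial in \<open>x\<close>, so \<open>x\<close> may be made complex. The factor has modulus at most \<open>1\<close> while \<open>Re s < 1\<close>
and vanishes at \<open>s = 1 - e\<close>. Hence \<open>f \<zeta> = F (bend e (p + \<zeta> q))\<close> is holomorphic and bounded by \<open>1\<close> in
a disc, and it equals \<open>F 0\<close> at two opposite real points near the boundary: the value at \<open>0\<close> controls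
\<open>F\<close> along every bent chord (lemma \<open>remez_along_bent_chord\<close>).

In the disc, Blaschke factors are split off. Zeros that come hyperbolically close to the chord
each cost a fixed amount of \<open>ln (1 / \<bar>F 0\<bar>)\<close>, so there are at most \<open>N\<close> of them, \<open>N\<close>
being proportional to \<open>\<epsilon> ^ (-3) ln (1 / \<bar>F 0\<bar>)\<close>; the other factors obey a
Harnack inequality. This gives a Remez inequality: \<open>\<bar>f y\<bar>\<close> is at most \<open>5 powr N\<close> times a
product of at most \<open>N\<close> factors \<open>2 + 2 / \<bar>t - c\<bar>\<close> times the value of \<open>\<bar>f\<bar>\<close> at
\<open>(1 - t) x + t y\<close>, for small \<open>t\<close> (lemma \<open>remez_product\<close>). By the inequality of means for square
roots of the factors, a random \<open>t\<close> in \<open>[0, a]\<close> hits a point where \<open>\<bar>F\<bar>\<close> is smaller than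
at the endpoint by a factor \<open>\<Lambda>\<close> with probability at most a constant times \<open>\<Lambda> powr
(- 1 / (2 N)) / sqrt a\<close> (lemma \<open>remez_measure\<close>).

To pass from curves to volumes, a Prekopa-Leindler inequality is used in which the interpolation
parameter is random and the hypothesis is only required on average (lemma
\<open>prekopa_leindler_euclidean\<close>). It applies because the preimage of a ball under \<open>bend e\<close> is convex
(lemma \<open>bend_preimage_convex\<close>; here \<open>e = \<epsilon> ^ 3 / 3\<close> is what the roundness of the ball can absorb)
and the Jacobian of \<open>bend e\<close> is log-concave. For a ball of volume \<open>K\<close>, a part of volume \<open>S\<close> where \<open>\<bar>F\<bar>\<close>
is large and a part of volume \<open>E\<close> where \<open>\<bar>F\<bar>\<close> is smaller by the factor \<open>\<Lambda>\<close>, the result is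
\<open>K powr (1 - a / 2) * S powr (a / 2) \<le> 2 powr \<theta> * (K - E / 2)\<close> with a small \<open>\<theta>\<close> (lemma
\<open>volume_interpolation\<close>). With \<open>a = 1 / (8 t)\<close> and \<open>\<Lambda> = (8 t) powr \<sigma>\<close> this contradicts the failure of
either claim: for the first, \<open>S\<close> is the set \<open>\<bar>F\<bar> \<ge> M\<close> of relative volume \<open>1 / exp 1\<close>; for the second, \<open>E\<close>
is its complement.
\<close>

section \<open>Quantile transport on an interval\<close>

definition nu :: "real measure" where "nu = uniform_measure lborel {-1..1}"

lemma sets_nu [simp, measurable_cong]: "sets nu = sets borel"
  by (simp add: nu_def)

lemma space_nu [simp]: "space nu = UNIV"
  by (simp add: nu_def)

lemma prob_space_nu: "prob_space nu"
  unfolding nu_def by (rule prob_space_uniform_measure) auto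

lemma AE_nu: "AE u in nu. u \<in> {-1..1}"
  unfolding nu_def by (rule AE_uniform_measureI) auto

lemma emeasure_nu: "E \<in> sets borel \<Longrightarrow> emeasure nu E = emeasure lborel ({-1..1} \<inter> E) / 2"
  unfolding nu_def by (subst emeasure_uniform_measure) auto

lemma emeasure_nu_tail: "u \<in> {-1..1} \<Longrightarrow> emeasure nu {u<..} = ennreal ((1 - u) / 2)"
proof -
  assume u: "u \<in> {-1..1}"
  have "{-1..1} \<inter> {u<..} = {u<..1}" using u by auto
  then show ?thesis using u
    by (simp add: emeasure_nu divide_ennreal[symmetric])
qed

text \<open>
Quantile functions are constructed on \<open>[-1, 1]\<close> only; composing them with the projection onto this
interval makes them total and continuous, hence measurable.
\<close>

definition clamp1 :: "real \<Rightarrow> real" where "clamp1 u = max (-1) (min 1 u)"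

lemma clamp1_in [simp]: "clamp1 u \<in> {-1..1}" "-1 \<le> clamp1 u" "clamp1 u \<le> 1"
  by (auto simp: clamp1_def)

lemma clamp1_id: "u \<in> {-1..1} \<Longrightarrow> clamp1 u = u"
  by (auto simp: clamp1_def)

lemma continuous_clamp1: "continuous_on UNIV clamp1"
  unfolding clamp1_def by (intro continuous_intros)

lemma continuous_on_compose_clamp1:
  "continuous_on {-1..1} Z \<Longrightarrow> continuous_on UNIV (\<lambda>u. Z (clamp1 u))"
  by (rule continuous_on_compose2[OF _ continuous_clamp1]) auto

text \<open>
Two laws on an interval agree once their tails do, and an increasing bijection carries tails to
tails. All transport maps below are recognized in this way.
\<close>

lemma distr_eq_of_increasing:
  fixes M N :: "real measure"
  assumes cont: "continuous_on {-1..1} Z" and mono: "strict_mono_on {-1..1} Z"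
    and ends: "Z (-1) = -1" "Z 1 = 1"
    and M: "prob_space M" "sets M = sets borel" and N: "prob_space N" "sets N = sets borel"
    and suppN: "AE x in N. x \<in> {-1..1}"
    and tails: "\<And>u. u \<in> {-1..1} \<Longrightarrow> emeasure M {u<..} = emeasure N {Z u<..}"
  shows "distr M borel (\<lambda>u. Z (clamp1 u)) = N"
proof (rule measure_eqI_lessThan)
  interpret M: prob_space M by fact
  interpret N: prob_space N by fact
  have [measurable]: "(\<lambda>u. Z (clamp1 u)) \<in> borel_measurable M"
    using borel_measurable_continuous_onI[OF continuous_on_compose_clamp1[OF cont]] M(2)
    by (metis measurable_cong_sets)
  have spM: "space M = UNIV" and spN: "space N = UNIV"
    using sets_eq_imp_space_eq[OF M(2)] sets_eq_imp_space_eq[OF N(2)] by auto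
  show "sets (distr M borel (\<lambda>u. Z (clamp1 u))) = sets borel" "sets N = sets borel"
    using N by auto
  interpret D: prob_space "distr M borel (\<lambda>u. Z (clamp1 u))"
    by (rule M.prob_space_distr) simp
  show "emeasure (distr M borel (\<lambda>u. Z (clamp1 u))) {x<..} < \<infinity>" for x
    using D.emeasure_finite[of "{x<..}"] by (simp add: less_top[symmetric])
  fix z :: real
  have eq: "emeasure (distr M borel (\<lambda>u. Z (clamp1 u))) {z<..} = emeasure M {v. z < Z (clamp1 v)}"
    by (subst emeasure_distr) (auto simp: spM vimage_def)
  have rng: "Z (clamp1 v) \<in> {-1..1}" for v
    using mono ends clamp1_in(1)[of v] strict_mono_on_leD[OF mono, of "-1" "clamp1 v"]
      strict_mono_on_leD[OF mono, of "clamp1 v" 1] by auto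
  consider "z < -1" | "z \<ge> 1" | "-1 \<le> z" "z < 1" by linarith
  then show "emeasure (distr M borel (\<lambda>u. Z (clamp1 u))) {z<..} = emeasure N {z<..}"
  proof cases
    case 1
    then have "{v. z < Z (clamp1 v)} = space M" using rng spM by (auto simp: less_le_trans)
    moreover have "emeasure N {z<..} = 1"
      by (subst N.emeasure_eq_1_AE) (use suppN N(2) 1 in \<open>auto elim!: eventually_mono\<close>)
    ultimately show ?thesis using eq M.emeasure_space_1 by simp
  next
    case 2
    then have e: "{v. z < Z (clamp1 v)} = {}" using rng by (auto simp: not_less intro: order_trans)
    have "AE x in N. x \<notin> {z<..}" using suppN by eventually_elim (use 2 in auto)
    then have "emeasure N {z<..} = 0"
      using N(2) by (subst (asm) AE_iff_measurable[of "{z<..}"]) (auto simp: spN)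
    then show ?thesis using eq e by simp
  next
    case 3
    then obtain u where u: "u \<in> {-1..1}" "Z u = z"
      using IVT'[of Z "-1" z 1] cont ends by auto
    have "u \<noteq> 1" using u 3 ends by auto
    have "(z < Z (clamp1 v)) = (u < v)" for v
    proof -
      have "(z < Z (clamp1 v)) = (u < clamp1 v)"
        using u strict_mono_on_less[OF mono, of u "clamp1 v"] by auto
      also have "\<dots> = (u < v)"
        using u \<open>u \<noteq> 1\<close> by (auto simp: clamp1_def)
      finally show ?thesis .
    qed
    then have "{v. z < Z (clamp1 v)} = {u<..}" by auto
    then show ?thesis using eq tails[OF u(1)] u(2) by simp
  qed
qed

lemma prob_space_density_nu:
  assumes [measurable]: "f \<in> borel_measurable borel"
    and "\<And>x. 0 \<le> f x" "\<And>x. f x \<le> C" "(\<integral>x. f x \<partial>nu) = 1"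
  shows "prob_space (density nu (\<lambda>x. ennreal (f x)))"
proof -
  interpret prob_space nu by (rule prob_space_nu)
  have "integrable nu f"
    by (rule integrable_const_bound[where B=C]) (use assms in \<open>auto\<close>)
  then have "(\<integral>\<^sup>+x. f x \<partial>nu) = 1" using assms by (subst nn_integral_eq_integral) auto
  then show ?thesis by (intro prob_spaceI) (simp add: emeasure_density)
qed

text \<open>
\<open>X\<close> is the inverse of the distribution function \<open>F\<close>. The bounds on the density make \<open>F\<close> bi-Lipschitz,
so that \<open>F\<close> and its inverse are continuous and strictly increasing.
\<close>

lemma quantile_exists:
  fixes f :: "real \<Rightarrow> real"
  assumes fm [measurable]: "f \<in> borel_measurable borel"
    and c: "0 < c" "\<And>x. c \<le> f x" and C: "\<And>x. f x \<le> C" and one: "(\<integral>x. f x \<partial>nu) = 1"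
  obtains X where "continuous_on {-1..1} X" "strict_mono_on {-1..1} X" "X (-1) = -1" "X 1 = 1"
    "distr nu borel (\<lambda>u. X (clamp1 u)) = density nu (\<lambda>x. ennreal (f x))"
proof -
  interpret prob_space nu by (rule prob_space_nu)
  let ?D = "density nu (\<lambda>x. ennreal (f x))"
  interpret D: prob_space ?D
    by (rule prob_space_density_nu[OF fm _ C one]) (use c in \<open>auto intro: order_trans less_imp_le\<close>)
  have f0: "0 \<le> f x" for x using c(1) c(2)[of x] by linarith
  define F where "F x = 1 - 2 * D.prob {x<..}" for x
  have diff: "D.prob {x<..} = D.prob {y<..} + D.prob {x<..y}" if "x \<le> y" for x y
  proof -
    have "{x<..} = {y<..} \<union> {x<..y}" using that by auto
    moreover have "D.prob ({y<..} \<union> {x<..y}) = D.prob {y<..} + D.prob {x<..y}"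
      by (rule D.finite_measure_Union) auto
    ultimately show ?thesis by simp
  qed
  have int: "D.prob {x<..y} = (\<integral>z. indicator {x<..y} z * f z \<partial>nu)" for x y
  proof -
    have "integrable nu (\<lambda>z. indicator {x<..y} z * f z)"
      by (rule integrable_const_bound[where B=C]) (use f0 C in \<open>auto simp: indicator_def intro: order_trans[OF f0]\<close>)
    then have "emeasure ?D {x<..y} = ennreal (\<integral>z. indicator {x<..y} z * f z \<partial>nu)"
      using f0 by (subst emeasure_density)
        (auto simp: nn_integral_eq_integral[symmetric] ennreal_mult' ennreal_indicator ac_simps intro!: nn_integral_cong)
    then show ?thesis
      unfolding measure_def by (simp add: f0 integral_nonneg_AE)
  qed
  have nuI: "prob {x<..y} = (y - x) / 2" if "-1 \<le> x" "x \<le> y" "y \<le> 1" for x y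
  proof -
    have "{-1..1} \<inter> {x<..y} = {x<..y}" using that by auto
    then have "emeasure nu {x<..y} = ennreal ((y - x) / 2)"
      using that by (simp add: emeasure_nu divide_ennreal[symmetric])
    then show ?thesis using that by (simp add: measure_def)
  qed
  have int2: "D.prob {x<..y} \<le> C * ((y - x) / 2)" "D.prob {x<..y} \<ge> c * ((y - x) / 2)"
    if "-1 \<le> x" "x \<le> y" "y \<le> 1" for x y
  proof -
    have i: "integrable nu (\<lambda>z. indicator {x<..y} z * f z)"
      by (rule integrable_const_bound[where B=C]) (use f0 C in \<open>auto simp: indicator_def intro: order_trans[OF f0]\<close>)
    have "(\<integral>z. indicator {x<..y} z * f z \<partial>nu) \<le> (\<integral>z. C * indicator {x<..y} z \<partial>nu)"
      by (rule integral_mono[OF i]) (use C in \<open>auto split: split_indicator intro!: integrable_mult_right integrable_real_indicator simp: less_top[symmetric]\<close>)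
    then show "D.prob {x<..y} \<le> C * ((y - x) / 2)" using int nuI[OF that] by simp
    have "(\<integral>z. indicator {x<..y} z * f z \<partial>nu) \<ge> (\<integral>z. c * indicator {x<..y} z \<partial>nu)"
      by (rule integral_mono[OF _ i]) (use c in \<open>auto split: split_indicator intro!: integrable_mult_right integrable_real_indicator simp: less_top[symmetric]\<close>)
    then show "D.prob {x<..y} \<ge> c * ((y - x) / 2)" using int nuI[OF that] by simp
  qed
  have Fd: "c * (y - x) \<le> F y - F x" "F y - F x \<le> C * (y - x)" if "-1 \<le> x" "x \<le> y" "y \<le> 1" for x y
    using diff[OF that(2)] int2[OF that] unfolding F_def by auto
  have Cpos: "C > 0" using c(1) c(2)[of 0] C[of 0] by linarith
  have contF: "continuous_on {-1..1} F"
  proof (rule continuous_onI)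
    fix x e :: real assume x: "x \<in> {-1..1}" and e: "0 < e"
    show "\<exists>d>0. \<forall>x'\<in>{-1..1}. dist x' x < d \<longrightarrow> dist (F x') (F x) \<le> e"
    proof (intro exI[of _ "e / C"] conjI ballI impI)
      show "e / C > 0" using e Cpos by simp
      fix x' assume x': "x' \<in> {-1..1}" "dist x' x < e / C"
      have "\<bar>F x' - F x\<bar> \<le> C * \<bar>x' - x\<bar>"
      proof (cases "x \<le> x'")
        case True
        then have "0 \<le> c * (x' - x)" using c(1) by simp
        then show ?thesis using Fd[of x x'] x x' True by auto
      next
        case False
        then have "0 \<le> c * (x - x')" using c(1) by simp
        then show ?thesis using Fd[of x' x] x x' False by auto
      qed
      also have "\<dots> \<le> e" using x'(2) Cpos by (simp add: dist_real_def field_simps)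
      finally show "dist (F x') (F x) \<le> e" by (simp add: dist_real_def)
    qed
  qed
  have monoF: "strict_mono_on {-1..1} F"
  proof (rule strict_mono_onI)
    fix x y :: real assume "x \<in> {-1..1}" "y \<in> {-1..1}" "x < y"
    moreover from this have "0 < c * (y - x)" using c(1) by simp
    ultimately show "F x < F y" using Fd(1)[of x y] by auto
  qed
  have suppD: "AE x in ?D. x \<in> {-1..1}"
  proof -
    have "AE x in nu. 0 < ennreal (f x) \<longrightarrow> x \<in> {-1..1}" using AE_nu by eventually_elim simp
    then show ?thesis by (subst AE_density) auto
  qed
  have F1: "F 1 = 1"
  proof -
    have "AE x in ?D. x \<notin> {1<..}" using suppD by eventually_elim auto
    then have "emeasure ?D {1<..} = 0"
      by (subst (asm) AE_iff_measurable[of "{1<..}"]) auto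
    then show ?thesis unfolding F_def by (simp add: measure_def)
  qed
  have Fm1: "F (-1) = -1"
  proof -
    have "AE x in nu. x \<noteq> -1"
    proof -
      have "emeasure nu {-1} = 0" by (simp add: emeasure_nu)
      then show ?thesis by (subst AE_iff_measurable[of "{-1}"]) auto
    qed
    then have "AE x in ?D. x \<noteq> -1" by (subst AE_density) auto
    with suppD have "AE x in ?D. x \<in> {-1<..}" by eventually_elim auto
    then have "D.prob {-1<..} = 1" by (subst D.prob_eq_1) auto
    then show ?thesis unfolding F_def by simp
  qed
  have D1: "distr ?D borel (\<lambda>u. F (clamp1 u)) = nu"
  proof (rule distr_eq_of_increasing[OF contF monoF Fm1 F1])
    show "prob_space ?D" "prob_space nu" by unfold_locales
    show "AE x in nu. x \<in> {-1..1}" by (rule AE_nu)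
    fix u :: real assume u: "u \<in> {-1..1}"
    have "F u \<in> {-1..1}"
      using strict_mono_on_leD[OF monoF, of "-1" u] strict_mono_on_leD[OF monoF, of u 1] u Fm1 F1 by auto
    then show "emeasure ?D {u<..} = emeasure nu {F u<..}"
      by (subst emeasure_nu_tail) (auto simp: F_def D.emeasure_eq_measure)
  qed auto
  define X where "X = the_inv_into {-1..1} F"
  have injF: "inj_on F {-1..1}" using monoF by (rule strict_mono_on_imp_inj_on)
  have imgF: "F ` {-1..1} = {-1..1}"
  proof
    show "F ` {-1..1} \<subseteq> {-1..1}"
      using strict_mono_on_leD[OF monoF, of "-1"] strict_mono_on_leD[OF monoF, of _ 1] Fm1 F1 by force
    show "{-1..1} \<subseteq> F ` {-1..1}"
    proof
      fix z :: real assume "z \<in> {-1..1}"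
      then show "z \<in> F ` {-1..1}" using IVT'[of F "-1" z 1] contF Fm1 F1 by force
    qed
  qed
  have XF: "X (F x) = x" if "x \<in> {-1..1}" for x
    unfolding X_def by (rule the_inv_into_f_f[OF injF that])
  have contX: "continuous_on {-1..1} X"
    using continuous_on_inv[OF contF, of X] XF imgF by auto
  have monoX: "strict_mono_on {-1..1} X"
  proof (rule strict_mono_onI)
    fix u v :: real assume uv: "u \<in> {-1..1}" "v \<in> {-1..1}" "u < v"
    obtain x y where "x \<in> {-1..1}" "y \<in> {-1..1}" "u = F x" "v = F y"
      using uv imgF by (metis imageE)
    then show "X u < X v" using uv strict_mono_on_less[OF monoF] XF by auto
  qed
  have Xe: "X (-1) = -1" "X 1 = 1" using XF[of 1] XF[of "-1"] F1 Fm1 by auto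
  have [measurable]: "(\<lambda>u. X (clamp1 u)) \<in> borel_measurable borel" "(\<lambda>u. F (clamp1 u)) \<in> borel_measurable borel"
    using borel_measurable_continuous_onI[OF continuous_on_compose_clamp1] contX contF by auto
  have "distr nu borel (\<lambda>u. X (clamp1 u)) = distr (distr ?D borel (\<lambda>u. F (clamp1 u))) borel (\<lambda>u. X (clamp1 u))"
    by (simp only: D1)
  also have "\<dots> = distr ?D borel (\<lambda>x. X (clamp1 (F (clamp1 x))))"
    by (subst distr_distr) (auto simp: comp_def)
  also have "\<dots> = distr ?D borel (\<lambda>x. x)"
  proof (rule distr_cong_AE)
    show "AE x in ?D. X (clamp1 (F (clamp1 x))) = x"
      using suppD
    proof eventually_elim
      case (elim x)
      then have "F x \<in> {-1..1}" using imgF by blast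
      then show ?case using elim by (simp only: clamp1_id XF)
    qed
  qed auto
  also have "\<dots> = ?D" by (rule distr_id2) simp
  finally show ?thesis by (intro that[OF contX monoX Xe])
qed

text \<open>
This is the equation \<open>X' u = 1 / f (X u)\<close> in integrated form, which avoids differentiability of \<open>X\<close>.
\<close>

lemma tail_of_quantile:
  fixes f :: "real \<Rightarrow> real"
  assumes [measurable]: "f \<in> borel_measurable borel" and fpos: "\<And>x. 0 < f x"
    and X: "continuous_on {-1..1} X" "strict_mono_on {-1..1} X" "X (-1) = -1" "X 1 = 1"
    and D: "distr nu borel (\<lambda>u. X (clamp1 u)) = density nu (\<lambda>x. ennreal (f x))"
    and u: "u \<in> {-1..1}"
  shows "(\<integral>\<^sup>+v. ennreal (1 / f (X (clamp1 v))) * indicator {u<..} v \<partial>nu) = ennreal ((1 - X u) / 2)"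
proof -
  have [measurable]: "(\<lambda>u. X (clamp1 u)) \<in> borel_measurable borel"
    using borel_measurable_continuous_onI[OF continuous_on_compose_clamp1] X(1) by auto
  have Xu: "X u \<in> {-1..1}"
    using strict_mono_on_leD[OF X(2), of "-1" u] strict_mono_on_leD[OF X(2), of u 1] u X by auto
  have "(\<integral>\<^sup>+v. ennreal (1 / f (X (clamp1 v))) * indicator {u<..} v \<partial>nu)
      = (\<integral>\<^sup>+v. ennreal (1 / f (X (clamp1 v))) * indicator {X u<..} (X (clamp1 v)) \<partial>nu)"
    by (rule nn_integral_cong_AE, use AE_nu in eventually_elim)
      (use u strict_mono_on_less[OF X(2), of u] in \<open>auto simp: indicator_def clamp1_id\<close>)
  also have "\<dots> = (\<integral>\<^sup>+x. ennreal (1 / f x) * indicator {X u<..} x \<partial>distr nu borel (\<lambda>u. X (clamp1 u)))"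
    by (subst nn_integral_distr) auto
  also have "\<dots> = (\<integral>\<^sup>+x. ennreal (f x) * (ennreal (1 / f x) * indicator {X u<..} x) \<partial>nu)"
    unfolding D by (subst nn_integral_density) auto
  also have "\<dots> = (\<integral>\<^sup>+x. indicator {X u<..} x \<partial>nu)"
  proof (rule nn_integral_cong)
    fix x
    have "ennreal (f x) * ennreal (1 / f x) = 1"
      using fpos[of x] by (simp add: ennreal_mult'[symmetric])
    then show "ennreal (f x) * (ennreal (1 / f x) * indicator {X u<..} x) = indicator {X u<..} x"
      by (simp add: mult.assoc[symmetric])
  qed
  also have "\<dots> = ennreal ((1 - X u) / 2)"
    by (subst nn_integral_indicator) (auto intro: emeasure_nu_tail[OF Xu])
  finally show ?thesis .
qed

text \<open>
For fixed \<open>t\<close> the map \<open>Z = (1 - t) X + t Y\<close> is again an increasing bijection of the interval, and its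
derivative is the second factor of the integrand: this is the substitution \<open>x = Z u\<close>.
\<close>

lemma integral_interpolated_quantiles:
  fixes f g h :: "real \<Rightarrow> real"
  assumes fm [measurable]: "f \<in> borel_measurable borel" and gm [measurable]: "g \<in> borel_measurable borel"
    and hm [measurable]: "h \<in> borel_measurable borel"
    and c: "0 < c" and f: "\<And>x. c \<le> f x" and g: "\<And>x. c \<le> g x"
    and h: "\<And>x. 0 \<le> h x" "\<And>x. h x \<le> C"
    and X: "continuous_on {-1..1} X" "strict_mono_on {-1..1} X" "X (-1) = -1" "X 1 = 1"
      "distr nu borel (\<lambda>u. X (clamp1 u)) = density nu (\<lambda>x. ennreal (f x))"
    and Y: "continuous_on {-1..1} Y" "strict_mono_on {-1..1} Y" "Y (-1) = -1" "Y 1 = 1"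
      "distr nu borel (\<lambda>u. Y (clamp1 u)) = density nu (\<lambda>x. ennreal (g x))"
    and t: "0 \<le> t" "t \<le> 1"
  shows "(\<integral>u. h ((1 - t) * X (clamp1 u) + t * Y (clamp1 u)) *
            ((1 - t) / f (X (clamp1 u)) + t / g (Y (clamp1 u))) \<partial>nu) = (\<integral>x. h x \<partial>nu)"
proof -
  interpret prob_space nu by (rule prob_space_nu)
  have fpos: "0 < f x" and gpos: "0 < g x" for x
    using c f[of x] g[of x] by auto
  have [measurable]: "(\<lambda>u. X (clamp1 u)) \<in> borel_measurable borel" "(\<lambda>u. Y (clamp1 u)) \<in> borel_measurable borel"
    using borel_measurable_continuous_onI[OF continuous_on_compose_clamp1] X(1) Y(1) by auto
  define k where "k u = (1 - t) / f (X (clamp1 u)) + t / g (Y (clamp1 u))" for u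
  have [measurable]: "k \<in> borel_measurable borel" unfolding k_def by measurable
  have k0: "0 \<le> k u" for u unfolding k_def using t fpos[of "X (clamp1 u)"] gpos[of "Y (clamp1 u)"] by auto
  define Z where "Z u = (1 - t) * X u + t * Y u" for u
  define M where "M = density nu (\<lambda>u. ennreal (k u))"
  have tail: "emeasure M {u<..} = ennreal ((1 - Z u) / 2)" if u: "u \<in> {-1..1}" for u
  proof -
    have XY: "X u \<le> 1" "Y u \<le> 1"
      using strict_mono_on_leD[OF X(2), of u 1] strict_mono_on_leD[OF Y(2), of u 1] u X Y by auto
    have "emeasure M {u<..} = (\<integral>\<^sup>+v. ennreal (k v) * indicator {u<..} v \<partial>nu)"
      unfolding M_def by (subst emeasure_density) auto
    also have "\<dots> = (\<integral>\<^sup>+v. ennreal (1 - t) * (ennreal (1 / f (X (clamp1 v))) * indicator {u<..} v)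
        + ennreal t * (ennreal (1 / g (Y (clamp1 v))) * indicator {u<..} v) \<partial>nu)"
    proof (rule nn_integral_cong)
      fix v
      have "ennreal (k v) = ennreal (1 - t) * ennreal (1 / f (X (clamp1 v))) + ennreal t * ennreal (1 / g (Y (clamp1 v)))"
        unfolding k_def using t fpos[of "X (clamp1 v)"] gpos[of "Y (clamp1 v)"]
        by (simp add: ennreal_mult'[symmetric] ennreal_plus[symmetric] del: ennreal_plus)
      then show "ennreal (k v) * indicator {u<..} v = ennreal (1 - t) * (ennreal (1 / f (X (clamp1 v))) * indicator {u<..} v)
        + ennreal t * (ennreal (1 / g (Y (clamp1 v))) * indicator {u<..} v)"
        by (auto simp: indicator_def)
    qed
    also have "\<dots> = ennreal (1 - t) * ennreal ((1 - X u) / 2) + ennreal t * ennreal ((1 - Y u) / 2)"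
      by (subst nn_integral_add, simp, simp, subst nn_integral_cmult, simp, subst nn_integral_cmult, simp,
          subst tail_of_quantile[OF fm fpos X u], subst tail_of_quantile[OF gm gpos Y u], simp)
    also have "\<dots> = ennreal ((1 - t) * ((1 - X u) / 2) + t * ((1 - Y u) / 2))"
    proof -
      have "ennreal ((1 - t) * ((1 - X u) / 2)) = ennreal (1 - t) * ennreal ((1 - X u) / 2)"
        "ennreal (t * ((1 - Y u) / 2)) = ennreal t * ennreal ((1 - Y u) / 2)"
        by (rule ennreal_mult; use t XY in simp)+
      moreover have "ennreal ((1 - t) * ((1 - X u) / 2) + t * ((1 - Y u) / 2)) =
          ennreal ((1 - t) * ((1 - X u) / 2)) + ennreal (t * ((1 - Y u) / 2))"
        using t XY by (intro ennreal_plus mult_nonneg_nonneg) auto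
      ultimately show ?thesis by simp
    qed
    also have "(1 - t) * ((1 - X u) / 2) + t * ((1 - Y u) / 2) = (1 - Z u) / 2"
      unfolding Z_def by (simp add: field_simps)
    finally show ?thesis .
  qed
  have suppM: "AE x in M. x \<in> {-1..1}"
  proof -
    have "AE x in nu. 0 < ennreal (k x) \<longrightarrow> x \<in> {-1..1}" using AE_nu by eventually_elim simp
    then show ?thesis unfolding M_def by (subst AE_density) auto
  qed
  have Ze: "Z (-1) = -1" "Z 1 = 1" unfolding Z_def using X Y by auto
  have pM: "prob_space M"
  proof (rule prob_spaceI)
    have sp: "space M = UNIV" by (simp add: M_def)
    have "AE x in nu. x \<noteq> -1"
    proof -
      have "emeasure nu {-1} = 0" by (simp add: emeasure_nu)
      then show ?thesis by (subst AE_iff_measurable[of "{-1}"]) auto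
    qed
    then have "AE x in M. x \<noteq> -1" unfolding M_def by (subst AE_density) auto
    with suppM have "AE x in M. x \<in> UNIV \<longleftrightarrow> x \<in> {-1<..}" by eventually_elim auto
    then have "emeasure M UNIV = emeasure M {-1<..}"
      by (intro emeasure_eq_AE) (auto simp: M_def)
    also have "\<dots> = 1" using tail[of "-1"] Ze by simp
    finally show "emeasure M (space M) = 1" using sp by simp
  qed
  have Zc: "continuous_on {-1..1} Z" unfolding Z_def by (intro continuous_intros X Y)
  have Zm: "strict_mono_on {-1..1} Z"
  proof (rule strict_mono_onI)
    fix u v :: real assume uv: "u \<in> {-1..1}" "v \<in> {-1..1}" "u < v"
    have "X u < X v" "Y u < Y v" by (rule strict_mono_onD[OF X(2) uv], rule strict_mono_onD[OF Y(2) uv])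
    then show "Z u < Z v" unfolding Z_def
      using t by (cases "t = 1") (auto intro!: add_less_le_mono mult_left_mono mult_strict_left_mono)
  qed
  have DZ: "distr M borel (\<lambda>u. Z (clamp1 u)) = nu"
  proof (rule distr_eq_of_increasing[OF Zc Zm Ze pM])
    show "emeasure M {u<..} = emeasure nu {Z u<..}" if u: "u \<in> {-1..1}" for u
    proof -
      have "Z u \<in> {-1..1}"
        using strict_mono_on_leD[OF Zm, of "-1" u] strict_mono_on_leD[OF Zm, of u 1] u Ze by auto
      then show ?thesis using tail[OF u] emeasure_nu_tail by simp
    qed
  qed (simp add: M_def, rule prob_space_nu, rule sets_nu, rule AE_nu)
  have Zmeas [measurable]: "(\<lambda>u. Z (clamp1 u)) \<in> borel_measurable borel" unfolding Z_def by measurable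
  have "(\<integral>x. h x \<partial>nu) = (\<integral>x. h x \<partial>distr M borel (\<lambda>u. Z (clamp1 u)))" by (simp only: DZ)
  also have "\<dots> = (\<integral>u. h (Z (clamp1 u)) \<partial>M)" by (subst integral_distr) (auto simp: M_def)
  also have "\<dots> = (\<integral>u. k u * h (Z (clamp1 u)) \<partial>nu)"
    unfolding M_def by (subst integral_density) (auto simp: k0)
  finally show ?thesis unfolding Z_def k_def by (simp add: mult.commute)
qed

section \<open>A Prekopa-Leindler inequality for random interpolation\<close>

lemma ln_interpolate_ge:
  fixes a b t :: real
  assumes "0 < a" "0 < b" "0 \<le> t" "t \<le> 1"
  shows "(1 - t) * ln a + t * ln b \<le> ln ((1 - t) * a + t * b)"
proof -
  have "concave_on {0<..} ln" by (rule ln_concave)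
  then show ?thesis using assms by (auto simp: concave_on_iff)
qed

text \<open>
Transport proof of the Prekopa-Leindler inequality, averaged over the interpolation parameter. For
each \<open>\<omega>\<close> the integral of \<open>h \<omega>\<close> is rewritten by the substitution through interpolated quantiles; Jensen's
inequality moves the logarithm inside, and the concavity of \<open>ln\<close> bounds the derivative of the
substitution from below. Averaging over \<open>\<omega>\<close> then leaves, for each \<open>u\<close>, exactly the hypothesis at the
points \<open>X u\<close> and \<open>Y u\<close>. The function \<open>h\<close> may depend on \<open>\<omega>\<close>, which is what the induction over the
dimension needs.
\<close>

lemma prekopa_leindler_line:
  fixes P :: "'w measure" and h :: "'w \<Rightarrow> real \<Rightarrow> real"
  assumes P: "prob_space P" and th [measurable]: "\<theta> \<in> borel_measurable P"
    and th01: "\<And>\<omega>. 0 \<le> \<theta> \<omega>" "\<And>\<omega>. \<theta> \<omega> \<le> 1"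
    and fm [measurable]: "f \<in> borel_measurable borel" and gm [measurable]: "g \<in> borel_measurable borel"
    and hm [measurable]: "case_prod h \<in> borel_measurable (P \<Otimes>\<^sub>M borel)"
    and c: "0 < c" and f: "\<And>x. c \<le> f x" "\<And>x. f x \<le> C" and g: "\<And>x. c \<le> g x" "\<And>x. g x \<le> C"
    and h: "\<And>\<omega> x. c \<le> h \<omega> x" "\<And>\<omega> x. h \<omega> x \<le> C"
    and hyp: "\<And>x y. (1 - (\<integral>\<omega>. \<theta> \<omega> \<partial>P)) * ln (f x) + (\<integral>\<omega>. \<theta> \<omega> \<partial>P) * ln (g y)
        \<le> (\<integral>\<omega>. ln (h \<omega> ((1 - \<theta> \<omega>) * x + \<theta> \<omega> * y)) \<partial>P)"
  shows "(1 - (\<integral>\<omega>. \<theta> \<omega> \<partial>P)) * ln (\<integral>x. f x \<partial>nu) + (\<integral>\<omega>. \<theta> \<omega> \<partial>P) * ln (\<integral>x. g x \<partial>nu)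
      \<le> (\<integral>\<omega>. ln (\<integral>x. h \<omega> x \<partial>nu) \<partial>P)"
proof -
  interpret P: prob_space P by fact
  interpret nu: prob_space nu by (rule prob_space_nu)
  interpret pair_sigma_finite P nu ..
  interpret PN: pair_prob_space P nu ..
  define \<tau> where "\<tau> = (\<integral>\<omega>. \<theta> \<omega> \<partial>P)"
  have cC: "c \<le> C" using f[of 0] by linarith
  have bdd_int: "integrable nu q" if "q \<in> borel_measurable borel" "\<And>x. c' \<le> q x" "\<And>x. q x \<le> C'" for q :: "real \<Rightarrow> real" and c' C'
  proof (rule nu.integrable_const_bound[where B="max \<bar>c'\<bar> \<bar>C'\<bar>"])
    show "AE x in nu. norm (q x) \<le> max \<bar>c'\<bar> \<bar>C'\<bar>"
    proof (rule AE_I2)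
      fix x show "norm (q x) \<le> max \<bar>c'\<bar> \<bar>C'\<bar>" using that(2)[of x] that(3)[of x] by auto
    qed
  qed (use that in simp)
  define A where "A = (\<integral>x. f x \<partial>nu)"
  define B where "B = (\<integral>x. g x \<partial>nu)"
  have int_bds: "c \<le> (\<integral>x. q x \<partial>nu)" "(\<integral>x. q x \<partial>nu) \<le> C"
    if "q \<in> borel_measurable borel" "\<And>x. c \<le> q x" "\<And>x. q x \<le> C" for q :: "real \<Rightarrow> real"
    using nu.integral_ge_const[OF bdd_int[OF that], of c] nu.integral_le_const[OF bdd_int[OF that], of C] that by auto
  have A: "c \<le> A" "A \<le> C" and B: "c \<le> B" "B \<le> C"
    unfolding A_def B_def using int_bds[OF fm f] int_bds[OF gm g] by auto
  have Ap: "0 < A" "0 < B" using A B c by auto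
  have Cp: "0 < C" using c cC by auto
  have fdb: "c / C \<le> f x / A" "f x / A \<le> C / c" for x
    using f[of x] A c Ap Cp by (auto intro!: frac_le)
  have gdb: "c / C \<le> g x / B" "g x / B \<le> C / c" for x
    using g[of x] B c Ap Cp by (auto intro!: frac_le)
  have fdm [measurable]: "(\<lambda>x. f x / A) \<in> borel_measurable borel" and gdm [measurable]: "(\<lambda>x. g x / B) \<in> borel_measurable borel" by auto
  have cc: "0 < c / C" using c Cp by simp
  have onef: "(\<integral>x. f x / A \<partial>nu) = 1" and oneg: "(\<integral>x. g x / B \<partial>nu) = 1"
    using Ap by (auto simp: A_def[symmetric] B_def[symmetric])
  obtain X where X: "continuous_on {-1..1} X" "strict_mono_on {-1..1} X" "X (-1) = -1" "X 1 = 1"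
      "distr nu borel (\<lambda>u. X (clamp1 u)) = density nu (\<lambda>x. ennreal (f x / A))"
    by (rule quantile_exists[OF fdm cc fdb onef])
  obtain Y where Y: "continuous_on {-1..1} Y" "strict_mono_on {-1..1} Y" "Y (-1) = -1" "Y 1 = 1"
      "distr nu borel (\<lambda>u. Y (clamp1 u)) = density nu (\<lambda>x. ennreal (g x / B))"
    by (rule quantile_exists[OF gdm cc gdb oneg])
  define X' where "X' u = X (clamp1 u)" for u
  define Y' where "Y' u = Y (clamp1 u)" for u
  have [measurable]: "X' \<in> borel_measurable borel" "Y' \<in> borel_measurable borel"
    unfolding X'_def Y'_def
    using borel_measurable_continuous_onI[OF continuous_on_compose_clamp1] X(1) Y(1) by auto
  define Z where "Z \<omega> u = (1 - \<theta> \<omega>) * X' u + \<theta> \<omega> * Y' u" for \<omega> u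
  \<comment> \<open>the derivative of the interpolated quantile function \<open>Z \<omega>\<close>\<close>
  define k where "k \<omega> u = (1 - \<theta> \<omega>) / (f (X' u) / A) + \<theta> \<omega> / (g (Y' u) / B)" for \<omega> u
  have hm1 [measurable]: "h \<omega> \<in> borel_measurable borel" if "\<omega> \<in> space P" for \<omega>
    using measurable_compose[OF measurable_Pair1'[OF that] hm] by simp
  have step1: "(\<integral>u. h \<omega> (Z \<omega> u) * k \<omega> u \<partial>nu) = (\<integral>x. h \<omega> x \<partial>nu)" if "\<omega> \<in> space P" for \<omega>
    unfolding Z_def k_def X'_def Y'_def
    by (rule integral_interpolated_quantiles[OF fdm gdm hm1[OF that] cc fdb(1) gdb(1) _ _ X Y th01])
       (use h c in \<open>auto intro: order_trans[of 0 c]\<close>)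
  have kb: "c / C \<le> k \<omega> u" "k \<omega> u \<le> C / c" for \<omega> u
  proof -
    have 1: "c / C \<le> 1 / (f (X' u) / A)" "1 / (f (X' u) / A) \<le> C / c"
      "c / C \<le> 1 / (g (Y' u) / B)" "1 / (g (Y' u) / B) \<le> C / c"
      using f[of "X' u"] g[of "Y' u"] A B c Ap Cp by (auto intro!: frac_le)
    have "k \<omega> u = (1 - \<theta> \<omega>) * (1 / (f (X' u) / A)) + \<theta> \<omega> * (1 / (g (Y' u) / B))"
      unfolding k_def by simp
    then show "c / C \<le> k \<omega> u" "k \<omega> u \<le> C / c"
      using 1 th01[of \<omega>] convex_bound_le[of "1 / (f (X' u) / A)" "C/c" "1 / (g (Y' u) / B)" "1 - \<theta> \<omega>" "\<theta> \<omega>"]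
        convex_bound_le[of "- (1 / (f (X' u) / A))" "- (c/C)" "- (1 / (g (Y' u) / B))" "1 - \<theta> \<omega>" "\<theta> \<omega>"] by auto
  qed
  \<comment> \<open>the integrand of the hypothesis at the points \<open>X u\<close>, \<open>Y u\<close>, with normalized densities\<close>
  define q where "q \<omega> u = ln (h \<omega> (Z \<omega> u)) - (1 - \<theta> \<omega>) * ln (f (X' u) / A) - \<theta> \<omega> * ln (g (Y' u) / B)" for \<omega> u
  have [measurable]: "(\<lambda>(\<omega>, u). Z \<omega> u) \<in> borel_measurable (P \<Otimes>\<^sub>M nu)"
    unfolding Z_def by measurable
  have [measurable]: "(\<lambda>(\<omega>, u). h \<omega> (Z \<omega> u)) \<in> borel_measurable (P \<Otimes>\<^sub>M nu)"
  proof -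
    have "(\<lambda>p. (fst p, Z (fst p) (snd p))) \<in> measurable (P \<Otimes>\<^sub>M nu) (P \<Otimes>\<^sub>M borel)"
      by measurable
    from measurable_compose[OF this hm] show ?thesis by (simp add: case_prod_beta')
  qed
  have qm [measurable]: "(\<lambda>(\<omega>, u). q \<omega> u) \<in> borel_measurable (P \<Otimes>\<^sub>M nu)"
    unfolding q_def by measurable
  have lnb: "ln c \<le> ln x" "ln x \<le> ln C" "\<bar>ln x\<bar> \<le> \<bar>ln c\<bar> + \<bar>ln C\<bar>" if "c \<le> x" "x \<le> C" for x
    using that c Cp cC by (smt (verit) ln_le_cancel_iff)+
  have lnb2: "\<bar>ln x\<bar> \<le> \<bar>ln (c/C)\<bar> + \<bar>ln (C/c)\<bar>" if "c/C \<le> x" "x \<le> C/c" for x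
    using that cc by (smt (verit) ln_le_cancel_iff)
  define D where "D = \<bar>ln c\<bar> + \<bar>ln C\<bar> + \<bar>ln (c/C)\<bar> + \<bar>ln (C/c)\<bar>"
  have comb: "\<bar>(1 - \<theta> \<omega>) * a + \<theta> \<omega> * b\<bar> \<le> E" if "\<bar>a\<bar> \<le> E" "\<bar>b\<bar> \<le> E" for a b E :: real and \<omega>
  proof -
    have "(1 - \<theta> \<omega>) * a + \<theta> \<omega> * b \<le> E" "(1 - \<theta> \<omega>) * (-a) + \<theta> \<omega> * (-b) \<le> E"
      using that th01[of \<omega>] by (intro convex_bound_le; simp add: abs_le_iff)+
    then show ?thesis by (simp add: abs_le_iff)
  qed
  have qb: "\<bar>q \<omega> u\<bar> \<le> D" for \<omega> u
    using lnb(3)[OF h, of \<omega> "Z \<omega> u"] comb[OF lnb2[OF fdb] lnb2[OF gdb], of \<omega> "X' u" "Y' u"]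
    unfolding q_def D_def by linarith
  have qint: "integrable (P \<Otimes>\<^sub>M nu) (\<lambda>(\<omega>, u). q \<omega> u)"
    by (rule PN.integrable_const_bound[where B=D]) (use qb in \<open>auto simp: case_prod_beta'\<close>)
  have step2: "(\<integral>u. q \<omega> u \<partial>nu) \<le> ln (\<integral>x. h \<omega> x \<partial>nu)" if w: "\<omega> \<in> space P" for \<omega>
  proof -
    have hm2 [measurable]: "h \<omega> \<in> borel_measurable borel" by (rule hm1[OF w])
    have zm [measurable]: "Z \<omega> \<in> borel_measurable borel" "k \<omega> \<in> borel_measurable borel" unfolding Z_def k_def by measurable
    have qm1 [measurable]: "q \<omega> \<in> borel_measurable borel" unfolding q_def by measurable
    let ?v = "\<lambda>u. h \<omega> (Z \<omega> u) * k \<omega> u"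
    have vb: "c * (c / C) \<le> ?v u" "?v u \<le> C * (C / c)" for u
    proof -
      have hk: "0 < h \<omega> (Z \<omega> u)" "0 < k \<omega> u"
        by (rule less_le_trans[OF c h(1)], rule less_le_trans[OF cc kb(1)])
      show "c * (c / C) \<le> ?v u"
        by (rule mult_mono[OF h(1) kb(1)]) (use hk cc in auto)
      show "?v u \<le> C * (C / c)"
        by (rule mult_mono[OF h(2) kb(2)]) (use hk Cp in auto)
    qed
    have vp: "0 < c * (c / C)" by (rule mult_pos_pos[OF c cc])
    have iv: "integrable nu ?v" by (rule bdd_int[OF _ vb]) simp
    have il: "integrable nu (\<lambda>u. ln (?v u))"
      by (rule bdd_int[of _ "ln (c * (c/C))" "ln (C * (C/c))"]) (use vb vp in \<open>auto intro!: ln_mono less_le_trans[OF vp] simp del: times_divide_eq_right\<close>)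
    have iq: "integrable nu (q \<omega>)"
    proof (rule bdd_int[of _ "-D" D])
      show "- D \<le> q \<omega> x" "q \<omega> x \<le> D" for x using qb[of \<omega> x] by auto
    qed simp
    have "(\<integral>u. q \<omega> u \<partial>nu) \<le> (\<integral>u. ln (?v u) \<partial>nu)"
    proof (rule integral_mono[OF iq il])
      fix u
      have hp: "0 < h \<omega> (Z \<omega> u)" and kp: "0 < k \<omega> u"
        by (rule less_le_trans[OF c h(1)], rule less_le_trans[OF cc kb(1)])
      have fp: "0 < f (X' u)" "0 < g (Y' u)" using f[of "X' u"] g[of "Y' u"] c by auto
      have "(1 - \<theta> \<omega>) * ln (A / f (X' u)) + \<theta> \<omega> * ln (B / g (Y' u))
        \<le> ln ((1 - \<theta> \<omega>) * (A / f (X' u)) + \<theta> \<omega> * (B / g (Y' u)))"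
        by (rule ln_interpolate_ge) (use fp Ap th01 in auto)
      moreover have "k \<omega> u = (1 - \<theta> \<omega>) * (A / f (X' u)) + \<theta> \<omega> * (B / g (Y' u))"
        unfolding k_def by simp
      ultimately have "- (1 - \<theta> \<omega>) * ln (f (X' u) / A) - \<theta> \<omega> * ln (g (Y' u) / B) \<le> ln (k \<omega> u)"
        using fp Ap by (simp add: ln_div algebra_simps)
      then show "q \<omega> u \<le> ln (?v u)"
        using hp kp unfolding q_def by (simp add: ln_mult algebra_simps)
    qed
    also have "\<dots> \<le> ln (\<integral>u. ?v u \<partial>nu)"
    proof -
      have "- ln (nu.expectation ?v) \<le> nu.expectation (\<lambda>u. - ln (?v u))"
      proof (rule nu.jensens_inequality[OF iv, where I="{0<..}" and q="\<lambda>x. - ln x"])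
        show "AE x in nu. ?v x \<in> {0<..}" using vb(1) vp by (auto intro!: AE_I2 less_le_trans[OF vp] simp del: times_divide_eq_right)
        show "convex_on {0<..} (\<lambda>x::real. - ln x)"
          using ln_concave by (simp add: concave_on_def)
      qed (use il in auto)
      then show ?thesis using il by simp
    qed
    also have "\<dots> = ln (\<integral>x. h \<omega> x \<partial>nu)" using step1[OF w] by simp
    finally show ?thesis .
  qed
  have "(1 - \<tau>) * ln A + \<tau> * ln B \<le> (\<integral>u. (\<integral>\<omega>. q \<omega> u \<partial>P) \<partial>nu)"
  proof -
    have tint: "integrable P \<theta>"
      by (rule P.integrable_const_bound[where B=1]) (use th01 in auto)
    have pt: "(1 - \<tau>) * ln A + \<tau> * ln B \<le> (\<integral>\<omega>. q \<omega> u \<partial>P)" for u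
    proof -
      have m: "(\<lambda>\<omega>. h \<omega> (Z \<omega> u)) \<in> borel_measurable P"
      proof -
        have "(\<lambda>\<omega>. (\<omega>, u)) \<in> measurable P (P \<Otimes>\<^sub>M nu)" by simp
        from measurable_compose[OF this, of "\<lambda>(\<omega>, u). h \<omega> (Z \<omega> u)" borel] show ?thesis by simp
      qed
      have i: "integrable P (\<lambda>\<omega>. ln (h \<omega> (Z \<omega> u)))"
        by (rule P.integrable_const_bound[where B="\<bar>ln c\<bar> + \<bar>ln C\<bar>"]) (use m lnb(3)[OF h] in auto)
      have fp: "0 < f (X' u)" "0 < g (Y' u)" using f[of "X' u"] g[of "Y' u"] c by auto
      have "(\<integral>\<omega>. q \<omega> u \<partial>P) = (\<integral>\<omega>. ln (h \<omega> (Z \<omega> u)) \<partial>P) - (1 - \<tau>) * ln (f (X' u) / A) - \<tau> * ln (g (Y' u) / B)"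
        unfolding q_def \<tau>_def using i tint by (simp add: P.prob_space)
      also have "\<dots> \<ge> (1 - \<tau>) * ln (f (X' u)) + \<tau> * ln (g (Y' u)) - (1 - \<tau>) * ln (f (X' u) / A) - \<tau> * ln (g (Y' u) / B)"
        using hyp[of "X' u" "Y' u"] unfolding Z_def \<tau>_def by simp
      also have "(1 - \<tau>) * ln (f (X' u)) + \<tau> * ln (g (Y' u)) - (1 - \<tau>) * ln (f (X' u) / A) - \<tau> * ln (g (Y' u) / B)
          = (1 - \<tau>) * ln A + \<tau> * ln B"
        using fp Ap by (simp add: ln_div algebra_simps)
      finally show ?thesis .
    qed
    have "integrable nu (\<lambda>u. \<integral>\<omega>. q \<omega> u \<partial>P)"
      using integrable_snd[OF qint] by simp
    then show ?thesis using pt by (intro nu.integral_ge_const) auto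
  qed
  also have "\<dots> = (\<integral>\<omega>. (\<integral>u. q \<omega> u \<partial>nu) \<partial>P)"
    by (rule Fubini_integral[OF qint])
  also have "\<dots> \<le> (\<integral>\<omega>. ln (\<integral>x. h \<omega> x \<partial>nu) \<partial>P)"
  proof (rule integral_mono[OF _ _ step2])
    show "integrable P (\<lambda>\<omega>. \<integral>u. q \<omega> u \<partial>nu)" using integrable_fst[OF qint] by simp
    have [measurable]: "case_prod h \<in> borel_measurable (P \<Otimes>\<^sub>M nu)"
      using hm by (simp cong: measurable_cong_sets)
    have "(\<lambda>\<omega>. ln (\<integral>x. h \<omega> x \<partial>nu)) \<in> borel_measurable P" by measurable
    then show "integrable P (\<lambda>\<omega>. ln (\<integral>x. h \<omega> x \<partial>nu))"
      by (rule P.integrable_const_bound[where B="\<bar>ln c\<bar> + \<bar>ln C\<bar>", rotated])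
         (use lnb(3) int_bds[OF hm1 h] in auto)
  qed
  finally show ?thesis unfolding \<tau>_def A_def B_def .
qed

text \<open>
Induction over the coordinates: freezing one coordinate and integrating out the others produces
functions of one variable, dependent on \<open>\<omega>\<close>, which satisfy the one-dimensional hypothesis by the
induction hypothesis.
\<close>

lemma prekopa_leindler_PiM:
  fixes P :: "'w measure" and I :: "'i set"
  assumes I: "finite I" and P: "prob_space P" and th [measurable]: "\<theta> \<in> borel_measurable P"
    and th01: "\<And>\<omega>. 0 \<le> \<theta> \<omega>" "\<And>\<omega>. \<theta> \<omega> \<le> 1" and c: "0 < c"
    and "f \<in> borel_measurable (PiM I (\<lambda>_. nu))" "g \<in> borel_measurable (PiM I (\<lambda>_. nu))"
    and "case_prod h \<in> borel_measurable (P \<Otimes>\<^sub>M PiM I (\<lambda>_. nu))"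
    and "\<And>x. c \<le> f x" "\<And>x. f x \<le> C" and "\<And>x. c \<le> g x" "\<And>x. g x \<le> C"
    and "\<And>\<omega> x. c \<le> h \<omega> x" "\<And>\<omega> x. h \<omega> x \<le> C"
    and "\<And>x y. (1 - (\<integral>\<omega>. \<theta> \<omega> \<partial>P)) * ln (f x) + (\<integral>\<omega>. \<theta> \<omega> \<partial>P) * ln (g y)
        \<le> (\<integral>\<omega>. ln (h \<omega> (\<lambda>i\<in>I. (1 - \<theta> \<omega>) * x i + \<theta> \<omega> * y i)) \<partial>P)"
  shows "(1 - (\<integral>\<omega>. \<theta> \<omega> \<partial>P)) * ln (\<integral>x. f x \<partial>PiM I (\<lambda>_. nu)) + (\<integral>\<omega>. \<theta> \<omega> \<partial>P) * ln (\<integral>x. g x \<partial>PiM I (\<lambda>_. nu))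
      \<le> (\<integral>\<omega>. ln (\<integral>x. h \<omega> x \<partial>PiM I (\<lambda>_. nu)) \<partial>P)"
  using I assms(7-)
proof (induction I arbitrary: f g h rule: finite_induct)
  case empty
  have e: "(\<integral>x. q x \<partial>PiM {} (\<lambda>_. nu)) = q (\<lambda>k. undefined)" for q :: "('i \<Rightarrow> real) \<Rightarrow> real"
    by (simp add: PiM_empty lebesgue_integral_count_space_finite)
  have "(\<lambda>i\<in>{}. z i) = (\<lambda>k. undefined)" for z :: "'i \<Rightarrow> real" by auto
  then show ?case unfolding e using empty.prems(10)[of "\<lambda>k. undefined" "\<lambda>k. undefined"] by simp
next
  case (insert i I)
  interpret N: prob_space nu by (rule prob_space_nu)
  interpret product_sigma_finite "\<lambda>_::'i. nu"
    by (rule product_sigma_finite.intro) (rule prob_space_imp_sigma_finite[OF prob_space_nu])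
  interpret PI: prob_space "PiM I (\<lambda>_. nu)"
    by (rule prob_space_PiM) (rule prob_space_nu)
  interpret PJ: prob_space "PiM (insert i I) (\<lambda>_. nu)"
    by (rule prob_space_PiM) (rule prob_space_nu)
  interpret P: prob_space P by fact
  note fm = insert.prems(1) and gm = insert.prems(2) and hm = insert.prems(3)
  note fb = insert.prems(4,5) and gb = insert.prems(6,7) and hb = insert.prems(8,9) and hyp = insert.prems(10)
  define \<tau> where "\<tau> = (\<integral>\<omega>. \<theta> \<omega> \<partial>P)"
  let ?N = "PiM I (\<lambda>_. nu)" and ?J = "PiM (insert i I) (\<lambda>_. nu)"
  have int: "integrable ?J q" if "q \<in> borel_measurable ?J" "\<And>x. c \<le> q x" "\<And>x. q x \<le> C" for q
  proof (rule PJ.integrable_const_bound[where B="max \<bar>c\<bar> \<bar>C\<bar>"])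
    show "AE x in ?J. norm (q x) \<le> max \<bar>c\<bar> \<bar>C\<bar>"
    proof (rule AE_I2)
      fix x show "norm (q x) \<le> max \<bar>c\<bar> \<bar>C\<bar>" using that(2)[of x] that(3)[of x] by auto
    qed
  qed (use that in simp)
  have intI: "integrable ?N q" if "q \<in> borel_measurable ?N" "\<And>x. c \<le> q x" "\<And>x. q x \<le> C" for q
  proof (rule PI.integrable_const_bound[where B="max \<bar>c\<bar> \<bar>C\<bar>"])
    show "AE x in ?N. norm (q x) \<le> max \<bar>c\<bar> \<bar>C\<bar>"
    proof (rule AE_I2)
      fix x show "norm (q x) \<le> max \<bar>c\<bar> \<bar>C\<bar>" using that(2)[of x] that(3)[of x] by auto
    qed
  qed (use that in simp)
  have upd: "(\<lambda>p. (snd p)(i := fst p)) \<in> measurable (nu \<Otimes>\<^sub>M ?N) ?J"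
    using measurable_add_dim[of i I "\<lambda>_. nu"] measurable_compose[OF measurable_pair_swap' measurable_add_dim[of i I "\<lambda>_. nu"]]
    by (simp add: case_prod_beta')
  have updx: "(\<lambda>x. x(i := \<xi>)) \<in> measurable ?N ?J" for \<xi>
    using measurable_compose[OF measurable_Pair1'[of \<xi> nu ?N] upd] by simp
  have bnd: "c \<le> (\<integral>x. q x \<partial>?N)" "(\<integral>x. q x \<partial>?N) \<le> C" if "q \<in> borel_measurable ?N" "\<And>x. c \<le> q x" "\<And>x. q x \<le> C" for q
    using PI.integral_ge_const[OF intI[OF that], of c] PI.integral_le_const[OF intI[OF that], of C] that by auto
  have margm: "(\<lambda>\<xi>. \<integral>x. q (x(i := \<xi>)) \<partial>?N) \<in> borel_measurable borel" if "q \<in> borel_measurable ?J" for q :: "('i \<Rightarrow> real) \<Rightarrow> real"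
  proof -
    have "(\<lambda>p. q ((snd p)(i := fst p))) \<in> borel_measurable (nu \<Otimes>\<^sub>M ?N)"
      by (rule measurable_compose[OF upd that])
    then have "(\<lambda>(\<xi>, x). q (x(i := \<xi>))) \<in> borel_measurable (nu \<Otimes>\<^sub>M ?N)"
      by (simp add: case_prod_beta')
    from PI.borel_measurable_lebesgue_integral[OF this] show ?thesis by simp
  qed
  have fub: "(\<integral>x. q x \<partial>?J) = (\<integral>\<xi>. (\<integral>x. q (x(i := \<xi>)) \<partial>?N) \<partial>nu)"
    if q: "q \<in> borel_measurable ?J" "\<And>x. c \<le> q x" "\<And>x. q x \<le> C" for q
  proof -
    have "(\<integral>x. q x \<partial>?J) = (\<integral>x. (\<integral>y. q (merge {i} I (x, y)) \<partial>?N) \<partial>PiM {i} (\<lambda>_. nu))"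
      using product_integral_fold[of "{i}" I q] int[OF q] insert.hyps by simp
    also have "\<dots> = (\<integral>x. (\<integral>y. q (y(i := x i)) \<partial>?N) \<partial>PiM {i} (\<lambda>_. nu))"
    proof (intro Bochner_Integration.integral_cong refl arg_cong[where f=q])
      fix x y assume "x \<in> space (PiM {i} (\<lambda>_. nu))" "y \<in> space ?N"
      then show "merge {i} I (x, y) = y(i := x i)"
        using insert.hyps by (auto simp: fun_eq_iff merge_def space_PiM PiE_def extensional_def)
    qed
    also have "\<dots> = (\<integral>\<xi>. (\<integral>x. q (x(i := \<xi>)) \<partial>?N) \<partial>nu)"
      by (rule product_integral_singleton) (use margm[OF q(1)] in simp)
    finally show ?thesis .
  qed
  define F where "F \<xi> = (\<integral>x. f (x(i := \<xi>)) \<partial>?N)" for \<xi>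
  define G where "G \<xi> = (\<integral>x. g (x(i := \<xi>)) \<partial>?N)" for \<xi>
  define H where "H \<omega> \<xi> = (if \<omega> \<in> space P then (\<integral>x. h \<omega> (x(i := \<xi>)) \<partial>?N) else c)" for \<omega> \<xi>
  have cC: "c \<le> C" using fb[of undefined] by linarith
  have h1: "h \<omega> \<in> borel_measurable ?J" if "\<omega> \<in> space P" for \<omega>
    using measurable_compose[OF measurable_Pair1'[OF that] hm] by simp
  have "(1 - \<tau>) * ln (\<integral>\<xi>. F \<xi> \<partial>nu) + \<tau> * ln (\<integral>\<xi>. G \<xi> \<partial>nu) \<le> (\<integral>\<omega>. ln (\<integral>\<xi>. H \<omega> \<xi> \<partial>nu) \<partial>P)"
    unfolding \<tau>_def
  proof (rule prekopa_leindler_line[OF P th th01 _ _ _ c])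
    show "F \<in> borel_measurable borel" "G \<in> borel_measurable borel"
      unfolding F_def G_def using margm fm gm by auto
    show "c \<le> F x" "F x \<le> C" "c \<le> G x" "G x \<le> C" for x
      unfolding F_def G_def
      by (rule bnd[OF measurable_compose[OF updx fm] fb] bnd[OF measurable_compose[OF updx gm] gb])+
    show "c \<le> H \<omega> x" "H \<omega> x \<le> C" for \<omega> x
      using bnd[OF measurable_compose[OF updx[of x] h1[of \<omega>]] hb] cC by (simp_all add: H_def del: fun_upd_apply)
    show "case_prod H \<in> borel_measurable (P \<Otimes>\<^sub>M borel)"
    proof -
      have "(\<lambda>q. (fst (fst q), (snd q)(i := snd (fst q)))) \<in> measurable ((P \<Otimes>\<^sub>M nu) \<Otimes>\<^sub>M ?N) (P \<Otimes>\<^sub>M ?J)"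
      proof (rule measurable_Pair)
        have "(\<lambda>q. (snd (fst q), snd q)) \<in> measurable ((P \<Otimes>\<^sub>M nu) \<Otimes>\<^sub>M ?N) (nu \<Otimes>\<^sub>M ?N)" by simp
        from measurable_compose[OF this upd]
        show "(\<lambda>q. (snd q)(i := snd (fst q))) \<in> measurable ((P \<Otimes>\<^sub>M nu) \<Otimes>\<^sub>M ?N) ?J" by simp
      qed simp
      from measurable_compose[OF this hm]
      have "(\<lambda>(p, x). h (fst p) (x(i := snd p))) \<in> borel_measurable ((P \<Otimes>\<^sub>M nu) \<Otimes>\<^sub>M ?N)"
        by (simp add: case_prod_beta')
      from PI.borel_measurable_lebesgue_integral[OF this]
      have m: "(\<lambda>p. \<integral>x. h (fst p) (x(i := snd p)) \<partial>?N) \<in> borel_measurable (P \<Otimes>\<^sub>M nu)" by simp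
      have "case_prod H \<in> borel_measurable (P \<Otimes>\<^sub>M nu) \<longleftrightarrow> (\<lambda>p. \<integral>x. h (fst p) (x(i := snd p)) \<partial>?N) \<in> borel_measurable (P \<Otimes>\<^sub>M nu)"
        by (rule measurable_cong) (auto simp: H_def space_pair_measure)
      with m show ?thesis by (simp cong: measurable_cong_sets)
    qed
    fix \<xi> \<eta> :: real
    define hh where "hh \<omega> x = (if \<omega> \<in> space P then h \<omega> (x(i := (1 - \<theta> \<omega>) * \<xi> + \<theta> \<omega> * \<eta>)) else c)" for \<omega> x
    have "(1 - (\<integral>\<omega>. \<theta> \<omega> \<partial>P)) * ln (\<integral>x. f (x(i := \<xi>)) \<partial>?N) + (\<integral>\<omega>. \<theta> \<omega> \<partial>P) * ln (\<integral>x. g (x(i := \<eta>)) \<partial>?N)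
      \<le> (\<integral>\<omega>. ln (\<integral>x. hh \<omega> x \<partial>?N) \<partial>P)"
    proof (rule insert.IH)
      show "(\<lambda>x. f (x(i := \<xi>))) \<in> borel_measurable ?N" "(\<lambda>x. g (x(i := \<eta>))) \<in> borel_measurable ?N"
        by (rule measurable_compose[OF updx fm] measurable_compose[OF updx gm])+
      have "(\<lambda>q. (fst q, (snd q)(i := (1 - \<theta> (fst q)) * \<xi> + \<theta> (fst q) * \<eta>))) \<in> measurable (P \<Otimes>\<^sub>M ?N) (P \<Otimes>\<^sub>M ?J)"
      proof (rule measurable_Pair)
        have "(\<lambda>q. ((1 - \<theta> (fst q)) * \<xi> + \<theta> (fst q) * \<eta>, snd q)) \<in> measurable (P \<Otimes>\<^sub>M ?N) (nu \<Otimes>\<^sub>M ?N)" by measurable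
        from measurable_compose[OF this upd]
        show "(\<lambda>q. (snd q)(i := (1 - \<theta> (fst q)) * \<xi> + \<theta> (fst q) * \<eta>)) \<in> measurable (P \<Otimes>\<^sub>M ?N) ?J" by simp
      qed simp
      from measurable_compose[OF this hm]
      have m: "(\<lambda>q. h (fst q) ((snd q)(i := (1 - \<theta> (fst q)) * \<xi> + \<theta> (fst q) * \<eta>))) \<in> borel_measurable (P \<Otimes>\<^sub>M ?N)" by simp
      have "case_prod hh \<in> borel_measurable (P \<Otimes>\<^sub>M ?N) \<longleftrightarrow> (\<lambda>q. h (fst q) ((snd q)(i := (1 - \<theta> (fst q)) * \<xi> + \<theta> (fst q) * \<eta>))) \<in> borel_measurable (P \<Otimes>\<^sub>M ?N)"
        by (rule measurable_cong) (auto simp: hh_def space_pair_measure)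
      with m show "case_prod hh \<in> borel_measurable (P \<Otimes>\<^sub>M ?N)" by simp
      show "c \<le> hh \<omega> x" "hh \<omega> x \<le> C" for \<omega> x unfolding hh_def using hb cC by auto
      fix x y :: "'i \<Rightarrow> real"
      have "(\<lambda>j\<in>insert i I. (1 - \<theta> \<omega>) * (x(i := \<xi>)) j + \<theta> \<omega> * (y(i := \<eta>)) j)
        = (\<lambda>j\<in>I. (1 - \<theta> \<omega>) * x j + \<theta> \<omega> * y j)(i := (1 - \<theta> \<omega>) * \<xi> + \<theta> \<omega> * \<eta>)" for \<omega>
        using insert.hyps by (auto simp: fun_eq_iff)
      then have "(\<integral>\<omega>. ln (h \<omega> (\<lambda>j\<in>insert i I. (1 - \<theta> \<omega>) * (x(i := \<xi>)) j + \<theta> \<omega> * (y(i := \<eta>)) j)) \<partial>P)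
        = (\<integral>\<omega>. ln (hh \<omega> (\<lambda>j\<in>I. (1 - \<theta> \<omega>) * x j + \<theta> \<omega> * y j)) \<partial>P)"
        by (intro Bochner_Integration.integral_cong) (auto simp: hh_def)
      then show "(1 - (\<integral>\<omega>. \<theta> \<omega> \<partial>P)) * ln (f (x(i := \<xi>))) + (\<integral>\<omega>. \<theta> \<omega> \<partial>P) * ln (g (y(i := \<eta>)))
        \<le> (\<integral>\<omega>. ln (hh \<omega> (\<lambda>j\<in>I. (1 - \<theta> \<omega>) * x j + \<theta> \<omega> * y j)) \<partial>P)"
        using hyp[of "x(i := \<xi>)" "y(i := \<eta>)"] by (simp only:)
    qed (use fb gb in auto)
    also have "\<dots> = (\<integral>\<omega>. ln (H \<omega> ((1 - \<theta> \<omega>) * \<xi> + \<theta> \<omega> * \<eta>)) \<partial>P)"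
      by (intro Bochner_Integration.integral_cong) (auto simp: hh_def H_def)
    finally show "(1 - (\<integral>\<omega>. \<theta> \<omega> \<partial>P)) * ln (F \<xi>) + (\<integral>\<omega>. \<theta> \<omega> \<partial>P) * ln (G \<eta>)
        \<le> (\<integral>\<omega>. ln (H \<omega> ((1 - \<theta> \<omega>) * \<xi> + \<theta> \<omega> * \<eta>)) \<partial>P)"
      unfolding F_def G_def .
  qed
  also have "(\<integral>\<omega>. ln (\<integral>\<xi>. H \<omega> \<xi> \<partial>nu) \<partial>P) = (\<integral>\<omega>. ln (\<integral>x. h \<omega> x \<partial>?J) \<partial>P)"
    by (intro Bochner_Integration.integral_cong) (simp_all add: H_def fub[OF h1 hb] del: fun_upd_apply)
  finally show ?case unfolding \<tau>_def F_def G_def fub[OF fm fb] fub[OF gm gb] .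
qed

lemma emeasure_nu_interval: "emeasure nu {l<..<u} = ennreal (max 0 (min 1 u - max (-1) l) / 2)"
proof -
  have "emeasure lborel ({-1..1} \<inter> {l<..<u}) = emeasure lborel {max (-1) l<..<min 1 u}"
  proof (rule emeasure_eq_AE)
    have "AE x in lborel. x \<noteq> (-1::real)" "AE x in lborel. x \<noteq> (1::real)" by (rule AE_lborel_singleton)+
    then show "AE x in lborel. x \<in> {-1..1} \<inter> {l<..<u} \<longleftrightarrow> x \<in> {max (-1) l<..<min 1 u}"
      by eventually_elim auto
  qed auto
  also have "\<dots> = ennreal (max 0 (min 1 u - max (-1) l))"
    by (cases "max (-1) l \<le> min 1 u") (auto simp: max_def)
  finally show ?thesis by (simp add: emeasure_nu divide_ennreal[symmetric])
qed

definition unit_cube :: "'a::euclidean_space measure" where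
  "unit_cube = uniform_measure lborel (box (- One) One)"

lemma sets_unit_cube [simp, measurable_cong]: "sets unit_cube = sets borel"
  by (simp add: unit_cube_def)

lemma emeasure_big_box: "emeasure lborel (box (- One) One :: 'a::euclidean_space set) = ennreal (2 ^ DIM('a))"
  by (subst emeasure_lborel_box) (auto simp: inner_diff_left inner_add_left)

lemma prob_space_unit_cube: "prob_space unit_cube"
  unfolding unit_cube_def by (rule prob_space_uniform_measure) (simp_all add: emeasure_big_box)

lemma unit_cube_eq_distr:
  "distr (PiM Basis (\<lambda>_. nu)) borel (\<lambda>x. \<Sum>b\<in>Basis. x b *\<^sub>R b) = (unit_cube :: 'a::euclidean_space measure)"
proof -
  interpret N: prob_space nu by (rule prob_space_nu)
  interpret product_prob_space "\<lambda>_::'a. nu" UNIV by unfold_locales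
  let ?E = "\<lambda>x. \<Sum>b\<in>Basis. x b *\<^sub>R b :: 'a"
  have Em [measurable]: "?E \<in> measurable (PiM Basis (\<lambda>_. nu)) borel" by measurable
  interpret K: prob_space "distr (PiM Basis (\<lambda>_. nu)) borel ?E"
  proof (rule prob_space.prob_space_distr[OF _ Em])
    show "prob_space (PiM Basis (\<lambda>_::'a. nu))" by (rule prob_space_PiM) (rule prob_space_nu)
  qed
  interpret U: prob_space "unit_cube :: 'a measure" by (rule prob_space_unit_cube)
  let ?B = "range (\<lambda>(a, b). box a b :: 'a set)"
  show ?thesis
  proof (rule measure_eqI_generator_eq)
    show "Int_stable ?B"
      by (auto simp: Int_stable_def box_Int_box)
    show "?B \<subseteq> Pow UNIV" "sets (distr (PiM Basis (\<lambda>_. nu)) borel ?E) = sigma_sets UNIV ?B"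
       "sets (unit_cube :: 'a measure) = sigma_sets UNIV ?B"
      by (simp_all add: borel_eq_box)
    let ?A = "\<lambda>n::nat. box (- (real n *\<^sub>R One)) (real n *\<^sub>R One) :: 'a set"
    show "range ?A \<subseteq> ?B" "(\<Union>i. ?A i) = UNIV"
      unfolding UN_box_eq_UNIV by auto
    show "emeasure (distr (PiM Basis (\<lambda>_. nu)) borel ?E) (?A i) \<noteq> \<infinity>" for i using K.emeasure_finite by simp
    fix X assume "X \<in> ?B"
    then obtain l u where X: "X = box l u" by auto
    define m where "m b = max 0 (min 1 (u \<bullet> b) - max (-1) (l \<bullet> b))" for b
    have "emeasure (distr (PiM Basis (\<lambda>_. nu)) borel ?E) X = emeasure (PiM Basis (\<lambda>_. nu)) (?E -` X \<inter> space (PiM Basis (\<lambda>_. nu)))"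
      unfolding X by (subst emeasure_distr) auto
    also have "?E -` X \<inter> space (PiM Basis (\<lambda>_. nu)) = (\<Pi>\<^sub>E b\<in>Basis. {l \<bullet> b<..<u \<bullet> b})"
      by (auto simp: X mem_box space_PiM PiE_iff)
    also have "emeasure (PiM Basis (\<lambda>_. nu)) \<dots> = (\<Prod>b\<in>Basis. emeasure nu {l \<bullet> b<..<u \<bullet> b})"
      by (rule emeasure_PiM) auto
    also have "\<dots> = (\<Prod>b\<in>Basis. ennreal (m b / 2))"
      by (simp add: emeasure_nu_interval m_def)
    also have "\<dots> = ennreal (\<Prod>b\<in>Basis. m b / 2)"
      by (rule prod_ennreal) (auto simp: m_def)
    also have "(\<Prod>b\<in>Basis. m b / 2) = (\<Prod>b\<in>Basis. m b) / 2 ^ DIM('a)"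
      by (simp add: prod_dividef)
    finally have 1: "emeasure (distr (PiM Basis (\<lambda>_. nu)) borel ?E) X = ennreal ((\<Prod>b\<in>Basis. m b) / 2 ^ DIM('a))" .
    let ?l = "\<Sum>b\<in>Basis. max (-1) (l \<bullet> b) *\<^sub>R b" and ?u = "\<Sum>b\<in>Basis. min 1 (u \<bullet> b) *\<^sub>R b"
    have bx: "box (- One) One \<inter> X = box ?l ?u"
      unfolding X box_Int_box by simp
    have "emeasure lborel (box ?l ?u) = ennreal (\<Prod>b\<in>Basis. m b)"
    proof (cases "\<forall>b\<in>Basis. ?l \<bullet> b \<le> ?u \<bullet> b")
      case True
      then have "m b = (?u - ?l) \<bullet> b" if "b \<in> Basis" for b
        using that by (auto simp: m_def inner_diff_left)
      then show ?thesis using True by (simp add: emeasure_lborel_box_eq)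
    next
      case False
      then obtain b where "b \<in> Basis" "m b = 0" by (force simp: m_def)
      then have "(\<Prod>b\<in>Basis. m b) = 0" by (simp add: prod_zero_iff) blast
      then show ?thesis using False by (simp only: emeasure_lborel_box_eq if_False ennreal_0)
    qed
    then have bX: "emeasure lborel (box (- One) One \<inter> X) = ennreal (\<Prod>b\<in>Basis. m b)"
      by (simp only: bx)
    have "emeasure unit_cube X = emeasure lborel (box (- One) One \<inter> X) / emeasure lborel (box (- One) One :: 'a set)"
      unfolding unit_cube_def by (rule emeasure_uniform_measure) (auto simp: X)
    also have "\<dots> = ennreal (\<Prod>b\<in>Basis. m b) / ennreal (2 ^ DIM('a))"
      by (simp only: bX emeasure_big_box)
    also have "\<dots> = ennreal ((\<Prod>b\<in>Basis. m b) / 2 ^ DIM('a))"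
      by (rule divide_ennreal) (auto simp: m_def intro: prod_nonneg)
    finally show "emeasure (distr (PiM Basis (\<lambda>_. nu)) borel ?E) X = emeasure unit_cube X" using 1 by simp
  qed
qed

lemma prekopa_leindler_euclidean:
  fixes P :: "'w measure" and f g h :: "'a::euclidean_space \<Rightarrow> real"
  assumes P: "prob_space P" and th [measurable]: "\<theta> \<in> borel_measurable P"
    and th01: "\<And>\<omega>. 0 \<le> \<theta> \<omega>" "\<And>\<omega>. \<theta> \<omega> \<le> 1" and c: "0 < c"
    and [measurable]: "f \<in> borel_measurable borel" "g \<in> borel_measurable borel" "h \<in> borel_measurable borel"
    and bounds: "\<And>x. c \<le> f x" "\<And>x. f x \<le> C" "\<And>x. c \<le> g x" "\<And>x. g x \<le> C" "\<And>x. c \<le> h x" "\<And>x. h x \<le> C"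
    and hyp: "\<And>x y. (1 - (\<integral>\<omega>. \<theta> \<omega> \<partial>P)) * ln (f x) + (\<integral>\<omega>. \<theta> \<omega> \<partial>P) * ln (g y)
        \<le> (\<integral>\<omega>. ln (h ((1 - \<theta> \<omega>) *\<^sub>R x + \<theta> \<omega> *\<^sub>R y)) \<partial>P)"
  shows "(1 - (\<integral>\<omega>. \<theta> \<omega> \<partial>P)) * ln (\<integral>x. f x \<partial>unit_cube) + (\<integral>\<omega>. \<theta> \<omega> \<partial>P) * ln (\<integral>x. g x \<partial>unit_cube)
      \<le> ln (\<integral>x. h x \<partial>unit_cube)"
proof -
  interpret P: prob_space P by fact
  let ?E = "\<lambda>x. \<Sum>b\<in>Basis. x b *\<^sub>R b :: 'a"
  let ?N = "PiM Basis (\<lambda>_::'a. nu)"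
  have Em [measurable]: "?E \<in> measurable ?N borel" by measurable
  have i: "(\<integral>x. q x \<partial>unit_cube) = (\<integral>x. q (?E x) \<partial>?N)" if "q \<in> borel_measurable borel" for q :: "'a \<Rightarrow> real"
    unfolding unit_cube_eq_distr[symmetric] by (rule integral_distr[OF Em that])
  have "(1 - (\<integral>\<omega>. \<theta> \<omega> \<partial>P)) * ln (\<integral>x. f (?E x) \<partial>?N) + (\<integral>\<omega>. \<theta> \<omega> \<partial>P) * ln (\<integral>x. g (?E x) \<partial>?N)
      \<le> (\<integral>\<omega>. ln (\<integral>x. h (?E x) \<partial>?N) \<partial>P)"
  proof (rule prekopa_leindler_PiM[OF _ P th th01 c])
    fix x y :: "'a \<Rightarrow> real"
    have "?E (\<lambda>i\<in>Basis. (1 - t) * x i + t * y i) = (1 - t) *\<^sub>R ?E x + t *\<^sub>R ?E y" for t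
      by (simp add: scaleR_sum_right sum.distrib[symmetric] scaleR_add_left)
    then show "(1 - (\<integral>\<omega>. \<theta> \<omega> \<partial>P)) * ln (f (?E x)) + (\<integral>\<omega>. \<theta> \<omega> \<partial>P) * ln (g (?E y))
        \<le> (\<integral>\<omega>. ln (h (?E (\<lambda>i\<in>Basis. (1 - \<theta> \<omega>) * x i + \<theta> \<omega> * y i))) \<partial>P)"
      using hyp[of "?E x" "?E y"] by simp
  qed (use bounds in \<open>simp_all add: case_prod_beta'\<close>)
  then show ?thesis by (simp add: i P.prob_space)
qed

section \<open>Schwarz-Pick estimates and Blaschke factors\<close>

abbreviation mob :: "complex \<Rightarrow> complex \<Rightarrow> complex" where "mob \<equiv> Moebius_function 0"

lemma moebius_denom_nonzero: "cmod w < 1 \<Longrightarrow> cmod z < 1 \<Longrightarrow> 1 - cnj w * z \<noteq> 0"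
  by (metis complex_mod_cnj eq_iff_diff_eq_0 less_irrefl norm_mult_less norm_one mult.left_neutral)

lemma one_minus_moebius_sq:
  assumes "cmod w < 1" "cmod z < 1"
  shows "1 - (cmod (mob w z))\<^sup>2 = (1 - (cmod w)\<^sup>2) * (1 - (cmod z)\<^sup>2) / (cmod (1 - cnj w * z))\<^sup>2"
proof -
  have nz: "cmod (1 - cnj w * z) \<noteq> 0" using moebius_denom_nonzero[OF assms] by simp
  have "(cmod (1 - cnj w * z))\<^sup>2 - (cmod (z - w))\<^sup>2 = (1 - (cmod w)\<^sup>2) * (1 - (cmod z)\<^sup>2)"
    unfolding cmod_power2 by (simp add: algebra_simps power2_eq_square)
  then show ?thesis using nz
    by (simp add: Moebius_function_simple norm_divide power_divide field_simps)
qed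

text \<open>
\<open>cmod (mob a b)\<close> is the pseudo-hyperbolic distance. Among points at distance at most \<open>c\<close> from \<open>a\<close>, the
modulus is largest on the ray through \<open>a\<close>, where it is \<open>(cmod a + c) / (1 + cmod a * c)\<close>.
\<close>

lemma norm_le_of_moebius_le:
  assumes a: "cmod a < 1" and b: "cmod b < 1" and c: "cmod (mob a b) \<le> c" "c < 1"
  shows "cmod b * (1 + cmod a * c) \<le> cmod a + c"
proof -
  define A B where "A = cmod a" and "B = cmod b"
  have AB: "0 \<le> A" "A < 1" "0 \<le> B" "B < 1" using a b by (auto simp: A_def B_def)
  have AB1: "A * B < 1" using AB mult_le_one[of A B] by (smt (verit) mult_less_cancel_right1 mult_less_cancel_left1)
  have c0: "0 \<le> c" using c(1) norm_ge_zero order_trans by blast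
  have "1 - A * B \<le> cmod (1 - cnj a * b)"
    using norm_triangle_ineq2[of 1 "cnj a * b"] by (simp add: A_def B_def norm_mult)
  then have "(1 - A * B)\<^sup>2 \<le> (cmod (1 - cnj a * b))\<^sup>2" using AB1 by (intro power_mono) auto
  then have "(1 - A\<^sup>2) * (1 - B\<^sup>2) / (cmod (1 - cnj a * b))\<^sup>2 \<le> (1 - A\<^sup>2) * (1 - B\<^sup>2) / (1 - A * B)\<^sup>2"
    using AB AB1 by (intro divide_left_mono mult_nonneg_nonneg mult_pos_pos) (auto simp: power_le_one intro!: less_le_trans[OF _ \<open>(1 - A * B)\<^sup>2 \<le> (cmod (1 - cnj a * b))\<^sup>2\<close>])
  then have "1 - (cmod (mob a b))\<^sup>2 \<le> (1 - A\<^sup>2) * (1 - B\<^sup>2) / (1 - A * B)\<^sup>2"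
    using one_minus_moebius_sq[OF a b] by (simp add: A_def B_def)
  also have "\<dots> = 1 - ((A - B) / (1 - A * B))\<^sup>2"
    using AB1 by (simp add: power_divide field_simps) (simp add: power2_eq_square algebra_simps)
  finally have "((A - B) / (1 - A * B))\<^sup>2 \<le> (cmod (mob a b))\<^sup>2" by simp
  also have "\<dots> \<le> c\<^sup>2" using c(1) by (intro power_mono) auto
  finally have "\<bar>(A - B) / (1 - A * B)\<bar> \<le> c" using c0 by (simp add: abs_le_square_iff[symmetric])
  then have "\<bar>A - B\<bar> \<le> c * (1 - A * B)" using AB1 by (simp add: abs_divide field_simps)
  then show ?thesis unfolding A_def[symmetric] B_def[symmetric] by (simp add: algebra_simps)
qed

text \<open>
The Schwarz lemma for \<open>f\<close> conjugated by disc automorphisms that move \<open>a\<close> and \<open>f a\<close> to \<open>0\<close>.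
\<close>

lemma schwarz_pick:
  assumes f: "f holomorphic_on ball 0 1" and lt: "\<And>z. cmod z < 1 \<Longrightarrow> cmod (f z) < 1"
    and a: "cmod a < 1" and b: "cmod b < 1"
  shows "cmod (mob (f a) (f b)) \<le> cmod (mob a b)"
proof -
  define g where "g = mob (f a) \<circ> f \<circ> mob (- a)"
  have ma: "cmod (mob (-a) z) < 1" if "cmod z < 1" for z
    using Moebius_function_norm_lt_1[of "-a" z] a that by simp
  have h1: "mob (-a) holomorphic_on ball 0 1"
    by (rule Moebius_function_holomorphic) (use a in simp)
  have "f \<circ> mob (-a) holomorphic_on ball 0 1"
    by (rule holomorphic_on_compose_gen[OF h1 f]) (use ma in auto)
  then have "mob (f a) \<circ> (f \<circ> mob (-a)) holomorphic_on ball 0 1"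
    by (rule holomorphic_on_compose_gen[OF _ Moebius_function_holomorphic[OF lt[OF a]]]) (use ma lt in auto)
  then have gh: "g holomorphic_on ball 0 1" by (simp add: g_def comp_assoc)
  have g0: "g 0 = 0" by (simp add: g_def Moebius_function_of_zero Moebius_function_eq_zero)
  have gl: "cmod (g z) < 1" if "cmod z < 1" for z
    unfolding g_def using Moebius_function_norm_lt_1[OF lt[OF a] lt[OF ma[OF that]]] by simp
  have mb: "cmod (mob a b) < 1" by (rule Moebius_function_norm_lt_1[OF a b])
  have "cmod (g (mob a b)) \<le> cmod (mob a b)"
    by (rule Schwarz_Lemma(1)[OF gh g0 gl mb])
  moreover have "mob (-a) (mob a b) = b"
    by (rule Moebius_function_compose) (use a b in auto)
  ultimately show ?thesis by (simp add: g_def)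
qed

lemma disc_map_cases:
  assumes f: "f holomorphic_on ball 0 1" and le: "\<forall>z. cmod z < 1 \<longrightarrow> cmod (f z) \<le> 1"
  obtains "\<forall>z. cmod z < 1 \<longrightarrow> cmod (f z) < 1" | c where "\<forall>z. cmod z < 1 \<longrightarrow> f z = c" "cmod c = 1"
proof (cases "\<forall>z. cmod z < 1 \<longrightarrow> cmod (f z) < 1")
  case False
  then obtain z where z: "cmod z < 1" "cmod (f z) = 1" using le by (meson leI order_antisym)
  have "f constant_on ball 0 1"
    by (rule maximum_modulus_principle[OF f, of "ball 0 1" z]) (use z le in auto)
  then obtain c where "\<And>w. cmod w < 1 \<Longrightarrow> f w = c" by (auto simp: constant_on_def)
  then show ?thesis using that(2) z by metis
qed (use that in auto)

text \<open>
By Schwarz-Pick \<open>f b\<close> is at pseudo-hyperbolic distance at most \<open>cmod (mob a b)\<close> from \<open>f a\<close>; the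
inequality says how far this keeps it from the unit circle.
\<close>

lemma one_minus_norm_ge:
  assumes f: "f holomorphic_on ball 0 1" and le: "\<And>z. cmod z < 1 \<Longrightarrow> cmod (f z) \<le> 1"
    and a: "cmod a < 1" and b: "cmod b < 1"
  shows "(1 - cmod (mob a b)) * ((1 - cmod (f a)) / (1 + cmod (f a))) \<le> 1 - cmod (f b)"
proof (rule disc_map_cases[OF f])
  show "\<forall>z. cmod z < 1 \<longrightarrow> cmod (f z) \<le> 1" using le by blast
next
  assume "\<forall>z. cmod z < 1 \<longrightarrow> cmod (f z) < 1"
  then have lt: "cmod (f z) < 1" if "cmod z < 1" for z using that by blast
  define c where "c = cmod (mob a b)"
  have c: "0 \<le> c" "c < 1" using Moebius_function_norm_lt_1[OF a b] by (auto simp: c_def)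
  have "cmod (mob (f a) (f b)) \<le> c" unfolding c_def by (rule schwarz_pick[OF f lt a b])
  from norm_le_of_moebius_le[OF lt[OF a] lt[OF b] this c(2)]
  have *: "cmod (f b) * (1 + cmod (f a) * c) \<le> cmod (f a) + c" .
  have fa: "0 \<le> cmod (f a)" "cmod (f a) < 1" using lt[OF a] by auto
  have "(1 - c) * (1 - cmod (f a)) \<le> (1 - cmod (f b)) * (1 + cmod (f a) * c)"
    using * by (simp add: algebra_simps)
  also have "\<dots> \<le> (1 - cmod (f b)) * (1 + cmod (f a))"
    using c fa lt[OF b] by (intro mult_left_mono) (auto intro: mult_left_le)
  finally have "(1 - c) * (1 - cmod (f a)) \<le> (1 - cmod (f b)) * (1 + cmod (f a))" .
  moreover have "0 < 1 + cmod (f a)" using fa(1) by linarith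
  ultimately show ?thesis unfolding c_def[symmetric]
    by (simp only: times_divide_eq_right pos_divide_le_eq)
next
  fix c assume "\<forall>z. cmod z < 1 \<longrightarrow> f z = c" "cmod c = 1"
  then show ?thesis using a b by simp
qed

lemma divide_by_moebius:
  assumes f: "f holomorphic_on ball 0 1" and le: "\<And>z. cmod z < 1 \<Longrightarrow> cmod (f z) \<le> 1"
    and a: "cmod a < 1" "f a = 0"
  obtains h where "h holomorphic_on ball 0 1" "\<And>z. cmod z < 1 \<Longrightarrow> cmod (h z) \<le> 1"
    "\<And>z. cmod z < 1 \<Longrightarrow> f z = mob a z * h z"
proof -
  have lt: "cmod (f z) < 1" if "cmod z < 1" for z
    by (rule disc_map_cases[OF f]) (use le a that in auto)
  have ma: "cmod (mob (-a) z) < 1" if "cmod z < 1" for z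
    using Moebius_function_norm_lt_1[of "-a" z] a that by simp
  define g where "g = f \<circ> mob (- a)"
  have h1: "mob (-a) holomorphic_on ball 0 1" "mob a holomorphic_on ball 0 1"
    by (rule Moebius_function_holomorphic; use a in simp)+
  have gh: "g holomorphic_on ball 0 1" unfolding g_def
    by (rule holomorphic_on_compose_gen[OF h1(1) f]) (use ma in auto)
  have g0: "g 0 = 0" using a by (simp add: g_def Moebius_function_of_zero)
  have gl: "cmod (g z) < 1" if "cmod z < 1" for z unfolding g_def using lt[OF ma[OF that]] by simp
  obtain k where k: "k holomorphic_on ball 0 1" "\<And>z. cmod z < 1 \<Longrightarrow> g z = z * k z" "deriv g 0 = k 0"
    by (rule Schwarz3[OF gh g0]) auto
  have kl: "cmod (k z) \<le> 1" if "cmod z < 1" for z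
  proof (cases "z = 0")
    case True
    then show ?thesis using Schwarz_Lemma(2)[OF gh g0 gl, of 0] k(3) by simp
  next
    case False
    have "cmod (g z) \<le> cmod z" by (rule Schwarz_Lemma(1)[OF gh g0 gl that])
    then show ?thesis using k(2)[OF that] False by (simp add: norm_mult)
  qed
  show ?thesis
  proof (rule that[of "k \<circ> mob a"])
    show "k \<circ> mob a holomorphic_on ball 0 1"
      by (rule holomorphic_on_compose_gen[OF h1(2) k(1)]) (use Moebius_function_norm_lt_1[OF a(1)] in auto)
    fix z :: complex assume z: "cmod z < 1"
    have m: "cmod (mob a z) < 1" by (rule Moebius_function_norm_lt_1[OF a(1) z])
    show "cmod ((k \<circ> mob a) z) \<le> 1" using kl[OF m] by simp
    have "mob (-a) (mob a z) = z"
      by (rule Moebius_function_compose) (use a z in auto)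
    then show "f z = mob a z * (k \<circ> mob a) z"
      using k(2)[OF m] by (simp add: g_def)
  qed
qed

text \<open>
Each zero that is divided out raises the modulus at \<open>\<tau>\<close> by a factor of at least \<open>1 / q\<close>, while the
modulus stays at most \<open>1\<close>; so the division ends after at most \<open>k\<close> steps. Multiplicities are counted
automatically.
\<close>

lemma extract_zeros:
  assumes \<rho>: "\<rho> < 1" and \<tau>: "cmod \<tau> < 1" and q: "q < 1" "\<And>z. cmod z \<le> \<rho> \<Longrightarrow> cmod (mob z \<tau>) \<le> q" "0 < q"
  shows "f holomorphic_on ball 0 1 \<Longrightarrow> (\<And>z. cmod z < 1 \<Longrightarrow> cmod (f z) \<le> 1) \<Longrightarrow> q ^ k < cmod (f \<tau>) \<Longrightarrow>
    \<exists>zs G. G holomorphic_on ball 0 1 \<and> (\<forall>z. cmod z < 1 \<longrightarrow> cmod (G z) \<le> 1) \<and> (\<forall>z. cmod z \<le> \<rho> \<longrightarrow> G z \<noteq> 0)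
      \<and> (\<forall>z\<in>set zs. cmod z \<le> \<rho>) \<and> (\<forall>w. cmod w < 1 \<longrightarrow> f w = (\<Prod>z\<leftarrow>zs. mob z w) * G w)"
proof (induction k arbitrary: f)
  case 0
  then show ?case using \<tau> by fastforce
next
  case (Suc k)
  show ?case
  proof (cases "\<exists>z. cmod z \<le> \<rho> \<and> f z = 0")
    case False
    then show ?thesis using Suc.prems by (intro exI[of _ "[]"] exI[of _ f]) auto
  next
    case True
    then obtain a where a: "cmod a \<le> \<rho>" "f a = 0" by blast
    obtain h where h: "h holomorphic_on ball 0 1" "\<And>z. cmod z < 1 \<Longrightarrow> cmod (h z) \<le> 1"
      "\<And>z. cmod z < 1 \<Longrightarrow> f z = mob a z * h z"
      by (rule divide_by_moebius[OF Suc.prems(1,2), of a]) (use a \<rho> in auto)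
    have "q ^ Suc k < cmod (mob a \<tau>) * cmod (h \<tau>)"
      using Suc.prems(3) h(3)[OF \<tau>] by (simp add: norm_mult)
    also have "\<dots> \<le> q * cmod (h \<tau>)" using q(2)[OF a(1)] by (intro mult_right_mono) auto
    finally have "q ^ k < cmod (h \<tau>)" using q(3) by simp
    from Suc.IH[OF h(1,2) this] obtain zs G where
      G: "G holomorphic_on ball 0 1" "\<forall>z. cmod z < 1 \<longrightarrow> cmod (G z) \<le> 1" "\<forall>z. cmod z \<le> \<rho> \<longrightarrow> G z \<noteq> 0"
      "\<forall>z\<in>set zs. cmod z \<le> \<rho>" "\<forall>w. cmod w < 1 \<longrightarrow> h w = (\<Prod>z\<leftarrow>zs. mob z w) * G w" by blast
    show ?thesis
      by (intro exI[of _ "a # zs"] exI[of _ G]) (use G a h(3) in \<open>auto simp: mult.assoc\<close>)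
  qed
qed

text \<open>
Holomorphy across the unit circle makes the number of zeros in the disc finite, so that a finite
Blaschke product suffices and no convergence question arises.
\<close>

lemma blaschke_factorization:
  assumes f: "f holomorphic_on ball 0 R" "R > 1" and le: "\<And>z. cmod z < 1 \<Longrightarrow> cmod (f z) \<le> 1"
    and \<tau>: "cmod \<tau> < 1" "f \<tau> \<noteq> 0"
  obtains zs G where "G holomorphic_on ball 0 1" "\<And>z. cmod z < 1 \<Longrightarrow> cmod (G z) \<le> 1"
    "\<And>z. cmod z < 1 \<Longrightarrow> G z \<noteq> 0" "\<And>z. z \<in> set zs \<Longrightarrow> cmod z < 1"
    "\<And>w. cmod w < 1 \<Longrightarrow> f w = (\<Prod>z\<leftarrow>zs. mob z w) * G w"
proof -
  have fin: "finite {z \<in> cball 0 1. f z = 0}"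
  proof (cases "f constant_on ball 0 R")
    case True
    then obtain c where "\<And>z. cmod z < R \<Longrightarrow> f z = c" by (auto simp: constant_on_def)
    then have "{z \<in> cball 0 1. f z = 0} = {}" using f(2) \<tau> by (smt (verit) Collect_empty_eq mem_cball_0)
    then show ?thesis by (simp only: finite.emptyI)
  next
    case False
    then show ?thesis
      by (intro holomorphic_compact_finite_zeros[OF f(1)]) (use f(2) in \<open>auto simp: convex_connected\<close>)
  qed
  define S where "S = cmod ` {z \<in> ball 0 1. f z = 0}"
  have finS: "finite S" unfolding S_def
    by (intro finite_imageI finite_subset[OF _ fin]) auto
  define \<rho> where "\<rho> = Max (insert 0 S)"
  have \<rho>: "\<rho> < 1" "0 \<le> \<rho>" unfolding \<rho>_def using finS by (auto simp: S_def)
  have \<rho>z: "cmod z \<le> \<rho>" if "cmod z < 1" "f z = 0" for z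
    unfolding \<rho>_def using finS that by (intro Max_ge) (auto simp: S_def)
  have f1: "f holomorphic_on ball 0 1" by (rule holomorphic_on_subset[OF f(1)]) (use f(2) in auto)
  define q where "q = sqrt (1 - (1 - \<rho>\<^sup>2) * (1 - (cmod \<tau>)\<^sup>2) / 4)"
  have pr: "0 < (1 - \<rho>\<^sup>2) * (1 - (cmod \<tau>)\<^sup>2)" "(1 - \<rho>\<^sup>2) * (1 - (cmod \<tau>)\<^sup>2) \<le> 1"
    using \<rho> \<tau> by (auto intro!: mult_pos_pos mult_le_one simp: power_less_one_iff power_le_one abs_square_less_1)
  have q: "0 < q" "q < 1" unfolding q_def using pr by (auto simp: real_sqrt_lt_1_iff)
  have qz: "cmod (mob z \<tau>) \<le> q" if z: "cmod z \<le> \<rho>" for z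
  proof -
    have z1: "cmod z < 1" using z \<rho> by simp
    have "cmod (1 - cnj z * \<tau>) \<le> 1 + cmod z * cmod \<tau>"
      using norm_triangle_ineq4[of 1 "cnj z * \<tau>"] by (simp add: norm_mult)
    also have "\<dots> \<le> 2" using z1 \<tau> by (simp add: mult_le_one)
    finally have "(cmod (1 - cnj z * \<tau>))\<^sup>2 \<le> 2\<^sup>2" by (intro power_mono) auto
    then have d: "(cmod (1 - cnj z * \<tau>))\<^sup>2 \<le> 4" by simp
    have "(1 - \<rho>\<^sup>2) * (1 - (cmod \<tau>)\<^sup>2) / 4 \<le> (1 - (cmod z)\<^sup>2) * (1 - (cmod \<tau>)\<^sup>2) / (cmod (1 - cnj z * \<tau>))\<^sup>2"
    proof (rule frac_le)
      show "(1 - \<rho>\<^sup>2) * (1 - (cmod \<tau>)\<^sup>2) \<le> (1 - (cmod z)\<^sup>2) * (1 - (cmod \<tau>)\<^sup>2)"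
        using z \<tau> by (intro mult_right_mono) (auto intro!: power_mono simp: power_le_one)
      show "0 < (cmod (1 - cnj z * \<tau>))\<^sup>2" using moebius_denom_nonzero[OF z1 \<tau>(1)] by simp
      show "0 \<le> (1 - (cmod z)\<^sup>2) * (1 - (cmod \<tau>)\<^sup>2)" using z1 \<tau> by (intro mult_nonneg_nonneg) (auto simp: power_le_one)
    qed (use d in auto)
    then have "(cmod (mob z \<tau>))\<^sup>2 \<le> 1 - (1 - \<rho>\<^sup>2) * (1 - (cmod \<tau>)\<^sup>2) / 4"
      using one_minus_moebius_sq[OF z1 \<tau>(1)] by linarith
    then show ?thesis unfolding q_def by (intro real_le_rsqrt)
  qed
  obtain k where "q ^ k < cmod (f \<tau>)"
    using real_arch_pow_inv[of "cmod (f \<tau>)" q] \<tau> q by auto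
  from extract_zeros[OF \<rho>(1) \<tau>(1) q(2) qz q(1) f1 le this]
  obtain zs G where G: "G holomorphic_on ball 0 1" "\<forall>z. cmod z < 1 \<longrightarrow> cmod (G z) \<le> 1" "\<forall>z. cmod z \<le> \<rho> \<longrightarrow> G z \<noteq> 0"
      "\<forall>z\<in>set zs. cmod z \<le> \<rho>" "\<forall>w. cmod w < 1 \<longrightarrow> f w = (\<Prod>z\<leftarrow>zs. mob z w) * G w" by blast
  show ?thesis
  proof (rule that[of G zs])
    show "G z \<noteq> 0" if "cmod z < 1" for z
      using G(3,5) \<rho>z[OF that] that by fastforce
  qed (use G \<rho> in force)+
qed

section \<open>A Remez inequality in the disc\<close>

text \<open>
In the variable \<open>v = (1 - r) / (1 + r)\<close> the left side is \<open>ln (1 + v) - ln (1 - v)\<close>, which is convex and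
lies below its chord from \<open>v = 0\<close> to \<open>v = 2 / 3\<close>, that is, \<open>r = 1 / 5\<close>.
\<close>

lemma ln_inverse_le:
  fixes r :: real
  assumes "1 / 5 \<le> r" "r \<le> 1"
  shows "- ln r \<le> 3 / 2 * ln 5 * ((1 - r) / (1 + r))"
proof -
  define \<phi> where "\<phi> v = ln (1 + v) - ln (1 - v)" for v :: real
  have conv: "convex_on {0..2/3} \<phi>"
  proof (rule f''_ge0_imp_convex)
    fix v :: real assume v: "v \<in> {0..2/3}"
    show "DERIV \<phi> v :> (1 / (1 + v) + 1 / (1 - v))"
      unfolding \<phi>_def using v by (auto intro!: derivative_eq_intros)
    show "DERIV (\<lambda>v. 1 / (1 + v) + 1 / (1 - v)) v :> (1 / (1 - v)\<^sup>2 - 1 / (1 + v)\<^sup>2)"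
      using v by (auto intro!: derivative_eq_intros simp: power2_eq_square)
    show "0 \<le> 1 / (1 - v)\<^sup>2 - 1 / (1 + v)\<^sup>2"
      using v by (auto intro!: divide_left_mono power_mono mult_pos_pos)
  qed auto
  define v where "v = (1 - r) / (1 + r)"
  have v: "0 \<le> v" "v \<le> 2/3" using assms by (auto simp: v_def field_simps)
  have 1: "(1 + v) = 2 / (1 + r)" "1 - v = 2 * r / (1 + r)" using assms by (auto simp: v_def field_simps)
  have "\<phi> v = - ln r" unfolding \<phi>_def 1 using assms by (simp add: ln_div ln_mult)
  moreover have "\<phi> ((1 - 3/2 * v) *\<^sub>R 0 + (3/2 * v) *\<^sub>R (2/3)) \<le> (1 - 3/2 * v) * \<phi> 0 + (3/2 * v) * \<phi> (2/3)"
    by (rule convex_onD[OF conv]) (use v in auto)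
  moreover have "\<phi> (2/3) = ln 5"
  proof -
    have "\<phi> (2/3) = ln ((5/3)/(1/3))" unfolding \<phi>_def by (subst ln_div) auto
    then show ?thesis by simp
  qed
  moreover have "(1 - 3/2 * v) *\<^sub>R 0 + (3/2 * v) *\<^sub>R (2/3) = v" "\<phi> 0 = 0" by (simp_all add: \<phi>_def)
  ultimately have "- ln r \<le> 3/2 * v * ln 5" by simp
  then show ?thesis unfolding v_def by (simp only: ac_simps)
qed

text \<open>
A Harnack inequality for \<open>- ln \<bar>f\<bar>\<close> which tolerates zeros of \<open>f\<close>, provided that \<open>\<bar>f a\<bar>\<close> is not small.
The threshold \<open>1 / 5\<close> is the one that separates near from far zeros later on.
\<close>

lemma harnack_far:
  assumes f: "f holomorphic_on ball 0 1" and le: "\<And>z. cmod z < 1 \<Longrightarrow> cmod (f z) \<le> 1"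
    and a: "cmod a < 1" and b: "cmod b < 1" and far: "1 / 5 \<le> cmod (f a)" and nz: "f b \<noteq> 0"
    and \<kappa>: "0 < \<kappa>" "\<kappa> \<le> 2 / 3 * (1 - cmod (mob a b))"
  shows "- ln (cmod (f a)) \<le> ln 5 / \<kappa> * (- ln (cmod (f b)))"
proof -
  define r where "r = cmod (f a)"
  define v where "v = (1 - r) / (1 + r)"
  have r: "1/5 \<le> r" "r \<le> 1" using far le[OF a] by (auto simp: r_def)
  have v0: "0 \<le> v" using r by (auto simp: v_def)
  have "3 / 2 * \<kappa> * v \<le> (1 - cmod (mob a b)) * v" using \<kappa> v0 by (intro mult_right_mono) auto
  also have "\<dots> \<le> 1 - cmod (f b)"
    using one_minus_norm_ge[OF f le a b] by (simp add: v_def r_def)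
  also have "\<dots> \<le> - ln (cmod (f b))"
    using ln_le_minus_one[of "cmod (f b)"] nz by simp
  finally have *: "3 / 2 * v \<le> - ln (cmod (f b)) / \<kappa>" using \<kappa> by (simp add: field_simps)
  have "- ln r \<le> ln 5 * (3 / 2 * v)" using ln_inverse_le[OF r] unfolding v_def by (simp only: ac_simps)
  also have "\<dots> \<le> ln 5 * (- ln (cmod (f b)) / \<kappa>)" by (rule mult_left_mono[OF *]) simp
  finally show ?thesis by (simp add: r_def)
qed

text \<open>
Without zeros, \<open>f\<close> has holomorphic roots of every order. A root of high order is not small at \<open>a\<close>, so
\<open>harnack_far\<close> applies to it, and the claim is homogeneous in \<open>ln \<bar>f\<bar>\<close>.
\<close>

lemma harnack_zero_free:
  assumes f: "f holomorphic_on ball 0 1" and le: "\<And>z. cmod z < 1 \<Longrightarrow> cmod (f z) \<le> 1"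
    and nz: "\<And>z. cmod z < 1 \<Longrightarrow> f z \<noteq> 0"
    and a: "cmod a < 1" and b: "cmod b < 1"
    and \<kappa>: "0 < \<kappa>" "\<kappa> \<le> 2 / 3 * (1 - cmod (mob a b))"
  shows "- ln (cmod (f a)) \<le> ln 5 / \<kappa> * (- ln (cmod (f b)))"
proof -
  obtain g where g: "g holomorphic_on ball 0 1" "\<And>z. z \<in> ball 0 1 \<Longrightarrow> f z = exp (g z)"
    by (rule contractible_imp_holomorphic_log[OF f]) (use nz convex_imp_contractible convex_ball in auto)
  \<comment> \<open>the order of the root\<close>
  obtain m :: nat where m: "- ln (cmod (f a)) / ln 5 < real m" using reals_Archimedean2 by blast
  have nla: "0 \<le> - ln (cmod (f a))" using le[OF a] nz[OF a] by simp
  have mp: "0 < real m" 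
  proof -
    have "0 \<le> - ln (cmod (f a)) / ln 5" using nla by (intro divide_nonneg_pos) auto
    then show ?thesis using m by linarith
  qed
  define h where "h z = exp (g z / of_nat m)" for z
  have hh: "h holomorphic_on ball 0 1" unfolding h_def by (intro holomorphic_intros g) (use mp in auto)
  have lnf: "ln (cmod (f z)) = Re (g z)" and lnh: "ln (cmod (h z)) = Re (g z) / real m" if "cmod z < 1" for z
    using g(2)[of z] that by (simp_all add: h_def)
  have hle: "cmod (h z) \<le> 1" if "cmod z < 1" for z
  proof -
    have "Re (g z) \<le> 0" using le[OF that] g(2)[of z] that by simp
    then show ?thesis by (simp add: h_def divide_nonpos_nonneg)
  qed
  have far: "1 / 5 \<le> cmod (h a)"
  proof -
    have "- ln 5 \<le> Re (g a) / real m" using m lnf[OF a] mp by (simp add: field_simps)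
    then have "exp (- ln 5) \<le> exp (Re (g a) / real m)" by (simp only: exp_le_cancel_iff)
    then show ?thesis by (simp add: h_def exp_minus)
  qed
  have hb: "h b \<noteq> 0" unfolding h_def by (rule exp_not_eq_zero)
  have "- ln (cmod (h a)) \<le> ln 5 / \<kappa> * (- ln (cmod (h b)))"
    by (rule harnack_far[OF hh hle a b far hb \<kappa>])
  then show ?thesis using lnf[OF a] lnf[OF b] lnh[OF a] lnh[OF b] mp by (simp add: field_simps)
qed

lemma one_minus_moebius_real_ge:
  fixes X \<tau> e :: real
  assumes X: "- (1 / 8) \<le> X" "X \<le> \<tau>" and \<tau>: "0 < \<tau>" "\<tau> < 1" and e: "e \<le> 1 - \<tau>\<^sup>2" "0 \<le> e"
  shows "7 / 18 * e \<le> 1 - cmod (mob (of_real X) (of_real \<tau>))"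
proof -
  have X1: "\<bar>X\<bar> < 1" using X \<tau> by auto
  define c where "c = cmod (mob (of_real X) (of_real \<tau>))"
  have c: "0 \<le> c" "c < 1" unfolding c_def using Moebius_function_norm_lt_1[of "of_real X" "of_real \<tau>" 0] X1 \<tau> by auto
  have d: "0 < 1 - X * \<tau>"
  proof -
    have "\<bar>X\<bar> * \<tau> < 1" using abs_mult_less[OF X1, of \<tau> 1] \<tau> by simp
    moreover have "X * \<tau> \<le> \<bar>X\<bar> * \<tau>" using \<tau> by (intro mult_right_mono) auto
    ultimately show ?thesis by linarith
  qed
  have "cmod (1 - cnj (of_real X) * of_real \<tau>) = 1 - X * \<tau>"
  proof -
    have "1 - cnj (of_real X) * of_real \<tau> = complex_of_real (1 - X * \<tau>)" by simp
    then show ?thesis using d by (simp only: norm_of_real)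
  qed
  then have eq: "1 - c\<^sup>2 = (1 - X\<^sup>2) * (1 - \<tau>\<^sup>2) / (1 - X * \<tau>)\<^sup>2"
    using one_minus_moebius_sq[of "of_real X" "of_real \<tau>"] X1 \<tau> by (simp add: c_def)
  have "7 / 9 * (1 - X * \<tau>)\<^sup>2 \<le> 1 - X\<^sup>2"
  proof (cases "0 \<le> X")
    case True
    have "X * (1 + \<tau>\<^sup>2) \<le> \<tau> * (1 + \<tau>\<^sup>2)" using X by (intro mult_right_mono) auto
    also have "\<dots> \<le> \<tau> * 2" using \<tau> by (intro mult_left_mono) (auto simp: power_le_one)
    finally have "X * (X * (1 + \<tau>\<^sup>2)) \<le> X * (\<tau> * 2)" using True by (intro mult_left_mono) auto
    then have "(1 - X * \<tau>)\<^sup>2 \<le> 1 - X\<^sup>2" by (simp add: power2_eq_square algebra_simps)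
    moreover have "0 \<le> (1 - X * \<tau>)\<^sup>2" by simp
    ultimately show ?thesis by linarith
  next
    case False
    have "- X * \<tau> \<le> 1 / 8 * 1" using False X \<tau> by (intro mult_mono) auto
    then have "(1 - X * \<tau>)\<^sup>2 \<le> (9 / 8)\<^sup>2" using d by (intro power_mono) auto
    moreover have "X\<^sup>2 \<le> (1 / 8)\<^sup>2"
      using power_mono[of "-X" "1/8" 2] False X by simp
    ultimately show ?thesis by (simp add: power2_eq_square)
  qed
  then have "7 / 9 \<le> (1 - X\<^sup>2) / (1 - X * \<tau>)\<^sup>2" using d by (simp add: field_simps)
  then have "7 / 9 * (1 - \<tau>\<^sup>2) \<le> (1 - X\<^sup>2) / (1 - X * \<tau>)\<^sup>2 * (1 - \<tau>\<^sup>2)"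
    using e by (intro mult_right_mono) auto
  also have "\<dots> = 1 - c\<^sup>2" using eq by simp
  also have "\<dots> = (1 - c) * (1 + c)" by (simp add: power2_eq_square algebra_simps)
  also have "\<dots> \<le> (1 - c) * 2" using c by (intro mult_left_mono) auto
  finally show ?thesis using e unfolding c_def[symmetric] by simp
qed

text \<open>
The triangle inequality for the pseudo-hyperbolic distance bounds the left side by the distance from
\<open>z\<close> to the intermediate point plus the distance between the two real points. The latter is compared
with the former through the real part: \<open>c\<close> is the parameter at which the segment passes \<open>Re z\<close>, so the
intermediate point has distance at least \<open>\<bar>y - x\<bar> * \<bar>t - c\<bar>\<close> from \<open>z\<close>.
\<close>

lemma moebius_ratio_real:
  fixes x y t :: real
  assumes z: "cmod z < 1" and x: "\<bar>x\<bar> < 1" and y: "\<bar>y\<bar> < 1" and xy: "x \<noteq> y" and t: "0 \<le> t" "t \<le> 1"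
    and c: "c = (Re z - x) / (y - x)" "t \<noteq> c"
  shows "cmod (mob z (of_real y)) \<le> (2 + 2 / \<bar>t - c\<bar>) * cmod (mob z (of_real (x + t * (y - x))))"
proof -
  define X where "X = x + t * (y - x)"
  have Xy: "X = (1 - t) * x + t * y" by (simp add: X_def algebra_simps)
  have X1: "\<bar>X\<bar> < 1"
  proof -
    have "X < 1" "- X < 1"
      unfolding Xy using convex_bound_lt[of x 1 y "1 - t" t] convex_bound_lt[of "-x" 1 "-y" "1 - t" t] x y t by auto
    then show ?thesis by simp
  qed
  let ?X = "complex_of_real X" and ?y = "complex_of_real y"
  have cX: "cmod ?X < 1" and cy: "cmod ?y < 1" using X1 y by auto
  have a: "cmod (mob z ?X) < 1" "cmod (mob z ?y) < 1" "cmod (mob ?X ?y) < 1"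
    using Moebius_function_norm_lt_1 z cX cy by auto
  have tri: "cmod (mob z ?y) \<le> cmod (mob z ?X) + cmod (mob ?X ?y)"
  proof -
    have "cmod (mob (mob z ?X) (mob z ?y)) \<le> cmod (mob ?X ?y)"
      by (rule schwarz_pick[OF Moebius_function_holomorphic[OF z] _ cX cy]) (use Moebius_function_norm_lt_1[OF z] in auto)
    from norm_le_of_moebius_le[OF a(1,2) this a(3)]
    have "cmod (mob z ?y) * (1 + cmod (mob z ?X) * cmod (mob ?X ?y)) \<le> cmod (mob z ?X) + cmod (mob ?X ?y)" .
    moreover have "cmod (mob z ?y) * 1 \<le> cmod (mob z ?y) * (1 + cmod (mob z ?X) * cmod (mob ?X ?y))"
      by (intro mult_left_mono) auto
    ultimately show ?thesis by simp
  qed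
  define p where "p = cmod (mob ?X ?y)"
  have p: "0 \<le> p" "p \<le> 1" using a by (auto simp: p_def)
  have Xy1: "0 < 1 - X * y"
    using abs_mult_less[OF X1 y] by (simp add: abs_mult[symmetric] abs_less_iff)
  have pe: "p = \<bar>y - X\<bar> / (1 - X * y)"
  proof -
    have "mob ?X ?y = complex_of_real ((y - X) / (1 - X * y))" by (simp add: Moebius_function_simple)
    then show ?thesis unfolding p_def using Xy1 by (simp only: norm_of_real) (simp add: abs_divide)
  qed
  have "1 - X\<^sup>2 \<le> 2 * (1 - \<bar>X\<bar>)"
  proof -
    have "0 \<le> (1 - \<bar>X\<bar>)\<^sup>2" by simp
    then show ?thesis by (simp add: power2_eq_square algebra_simps abs_mult_self_eq)
  qed
  also have "\<dots> \<le> 2 * (1 - X * y)"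
  proof -
    have "X * y \<le> \<bar>X\<bar> * \<bar>y\<bar>" using abs_ge_self[of "X * y"] by (simp add: abs_mult)
    also have "\<dots> \<le> \<bar>X\<bar> * 1" using y by (intro mult_left_mono) auto
    finally show ?thesis by simp
  qed
  finally have "p * (1 - X\<^sup>2) \<le> p * (2 * (1 - X * y))" by (rule mult_left_mono[OF _ p(1)])
  then have p2: "p * (1 - X\<^sup>2) \<le> 2 * \<bar>y - X\<bar>"
  proof -
    have "p * (2 * (1 - X * y)) = 2 * (p * (1 - X * y))" by simp
    also have "p * (1 - X * y) = \<bar>y - X\<bar>" using pe Xy1 by simp
    finally show ?thesis using \<open>p * (1 - X\<^sup>2) \<le> p * (2 * (1 - X * y))\<close> by simp
  qed
  define d where "d = cmod (?X - z)"
  have de: "d \<ge> \<bar>y - x\<bar> * \<bar>t - c\<bar>"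
  proof -
    have "\<bar>y - x\<bar> * \<bar>t - c\<bar> = \<bar>(y - x) * (t - c)\<bar>" by (simp add: abs_mult)
    also have "(y - x) * (t - c) = X - Re z" using xy by (simp add: c X_def field_simps)
    also have "\<bar>X - Re z\<bar> \<le> d" unfolding d_def using abs_Re_le_cmod[of "?X - z"] by simp
    finally show ?thesis .
  qed
  have tc: "0 < \<bar>t - c\<bar>" using c by simp
  have dp: "0 < d" using de xy tc by (smt (verit) mult_pos_pos zero_less_abs_iff)
  define q where "q = cmod (1 - cnj z * ?X)"
  have qp: "0 < q" unfolding q_def using moebius_denom_nonzero[OF z cX] by simp
  have q: "q \<le> (1 - X\<^sup>2) + d"
  proof -
    have "1 - cnj z * ?X = of_real (1 - X\<^sup>2) + ?X * cnj (?X - z)"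
      by (simp add: algebra_simps power2_eq_square)
    then have "q \<le> cmod (of_real (1 - X\<^sup>2)) + cmod (?X * cnj (?X - z))"
      unfolding q_def by (metis norm_triangle_ineq)
    also have "cmod (of_real (1 - X\<^sup>2)) = 1 - X\<^sup>2"
      using X1 by (simp only: norm_of_real) (simp add: abs_square_le_1)
    also have "cmod (?X * cnj (?X - z)) \<le> 1 * d"
    proof -
      have "cmod (?X * cnj (?X - z)) = \<bar>X\<bar> * d" unfolding d_def by (simp only: norm_mult complex_mod_cnj norm_of_real real_norm_def)
      also have "\<dots> \<le> 1 * d" using X1 dp by (intro mult_right_mono) auto
      finally show ?thesis .
    qed
    finally show ?thesis by simp
  qed
  have m: "cmod (mob z ?X) = d / q" by (simp add: Moebius_function_simple norm_divide d_def q_def)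
  have "p * q \<le> p * ((1 - X\<^sup>2) + d)" using q p by (intro mult_left_mono) auto
  also have "\<dots> \<le> 2 * \<bar>y - X\<bar> + d" 
  proof -
    have "p * d \<le> 1 * d" using p dp by (intro mult_right_mono) auto
    then show ?thesis using p2 by (simp add: distrib_left)
  qed
  also have "2 * \<bar>y - X\<bar> \<le> 2 * (d / \<bar>t - c\<bar>)"
  proof -
    have "y - X = (1 - t) * (y - x)" by (simp add: X_def algebra_simps)
    then have "\<bar>y - X\<bar> \<le> 1 * \<bar>y - x\<bar>" using t by (simp add: abs_mult mult_left_le_one_le)
    also have "\<dots> \<le> d / \<bar>t - c\<bar>" using de tc by (simp add: field_simps)
    finally show ?thesis by simp
  qed
  finally have "p * q \<le> d * (1 + 2 / \<bar>t - c\<bar>)" by (simp add: algebra_simps)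
  then have "p \<le> (1 + 2 / \<bar>t - c\<bar>) * (d / q)" using qp by (simp add: field_simps)
  moreover have "(2 + 2 / \<bar>t - c\<bar>) * (d / q) = (1 + 2 / \<bar>t - c\<bar>) * (d / q) + d / q"
    by (simp add: distrib_right del: times_divide_eq_left times_divide_eq_right)
  ultimately show ?thesis using tri unfolding p_def[symmetric] m X_def[symmetric]
    by linarith
qed

lemma prod_list_norm: "cmod (\<Prod>z\<leftarrow>zs. g z) = (\<Prod>z\<leftarrow>zs. cmod (g z))"
  by (induction zs) (auto simp: norm_mult)

lemma prod_list_filter_split:
  fixes g :: "'a \<Rightarrow> real"
  shows "(\<Prod>z\<leftarrow>zs. g z) = (\<Prod>z\<leftarrow>filter P zs. g z) * (\<Prod>z\<leftarrow>filter (\<lambda>z. \<not> P z) zs. g z)"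
  by (induction zs) auto

lemma prod_list_mono_real:
  fixes g h :: "'a \<Rightarrow> real"
  assumes "\<And>z. z \<in> set zs \<Longrightarrow> 0 \<le> g z" "\<And>z. z \<in> set zs \<Longrightarrow> g z \<le> h z"
  shows "0 \<le> (\<Prod>z\<leftarrow>zs. g z)" "(\<Prod>z\<leftarrow>zs. g z) \<le> (\<Prod>z\<leftarrow>zs. h z)"
  using assms
proof (induction zs)
  case (Cons a zs)
  { case 1 then show ?case using Cons.IH(1) by auto }
  { case 2
    then have "0 \<le> prod_list (map g zs)" "prod_list (map g zs) \<le> prod_list (map h zs)" using Cons.IH by auto
    then show ?case using 2 by (auto intro!: mult_mono intro: order_trans) }
qed auto

lemma prod_list_mult_distrib:
  fixes g h :: "'a \<Rightarrow> real"
  shows "(\<Prod>z\<leftarrow>zs. g z * h z) = (\<Prod>z\<leftarrow>zs. g z) * (\<Prod>z\<leftarrow>zs. h z)"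
  by (induction zs) auto

lemma prod_list_le_power:
  fixes g :: "'a \<Rightarrow> real"
  assumes "\<And>z. z \<in> set zs \<Longrightarrow> 0 \<le> g z" "\<And>z. z \<in> set zs \<Longrightarrow> g z \<le> q"
  shows "(\<Prod>z\<leftarrow>zs. g z) \<le> q ^ length zs"
  using prod_list_mono_real(2)[of zs g "\<lambda>_. q"] assms by (simp add: map_replicate_const)

lemma prod_list_powr:
  fixes g :: "'a \<Rightarrow> real"
  assumes "\<And>z. z \<in> set zs \<Longrightarrow> 0 < g z"
  shows "(\<Prod>z\<leftarrow>zs. g z powr k) = (\<Prod>z\<leftarrow>zs. g z) powr k" "0 < (\<Prod>z\<leftarrow>zs. g z)"
  using assms
proof (induction zs)
  case (Cons a zs)
  { case 1 then show ?case using Cons.IH by (simp add: powr_mult less_imp_le) }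
  { case 2 then show ?case using Cons.IH by simp }
qed auto

text \<open>
A zero is near if some point of the first eighth of the segment has pseudo-hyperbolic distance less
than \<open>1 / 5\<close> from it. Near zeros lower \<open>ln \<bar>f \<tau>\<bar>\<close> by at least \<open>\<kappa>\<close> each, so there are at most \<open>L / \<kappa>\<close> of
them, and they give the explicit factors. Far zeros and the zero-free factor together change by at
most \<open>5 powr N\<close>. The start \<open>x \<ge> 0\<close> keeps the first eighth of the
segment to the right of \<open>- 1 / 8\<close>, where the pseudo-hyperbolic distance to \<open>\<tau>\<close> stays below \<open>1\<close> by a
fixed multiple of \<open>e\<close>.
\<close>

lemma remez_product_pos:
  fixes x y \<tau> e L N :: real
  assumes f: "f holomorphic_on ball 0 R" "R > 1" and le: "\<And>z. cmod z < 1 \<Longrightarrow> cmod (f z) \<le> 1"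
    and \<tau>: "0 < \<tau>" "\<tau> < 1" and e: "0 < e" "e \<le> 1 - \<tau>\<^sup>2"
    and L: "cmod (f (of_real \<tau>)) = exp (- L)" and N: "27 * L \<le> 7 * e * N"
    and x: "0 \<le> x" "x \<le> \<tau>" and y: "- \<tau> \<le> y" "y \<le> \<tau>" and xy: "x \<noteq> y"
  obtains cs :: "real list" where "real (length cs) \<le> N"
    "\<And>t. 0 \<le> t \<Longrightarrow> t \<le> 1 / 8 \<Longrightarrow> t \<notin> set cs \<Longrightarrow>
       cmod (f (of_real y)) \<le> 5 powr N * (\<Prod>c\<leftarrow>cs. 2 + 2 / \<bar>t - c\<bar>) * cmod (f (of_real (x + t * (y - x))))"
proof -
  let ?\<tau> = "complex_of_real \<tau>"
  have f\<tau>: "f ?\<tau> \<noteq> 0" using L by auto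
  have \<tau>1: "cmod ?\<tau> < 1" using \<tau> by simp
  obtain zs G where G: "G holomorphic_on ball 0 1" "\<And>z. cmod z < 1 \<Longrightarrow> cmod (G z) \<le> 1"
    "\<And>z. cmod z < 1 \<Longrightarrow> G z \<noteq> 0" and zs: "\<And>z. z \<in> set zs \<Longrightarrow> cmod z < 1"
    and fact: "\<And>w. cmod w < 1 \<Longrightarrow> f w = (\<Prod>z\<leftarrow>zs. mob z w) * G w"
  proof (rule blaschke_factorization[OF f le \<tau>1 f\<tau>])
    fix zs G
    assume "G holomorphic_on ball 0 1" "\<And>z. cmod z < 1 \<Longrightarrow> cmod (G z) \<le> 1" "\<And>z. cmod z < 1 \<Longrightarrow> G z \<noteq> 0"
      "\<And>z. z \<in> set zs \<Longrightarrow> cmod z < 1" "\<And>w. cmod w < 1 \<Longrightarrow> f w = (\<Prod>z\<leftarrow>zs. mob z w) * G w"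
    then show thesis by (rule that)
  qed
  define X where "X t = complex_of_real (x + t * (y - x))" for t
  have Xr: "- (1/8) \<le> x + t * (y - x)" "x + t * (y - x) \<le> \<tau>" if "0 \<le> t" "t \<le> 1/8" for t
  proof -
    have e: "x + t * (y - x) = (1 - t) * x + t * y" by (simp add: algebra_simps)
    have "t * (-1) \<le> t * y" using that y \<tau> by (intro mult_left_mono) auto
    moreover have "0 \<le> (1 - t) * x" using that x by auto
    ultimately show "- (1/8) \<le> x + t * (y - x)" using that e by linarith
    show "x + t * (y - x) \<le> \<tau>" unfolding e using that x y by (intro convex_bound_le) auto
  qed
  have X1: "cmod (X t) < 1" if "0 \<le> t" "t \<le> 1/8" for t
    using Xr[OF that] \<tau> unfolding X_def unfolding norm_of_real by auto
  define \<kappa> where "\<kappa> = 7 / 27 * e"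
  have \<kappa>: "0 < \<kappa>" using e by (simp add: \<kappa>_def)
  have \<kappa>2: "\<kappa> \<le> 2 / 3 * (1 - cmod (mob (X t) ?\<tau>))" if "0 \<le> t" "t \<le> 1/8" for t
    using one_minus_moebius_real_ge[OF Xr[OF that] \<tau> e(2)] e(1) unfolding X_def \<kappa>_def by simp
  \<comment> \<open>only the segment up to \<open>1 / 8\<close> counts, as \<open>t\<close> is restricted to it\<close>
  define near where "near z \<longleftrightarrow> (\<exists>t. 0 \<le> t \<and> t \<le> 1/8 \<and> cmod (mob z (X t)) < 1/5)" for z
  let ?nz = "filter near zs" and ?fz = "filter (\<lambda>z. \<not> near z) zs"
  define b where "b z = cmod (mob z ?\<tau>)" for z
  have b1: "b z \<le> 1" "0 \<le> b z" if "z \<in> set zs" for z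
    unfolding b_def using Moebius_function_norm_lt_1[OF zs[OF that] \<tau>1, of 0] by auto
  have tot: "exp (- L) = (\<Prod>z\<leftarrow>zs. b z) * cmod (G ?\<tau>)"
    unfolding L[symmetric] fact[OF \<tau>1] norm_mult prod_list_norm b_def ..
  have tot2: "exp (- L) = (\<Prod>z\<leftarrow>?nz. b z) * ((\<Prod>z\<leftarrow>?fz. b z) * cmod (G ?\<tau>))"
    unfolding tot prod_list_filter_split[of b zs near] by (simp add: mult.assoc)
  have bpos: "0 < b z" if "z \<in> set zs" for z
  proof -
    have "(\<Prod>z\<leftarrow>zs. b z) \<noteq> 0" using tot by auto
    then have "b z \<noteq> 0" using that by (auto simp: prod_list_zero_iff)
    then show ?thesis using b1(2)[OF that] by simp
  qed
  have nearb: "b z \<le> exp (- \<kappa>)" if z: "z \<in> set ?nz" for z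
  proof -
    have zz: "z \<in> set zs" "near z" using z by auto
    then obtain t where t: "0 \<le> t" "t \<le> 1/8" "cmod (mob z (X t)) < 1/5" unfolding near_def by blast
    define r where "r = cmod (mob z (X t))"
    have r: "0 \<le> r" "r < 1/5" using t by (auto simp: r_def)
    have "(1 - cmod (mob (X t) ?\<tau>)) * ((1 - r) / (1 + r)) \<le> 1 - b z"
      unfolding r_def b_def
      by (rule one_minus_norm_ge[OF Moebius_function_holomorphic[OF zs[OF zz(1)]] _ X1[OF t(1,2)] \<tau>1])
         (use Moebius_function_norm_lt_1[OF zs[OF zz(1)]] in \<open>auto intro: less_imp_le\<close>)
    moreover have "(1 - cmod (mob (X t) ?\<tau>)) * (2 / 3) \<le> (1 - cmod (mob (X t) ?\<tau>)) * ((1 - r) / (1 + r))"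
    proof (rule mult_left_mono)
      show "2 / 3 \<le> (1 - r) / (1 + r)" using r by (simp add: field_simps)
      show "0 \<le> 1 - cmod (mob (X t) ?\<tau>)" using \<kappa>2[OF t(1,2)] \<kappa> by simp
    qed
    ultimately have "b z \<le> 1 + (- \<kappa>)" using \<kappa>2[OF t(1,2)] by linarith
    also have "\<dots> \<le> exp (- \<kappa>)" by (rule exp_ge_add_one_self)
    finally show ?thesis .
  qed
  have G\<tau>: "0 < cmod (G ?\<tau>)" "cmod (G ?\<tau>) \<le> 1" using G(2,3)[OF \<tau>1] by auto
  have fz: "0 < (\<Prod>z\<leftarrow>?fz. b z)" "(\<Prod>z\<leftarrow>?fz. b z) \<le> 1"
    using prod_list_powr(2)[of ?fz b] bpos prod_list_le_power[of ?fz b 1] b1 by auto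
  have nz: "0 < (\<Prod>z\<leftarrow>?nz. b z)" "(\<Prod>z\<leftarrow>?nz. b z) \<le> 1"
    using prod_list_powr(2)[of ?nz b] bpos prod_list_le_power[of ?nz b 1] b1 by auto
  have LN: "L / \<kappa> \<le> N" using N e unfolding \<kappa>_def by (simp add: field_simps)
  have len: "real (length ?nz) \<le> N"
  proof -
    have "exp (- L) \<le> (\<Prod>z\<leftarrow>?nz. b z) * 1"
      unfolding tot2 using nz(1) fz G\<tau> by (intro mult_left_mono) (auto intro: mult_le_one)
    also have "\<dots> \<le> exp (- \<kappa>) ^ length ?nz"
      using prod_list_le_power[of ?nz b "exp (- \<kappa>)"] nearb b1 by auto
    also have "\<dots> = exp (- (real (length ?nz) * \<kappa>))" by (simp add: exp_of_nat_mult[symmetric])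
    finally have "real (length ?nz) * \<kappa> \<le> L" by simp
    then have "real (length ?nz) \<le> L / \<kappa>" using \<kappa> by (simp add: field_simps)
    then show ?thesis using LN by simp
  qed
  define cs where "cs = map (\<lambda>z. (Re z - x) / (y - x)) ?nz"
  show ?thesis
  proof (rule that[of cs])
    show "real (length cs) \<le> N" using len by (simp add: cs_def)
    fix t assume t: "0 \<le> t" "t \<le> 1/8" "t \<notin> set cs"
    define K where "K = ln 5 / \<kappa>"
    have y1: "\<bar>y\<bar> < 1" and x1: "\<bar>x\<bar> < 1" using y x \<tau> by auto
    have cy: "cmod (of_real y) < 1" using y1 by simp
    have pw: "b' powr K \<le> a" if "- ln a \<le> ln 5 / \<kappa> * (- ln b')" "0 < a" "0 < b'" for a b' :: real
    proof -
      have "K * ln b' \<le> ln a" using that(1) by (simp add: K_def)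
      then have "exp (K * ln b') \<le> exp (ln a)" by simp
      then show ?thesis using that(2,3) by (simp add: powr_def)
    qed
    have GX: "cmod (G ?\<tau>) powr K \<le> cmod (G (X t))"
      by (rule pw[OF harnack_zero_free[OF G(1,2,3) X1[OF t(1,2)] \<tau>1 \<kappa> \<kappa>2[OF t(1,2)]]])
         (use G(3) \<tau>1 X1[OF t(1,2)] in auto)
    have fX: "b z powr K \<le> cmod (mob z (X t))" if z: "z \<in> set ?fz" for z
    proof -
      have zz: "z \<in> set zs" "\<not> near z" using z by auto
      then have far: "1/5 \<le> cmod (mob z (X t))" using t unfolding near_def by force
      have "- ln (cmod (mob z (X t))) \<le> ln 5 / \<kappa> * (- ln (cmod (mob z ?\<tau>)))"
        by (rule harnack_far[OF Moebius_function_holomorphic[OF zs[OF zz(1)]] _ X1[OF t(1,2)] \<tau>1 far _ \<kappa> \<kappa>2[OF t(1,2)]])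
          (use Moebius_function_norm_lt_1[OF zs[OF zz(1)]] bpos[OF zz(1)] in \<open>auto simp: b_def intro: less_imp_le\<close>)
      then show ?thesis unfolding b_def by (rule pw) (use far bpos[OF zz(1)] in \<open>auto simp: b_def\<close>)
    qed
    have "5 powr (- N) \<le> 5 powr (- (L / \<kappa>))" using LN by simp
    also have "\<dots> = exp (- L) powr K" by (simp add: powr_def K_def)
    also have "\<dots> \<le> ((\<Prod>z\<leftarrow>?fz. b z) * cmod (G ?\<tau>)) powr K"
    proof (rule powr_mono2)
      show "exp (- L) \<le> (\<Prod>z\<leftarrow>?fz. b z) * cmod (G ?\<tau>)"
        unfolding tot2 using nz fz G\<tau> by (intro mult_left_le_one_le) auto
      show "0 \<le> K" using \<kappa> by (simp add: K_def)
    qed auto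
    also have "\<dots> = (\<Prod>z\<leftarrow>?fz. b z powr K) * cmod (G ?\<tau>) powr K"
      using fz G\<tau> by (subst prod_list_powr(1)) (auto simp: powr_mult bpos)
    also have "\<dots> \<le> (\<Prod>z\<leftarrow>?fz. cmod (mob z (X t))) * cmod (G (X t))"
    proof (rule mult_mono[OF _ GX])
      show "(\<Prod>z\<leftarrow>?fz. b z powr K) \<le> (\<Prod>z\<leftarrow>?fz. cmod (mob z (X t)))"
        by (rule prod_list_mono_real) (use fX in auto)
      show "0 \<le> (\<Prod>z\<leftarrow>?fz. cmod (mob z (X t)))" by (rule prod_list_mono_real(1)[where h="\<lambda>z. cmod (mob z (X t))"]) auto
    qed auto
    finally have far: "1 \<le> 5 powr N * ((\<Prod>z\<leftarrow>?fz. cmod (mob z (X t))) * cmod (G (X t)))"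
      by (simp add: powr_minus field_simps)
    have A0: "0 \<le> (\<Prod>z\<leftarrow>?nz. cmod (mob z (of_real y)))"
      by (rule prod_list_mono_real(1)[where h="\<lambda>z. cmod (mob z (of_real y))"]) auto
    have "cmod (f (of_real y)) = (\<Prod>z\<leftarrow>?nz. cmod (mob z (of_real y))) * ((\<Prod>z\<leftarrow>?fz. cmod (mob z (of_real y))) * cmod (G (of_real y)))"
      unfolding fact[OF cy] norm_mult prod_list_norm prod_list_filter_split[of "\<lambda>z. cmod (mob z (of_real y))" zs near] by (simp add: mult.assoc)
    also have "\<dots> \<le> (\<Prod>z\<leftarrow>?nz. cmod (mob z (of_real y))) * 1"
    proof (rule mult_left_mono[OF _ A0], rule mult_le_one)
      have "(\<Prod>z\<leftarrow>?fz. cmod (mob z (of_real y))) \<le> 1 ^ length ?fz"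
        by (rule prod_list_le_power) (use Moebius_function_norm_lt_1[OF zs cy] in \<open>auto intro: less_imp_le\<close>)
      then show "(\<Prod>z\<leftarrow>?fz. cmod (mob z (of_real y))) \<le> 1" by simp
    qed (use G(2)[OF cy] in auto)
    also have "\<dots> \<le> (\<Prod>z\<leftarrow>?nz. (2 + 2 / \<bar>t - (Re z - x) / (y - x)\<bar>) * cmod (mob z (X t)))"
      unfolding mult_1_right
    proof (rule prod_list_mono_real(2))
      fix z assume z: "z \<in> set ?nz"
      then have "t \<noteq> (Re z - x) / (y - x)" using t(3) by (auto simp: cs_def)
      then show "cmod (mob z (of_real y)) \<le> (2 + 2 / \<bar>t - (Re z - x) / (y - x)\<bar>) * cmod (mob z (X t))"
        unfolding X_def using moebius_ratio_real[OF zs x1 y1 xy _ _ refl] z t by auto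
    qed auto
    also have "\<dots> = (\<Prod>c\<leftarrow>cs. 2 + 2 / \<bar>t - c\<bar>) * (\<Prod>z\<leftarrow>?nz. cmod (mob z (X t)))"
      unfolding cs_def by (simp add: prod_list_mult_distrib comp_def)
    finally have 1: "cmod (f (of_real y)) \<le> (\<Prod>c\<leftarrow>cs. 2 + 2 / \<bar>t - c\<bar>) * (\<Prod>z\<leftarrow>?nz. cmod (mob z (X t)))" (is "_ \<le> ?r * ?n") .
    have rn: "0 \<le> ?r" "0 \<le> ?n"
      by (rule prod_list_mono_real(1)[OF _ order_refl]; auto)+
    have "?r * ?n * 1 \<le> ?r * ?n * (5 powr N * ((\<Prod>z\<leftarrow>?fz. cmod (mob z (X t))) * cmod (G (X t))))"
      by (rule mult_left_mono[OF far]) (use rn in auto)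
    also have "\<dots> = 5 powr N * ?r * cmod (f (X t))"
      unfolding fact[OF X1[OF t(1,2)]] norm_mult prod_list_norm prod_list_filter_split[of "\<lambda>z. cmod (mob z (X t))" zs near] by simp
    finally show "cmod (f (of_real y)) \<le> 5 powr N * (\<Prod>c\<leftarrow>cs. 2 + 2 / \<bar>t - c\<bar>) * cmod (f (of_real (x + t * (y - x))))"
      using 1 unfolding X_def[symmetric] by simp
  qed
qed

text \<open>
If the segment starts in the left half of the disc, it is reflected; the reflection exchanges the two
points where the modulus of \<open>f\<close> is known.
\<close>

lemma remez_product:
  fixes x y \<tau> e L N :: real
  assumes f: "f holomorphic_on ball 0 R" "R > 1" and le: "\<And>z. cmod z < 1 \<Longrightarrow> cmod (f z) \<le> 1"
    and \<tau>: "0 < \<tau>" "\<tau> < 1" and e: "0 < e" "e \<le> 1 - \<tau>\<^sup>2"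
    and L: "cmod (f (of_real \<tau>)) = exp (- L)" "cmod (f (- of_real \<tau>)) = exp (- L)" and N: "27 * L \<le> 7 * e * N"
    and x: "- \<tau> \<le> x" "x \<le> \<tau>" and y: "- \<tau> \<le> y" "y \<le> \<tau>" and xy: "x \<noteq> y"
  obtains cs :: "real list" where "real (length cs) \<le> N"
    "\<And>t. 0 \<le> t \<Longrightarrow> t \<le> 1 / 8 \<Longrightarrow> t \<notin> set cs \<Longrightarrow>
       cmod (f (of_real y)) \<le> 5 powr N * (\<Prod>c\<leftarrow>cs. 2 + 2 / \<bar>t - c\<bar>) * cmod (f (of_real (x + t * (y - x))))"
proof (cases "0 \<le> x")
  case True
  show ?thesis
    by (rule remez_product_pos[OF f le \<tau> e L(1) N True x(2) y xy]) (assumption, erule that, blast)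
next
  case False
  let ?g = "\<lambda>z. f (- z)"
  have g: "?g holomorphic_on ball 0 R"
  proof -
    have "uminus holomorphic_on ball (0::complex) R" "uminus ` ball (0::complex) R \<subseteq> ball 0 R"
      by (auto intro!: holomorphic_intros)
    from holomorphic_on_compose_gen[OF this(1) f(1) this(2)] show ?thesis by (simp add: comp_def)
  qed
  obtain cs :: "real list" where cs: "real (length cs) \<le> N"
    "\<And>t. 0 \<le> t \<Longrightarrow> t \<le> 1 / 8 \<Longrightarrow> t \<notin> set cs \<Longrightarrow>
       cmod (?g (of_real (- y))) \<le> 5 powr N * (\<Prod>c\<leftarrow>cs. 2 + 2 / \<bar>t - c\<bar>) * cmod (?g (of_real (- x + t * (- y - - x))))"
    by (rule remez_product_pos[OF g f(2) _ \<tau> e _ N, of "-x" "-y"]) (use le L False x y xy in auto)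
  show ?thesis
  proof (rule that[OF cs(1)])
    fix t assume t: "0 \<le> t" "t \<le> 1/8" "t \<notin> set cs"
    have eq: "- complex_of_real (- x + t * (- y - - x)) = of_real (x + t * (y - x))" by (simp add: algebra_simps)
    show "cmod (f (of_real y)) \<le> 5 powr N * (\<Prod>c\<leftarrow>cs. 2 + 2 / \<bar>t - c\<bar>) * cmod (f (of_real (x + t * (y - x))))"
      using cs(2)[OF t] by (simp only: eq of_real_minus minus_minus)
  qed
qed

section \<open>The measure of the set where a Remez product is large\<close>

text \<open>
The weighted inequality of arithmetic and geometric means, the list being filled up with the factor
\<open>1\<close> to total weight \<open>N\<close>.
\<close>

lemma prod_list_powr_le_mean:
  fixes N :: real
  assumes N: "0 < N" and len: "real (length xs) \<le> N" and pos: "\<And>x. x \<in> set xs \<Longrightarrow> 1 \<le> x"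
  shows "(\<Prod>x\<leftarrow>xs. x) powr (1 / N) \<le> (\<Sum>x\<leftarrow>xs. x) / N + (1 - real (length xs) / N)"
proof -
  define m where "m = (\<Sum>x\<leftarrow>xs. x) / N + (1 - real (length xs) / N)"
  have s: "real (length xs) \<le> (\<Sum>x\<leftarrow>xs. x)" "1 \<le> (\<Prod>x\<leftarrow>xs. x)" 
    using pos
  proof (induction xs)
    case (Cons a xs)
    { case 1
      have "1 \<le> a" "real (length xs) \<le> sum_list (map (\<lambda>x. x) xs)" using 1 Cons.IH(1) by auto
      then show ?case by simp }
    { case 2
      then have "1 \<le> a" "1 \<le> prod_list (map (\<lambda>x. x) xs)" using Cons.IH(2) by auto
      then have "1 * 1 \<le> a * prod_list (map (\<lambda>x. x) xs)" by (intro mult_mono) auto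
      then show ?case by simp }
  qed auto
  have m: "1 \<le> m" using s N by (simp add: m_def field_simps)
  have "(\<Sum>x\<leftarrow>xs. ln x) \<le> (\<Sum>x\<leftarrow>xs. x) / m - real (length xs) + real (length xs) * ln m"
    using pos
  proof (induction xs)
    case (Cons a xs)
    have "ln (a / m) \<le> a / m - 1" using Cons.prems[of a] m by (intro ln_le_minus_one) auto
    then have "ln a \<le> a / m - 1 + ln m" using Cons.prems[of a] m by (simp add: ln_div)
    moreover have "(\<Sum>x\<leftarrow>xs. ln x) \<le> (\<Sum>x\<leftarrow>xs. x) / m - real (length xs) + real (length xs) * ln m"
      by (rule Cons.IH) (use Cons.prems in auto)
    ultimately show ?case by (simp add: add_divide_distrib algebra_simps)
  qed auto
  moreover have "ln (\<Prod>x\<leftarrow>xs. x) = (\<Sum>x\<leftarrow>xs. ln x)"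
    using pos
  proof (induction xs)
    case (Cons a xs)
    have "0 < (\<Prod>x\<leftarrow>xs. x)"
      using Cons.prems by (induction xs) (auto intro!: mult_pos_pos simp: less_le_trans[OF zero_less_one])
    moreover have "0 < a" using Cons.prems[of a] by simp
    ultimately show ?case using Cons.IH Cons.prems by (simp add: ln_mult)
  qed auto
  ultimately have A: "ln (\<Prod>x\<leftarrow>xs. x) / N \<le> ((\<Sum>x\<leftarrow>xs. x) / m - real (length xs) + real (length xs) * ln m) / N"
    using N by (simp add: divide_right_mono)
  have B: "0 \<le> (1 - real (length xs) / N) * (1 / m - 1 + ln m)"
  proof (rule mult_nonneg_nonneg)
    show "0 \<le> 1 - real (length xs) / N" using len N by simp
    have "ln (1 / m) \<le> 1 / m - 1" using m by (intro ln_le_minus_one) auto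
    then show "0 \<le> 1 / m - 1 + ln m" using m by (simp add: ln_div)
  qed
  have C: "(\<Sum>x\<leftarrow>xs. x) / N = m - (1 - real (length xs) / N)" by (simp add: m_def)
  have "((\<Sum>x\<leftarrow>xs. x) / m - real (length xs) + real (length xs) * ln m) / N
      = ((\<Sum>x\<leftarrow>xs. x) / N) / m - real (length xs) / N + real (length xs) / N * ln m"
    by (simp add: add_divide_distrib diff_divide_distrib)
  also have "\<dots> = 1 - (1 - real (length xs) / N) / m - real (length xs) / N + real (length xs) / N * ln m"
  proof -
    have "(m - q) / m = 1 - q / m" for q using m by (simp add: diff_divide_distrib)
    then show ?thesis unfolding C by (simp only:)
  qed
  also have "\<dots> = ln m - (1 - real (length xs) / N) * (1 / m - 1 + ln m)"
  proof -
    have "1 - q / m - (1 - q) + (1 - q) * ln m = ln m - q * (1 / m - 1 + ln m)" for q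
      by (simp add: algebra_simps)
    from this[of "1 - real (length xs) / N"] show ?thesis by simp
  qed
  also have "\<dots> \<le> ln m" using B by simp
  finally have "ln (\<Prod>x\<leftarrow>xs. x) / N \<le> ln m" using A by simp
  then have "exp (ln (\<Prod>x\<leftarrow>xs. x) / N) \<le> exp (ln m)" by simp
  then show ?thesis using s m unfolding m_def[symmetric] by (simp add: powr_def)
qed

text \<open>
The worst position of \<open>c\<close> is the midpoint of the interval.
\<close>

lemma nn_integral_inverse_sqrt:
  fixes a c :: real
  assumes a: "0 < a"
  shows "(\<integral>\<^sup>+t. ennreal (1 / sqrt \<bar>t - c\<bar>) * indicator {0..a} t \<partial>lborel) \<le> ennreal (2 * sqrt 2 * sqrt a)"
proof -
  define \<Phi> where "\<Phi> t = 2 * sgn (t - c) * sqrt \<bar>t - c\<bar>" for t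
  have "((\<lambda>t. 1 / sqrt \<bar>t - c\<bar>) has_integral (\<Phi> a - \<Phi> 0)) {0..a}"
  proof (rule fundamental_theorem_of_calculus_interior_strong[of "{c}"])
    fix t assume "t \<in> {0<..<a} - {c}"
    then consider "t < c" | "t > c" by fastforce
    then show "(\<Phi> has_vector_derivative 1 / sqrt \<bar>t - c\<bar>) (at t)"
    proof cases
      case 1
      have "((\<lambda>t. - 2 * sqrt (c - t)) has_real_derivative 1 / sqrt \<bar>t - c\<bar>) (at t)"
        using 1 by (auto intro!: derivative_eq_intros simp: field_simps)
      then show ?thesis unfolding has_real_derivative_iff_has_vector_derivative
        by (rule has_vector_derivative_transform_within_open[of _ _ _ "{..<c}"]) (use 1 in \<open>auto simp: \<Phi>_def\<close>)
    next
      case 2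
      have "((\<lambda>t. 2 * sqrt (t - c)) has_real_derivative 1 / sqrt \<bar>t - c\<bar>) (at t)"
        using 2 by (auto intro!: derivative_eq_intros simp: field_simps)
      then show ?thesis unfolding has_real_derivative_iff_has_vector_derivative
        by (rule has_vector_derivative_transform_within_open[of _ _ _ "{c<..}"]) (use 2 in \<open>auto simp: \<Phi>_def\<close>)
    qed
  next
    have eq: "\<Phi> = (\<lambda>t. 2 * (sqrt (max 0 (t - c)) - sqrt (max 0 (c - t))))"
      by (rule ext) (auto simp: \<Phi>_def sgn_if max_def)
    show "continuous_on {0..a} \<Phi>" unfolding eq by (intro continuous_intros)
  qed (use a in auto)
  then have "(\<integral>\<^sup>+t. ennreal (1 / sqrt \<bar>t - c\<bar>) * indicator {0..a} t \<partial>lborel) = ennreal (\<Phi> a - \<Phi> 0)"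
    by (intro nn_integral_has_integral_lebesgue') auto
  also have "\<Phi> a - \<Phi> 0 \<le> 2 * sqrt 2 * sqrt a"
  proof -
    have sqa: "sqrt a \<le> sqrt 2 * sqrt a" using a by (simp add: real_sqrt_mult[symmetric])
    consider "c \<le> 0" | "a \<le> c" | "0 < c" "c < a" by linarith
    then show ?thesis
    proof cases
      case 1
      have "sqrt (a - c) \<le> sqrt a + sqrt (- c)" using sqrt_add_le_add_sqrt[of a "-c"] a 1 by simp
      moreover have "\<Phi> a - \<Phi> 0 = 2 * sqrt (a - c) - 2 * sqrt (- c)" using 1 a by (auto simp: \<Phi>_def sgn_if)
      ultimately show ?thesis using sqa by linarith
    next
      case 2
      have "sqrt c \<le> sqrt a + sqrt (c - a)" using sqrt_add_le_add_sqrt[of a "c - a"] a 2 by simp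
      moreover have "\<Phi> a = - 2 * sqrt (c - a)" "\<Phi> 0 = - 2 * sqrt c"
        using 2 a by (cases "a = c"; simp add: \<Phi>_def)+
      ultimately show ?thesis using sqa by linarith
    next
      case 3
      have "(sqrt (a - c) + sqrt c)\<^sup>2 \<le> (sqrt 2 * sqrt a)\<^sup>2"
      proof -
        have "0 \<le> (sqrt (a - c) - sqrt c)\<^sup>2" by simp
        then show ?thesis using 3 a by (simp add: power2_sum power2_diff power_mult_distrib)
      qed
      then have "sqrt (a - c) + sqrt c \<le> sqrt 2 * sqrt a" by (rule power2_le_imp_le) (use a in auto)
      then show ?thesis using 3 by (auto simp: \<Phi>_def sgn_if)
    qed
  qed
  finally show ?thesis by (simp add: ennreal_leI)
qed

text \<open>
Half of the exponent is sacrificed: each factor enters with a square root, since \<open>1 / sqrt \<bar>t - c\<bar>\<close> is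
integrable in \<open>t\<close> and \<open>1 / \<bar>t - c\<bar>\<close> is not. The inequality of means reduces the product to a sum, and
Markov's inequality finishes the proof. The bound does not depend on the positions \<open>c\<close>.
\<close>

lemma remez_measure:
  fixes a N K :: real and cs :: "real list"
  assumes N: "0 < N" and len: "real (length cs) \<le> N" and a: "0 < a" and K: "0 < K"
    and B [measurable]: "B \<in> sets borel"
    and bad: "\<And>t. t \<in> B \<Longrightarrow> 0 \<le> t \<Longrightarrow> t \<le> a \<Longrightarrow> t \<notin> set cs \<Longrightarrow> K \<le> 5 powr N * (\<Prod>c\<leftarrow>cs. 2 + 2 / \<bar>t - c\<bar>)"
  shows "measure (uniform_measure lborel {0..a}) B \<le> sqrt 5 * (sqrt 2 + 4 / sqrt a) * K powr (- 1 / (2 * N))"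
proof -
  define k where "k = K powr (1 / (2 * N))"
  have k: "0 < k" using K by (simp add: k_def)
  define w where "w = 1 - real (length cs) / N"
  have w: "0 \<le> w" using len N by (simp add: w_def)
  define r where "r c t = sqrt 2 + sqrt 2 * (1 / sqrt \<bar>t - c\<bar>)" for c t :: real
  \<comment> \<open>\<open>m\<close> bounds the mean of the square roots of the factors, \<open>w\<close> being the weight of the filling factors \<open>1\<close>\<close>
  define m where "m t = (\<Sum>c\<leftarrow>cs. r c t) / N + w" for t
  have r0: "0 \<le> r c t" for c t by (simp add: r_def)
  have rm [measurable]: "r c \<in> borel_measurable borel" for c unfolding r_def by measurable
  have pt: "k \<le> sqrt 5 * m t" if t: "t \<in> B" "0 \<le> t" "t \<le> a" "t \<notin> set cs" for t
  proof -
    let ?q = "\<lambda>c. 2 + 2 / \<bar>t - c\<bar>"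
    have q: "1 \<le> ?q c" for c by (simp add: add_increasing2)
    have "k \<le> (5 powr N * (\<Prod>c\<leftarrow>cs. ?q c)) powr (1 / (2 * N))"
      unfolding k_def using bad[OF t] K N by (intro powr_mono2) auto
    also have "\<dots> = sqrt 5 * (\<Prod>c\<leftarrow>cs. ?q c) powr (1 / (2 * N))"
    proof -
      have "0 \<le> (\<Prod>c\<leftarrow>cs. ?q c)" by (induction cs) (auto intro!: mult_nonneg_nonneg)
      then show ?thesis using N by (simp add: powr_mult powr_powr powr_half_sqrt)
    qed
    also have "(\<Prod>c\<leftarrow>cs. ?q c) powr (1 / (2 * N)) = (\<Prod>x\<leftarrow>map (\<lambda>c. sqrt (?q c)) cs. x) powr (1 / N)"
    proof -
      have "(\<Prod>x\<leftarrow>map (\<lambda>c. sqrt (?q c)) cs. x) = sqrt (\<Prod>c\<leftarrow>cs. ?q c)"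
        by (induction cs) (simp_all add: real_sqrt_mult del: real_sqrt_eq_iff)
      moreover have "0 \<le> (\<Prod>c\<leftarrow>cs. ?q c)" by (induction cs) (auto intro!: mult_nonneg_nonneg)
      ultimately show ?thesis by (simp add: powr_half_sqrt[symmetric] powr_powr)
    qed
    also have "\<dots> \<le> (\<Sum>x\<leftarrow>map (\<lambda>c. sqrt (?q c)) cs. x) / N + (1 - real (length (map (\<lambda>c. sqrt (?q c)) cs)) / N)"
      by (rule prod_list_powr_le_mean[OF N]) (use len q in auto)
    also have "\<dots> \<le> m t"
    proof -
      have "(\<Sum>x\<leftarrow>map (\<lambda>c. sqrt (?q c)) cs. x) \<le> (\<Sum>c\<leftarrow>cs. r c t)"
        unfolding map_map comp_def
      proof (rule sum_list_mono)
        fix c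
        have "sqrt (?q c) \<le> sqrt 2 + sqrt (2 / \<bar>t - c\<bar>)" by (rule sqrt_add_le_add_sqrt) auto
        then show "sqrt (?q c) \<le> r c t" by (simp add: r_def real_sqrt_divide)
      qed
      then show ?thesis unfolding m_def w_def using N by (simp add: divide_right_mono)
    qed
    finally show ?thesis by simp
  qed
  let ?I = "indicator {0..a} :: real \<Rightarrow> ennreal"
  define M0 where "M0 = sqrt 2 * a + sqrt 2 * (2 * sqrt 2 * sqrt a)"
  have M0: "0 \<le> M0" "a \<le> M0"
  proof -
    show "0 \<le> M0" unfolding M0_def using a by simp
    have "a * 1 \<le> a * sqrt 2" using a by (intro mult_left_mono) auto
    then show "a \<le> M0" unfolding M0_def using a by (simp add: mult.commute add_increasing2)
  qed
  have ri: "(\<integral>\<^sup>+t. ennreal (r c t) * ?I t \<partial>lborel) \<le> ennreal M0" for c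
  proof -
    have "(\<integral>\<^sup>+t. ennreal (r c t) * ?I t \<partial>lborel) =
      (\<integral>\<^sup>+t. ennreal (sqrt 2) * ?I t + ennreal (sqrt 2) * (ennreal (1 / sqrt \<bar>t - c\<bar>) * ?I t) \<partial>lborel)"
    proof (rule nn_integral_cong)
      fix t
      have "ennreal (r c t) = ennreal (sqrt 2) + ennreal (sqrt 2) * ennreal (1 / sqrt \<bar>t - c\<bar>)"
        unfolding r_def by (subst ennreal_plus) (simp_all add: ennreal_mult'[symmetric])
      then show "ennreal (r c t) * ?I t = ennreal (sqrt 2) * ?I t + ennreal (sqrt 2) * (ennreal (1 / sqrt \<bar>t - c\<bar>) * ?I t)"
        by (simp only: distrib_right mult.assoc)
    qed
    also have "\<dots> = ennreal (sqrt 2) * ennreal a + ennreal (sqrt 2) * (\<integral>\<^sup>+t. ennreal (1 / sqrt \<bar>t - c\<bar>) * ?I t \<partial>lborel)"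
      using a by (simp add: nn_integral_add nn_integral_cmult)
    also have "\<dots> \<le> ennreal (sqrt 2) * ennreal a + ennreal (sqrt 2) * ennreal (2 * sqrt 2 * sqrt a)"
      by (intro add_left_mono mult_left_mono nn_integral_inverse_sqrt a) simp
    also have "\<dots> = ennreal M0" unfolding M0_def using a by (simp add: ennreal_plus ennreal_mult)
    finally show ?thesis .
  qed
  have sl: "(\<integral>\<^sup>+t. ennreal (\<Sum>c\<leftarrow>cs'. r c t) * ?I t \<partial>lborel) \<le> ennreal (real (length cs') * M0)" for cs'
  proof (induction cs')
    case (Cons c cs')
    have s0: "0 \<le> (\<Sum>c\<leftarrow>cs'. r c t)" for t using r0 by (intro sum_list_nonneg) auto
    have mm: "(\<lambda>t. \<Sum>c\<leftarrow>cs'. r c t) \<in> borel_measurable borel"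
      by (induction cs') auto
    have "(\<integral>\<^sup>+t. ennreal (\<Sum>c\<leftarrow>c # cs'. r c t) * ?I t \<partial>lborel)
      = (\<integral>\<^sup>+t. ennreal (r c t) * ?I t + ennreal (\<Sum>c\<leftarrow>cs'. r c t) * ?I t \<partial>lborel)"
      by (intro nn_integral_cong) (simp add: ennreal_plus r0 s0 distrib_right)
    also have "\<dots> = (\<integral>\<^sup>+t. ennreal (r c t) * ?I t \<partial>lborel) + (\<integral>\<^sup>+t. ennreal (\<Sum>c\<leftarrow>cs'. r c t) * ?I t \<partial>lborel)"
      using mm by (intro nn_integral_add) auto
    also have "\<dots> \<le> ennreal M0 + ennreal (real (length cs') * M0)" by (intro add_mono ri Cons.IH)
    also have "\<dots> = ennreal (real (length (c # cs')) * M0)" using M0 by (simp add: ennreal_plus[symmetric] distrib_right del: ennreal_plus)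
    finally show ?case .
  qed simp
  have s0: "0 \<le> (\<Sum>c\<leftarrow>cs. r c t)" for t using r0 by (intro sum_list_nonneg) auto
  have sm: "(\<lambda>t. \<Sum>c\<leftarrow>cs. r c t) \<in> borel_measurable borel" by (induction cs) auto
  have mi: "(\<integral>\<^sup>+t. ennreal (m t) * ?I t \<partial>lborel) \<le> ennreal M0"
  proof -
    have "(\<integral>\<^sup>+t. ennreal (m t) * ?I t \<partial>lborel) = (\<integral>\<^sup>+t. ennreal (1 / N) * (ennreal (\<Sum>c\<leftarrow>cs. r c t) * ?I t) + ennreal w * ?I t \<partial>lborel)"
      unfolding m_def using N w s0
      by (intro nn_integral_cong) (simp add: ennreal_plus ennreal_mult'[symmetric] mult.assoc[symmetric] distrib_right)
    also have "\<dots> = ennreal (1 / N) * (\<integral>\<^sup>+t. ennreal (\<Sum>c\<leftarrow>cs. r c t) * ?I t \<partial>lborel) + ennreal w * ennreal a"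
      using a sm by (simp add: nn_integral_add nn_integral_cmult)
    also have "\<dots> \<le> ennreal (1 / N) * ennreal (real (length cs) * M0) + ennreal w * ennreal M0"
      by (intro add_mono mult_left_mono sl ennreal_leI M0) auto
    also have "\<dots> = ennreal (1 / N * (real (length cs) * M0) + w * M0)"
    proof -
      have "ennreal (1 / N * (real (length cs) * M0)) = ennreal (1 / N) * ennreal (real (length cs) * M0)"
        by (rule ennreal_mult) (use N M0 in auto)
      moreover have "ennreal (w * M0) = ennreal w * ennreal M0" by (rule ennreal_mult) (use w M0 in auto)
      moreover have "ennreal (1 / N * (real (length cs) * M0) + w * M0) = ennreal (1 / N * (real (length cs) * M0)) + ennreal (w * M0)"
        by (rule ennreal_plus) (use N w M0 in auto)
      ultimately show ?thesis by (simp only:)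
    qed
    also have "1 / N * (real (length cs) * M0) + w * M0 = M0" using N by (simp add: w_def field_simps)
    finally show ?thesis .
  qed
  have "ennreal k * emeasure lborel ({0..a} \<inter> B) = (\<integral>\<^sup>+t. ennreal k * indicator ({0..a} \<inter> B) t \<partial>lborel)"
    by (simp add: nn_integral_cmult)
  also have "\<dots> \<le> (\<integral>\<^sup>+t. ennreal (sqrt 5) * (ennreal (m t) * ?I t) \<partial>lborel)"
  proof (rule nn_integral_mono_AE)
    have "AE t in lborel. t \<notin> set cs"
      by (rule AE_not_in, rule finite_imp_null_set_lborel) simp
    then show "AE t in lborel. ennreal k * indicator ({0..a} \<inter> B) t \<le> ennreal (sqrt 5) * (ennreal (m t) * ?I t)"
    proof eventually_elim
      case (elim t)
      show ?case
      proof (cases "t \<in> {0..a} \<inter> B")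
        case True
        then have "ennreal k \<le> ennreal (sqrt 5 * m t)" using pt elim by (intro ennreal_leI) auto
        then show ?thesis using True by (simp add: ennreal_mult')
      qed simp
    qed
  qed
  also have "\<dots> = ennreal (sqrt 5) * (\<integral>\<^sup>+t. ennreal (m t) * ?I t \<partial>lborel)"
    using sm unfolding m_def by (intro nn_integral_cmult) auto
  also have "\<dots> \<le> ennreal (sqrt 5) * ennreal M0" by (intro mult_left_mono mi) simp
  finally have main: "ennreal k * emeasure lborel ({0..a} \<inter> B) \<le> ennreal (sqrt 5 * M0)"
    using M0 by (simp add: ennreal_mult')
  have finB: "emeasure lborel ({0..a} \<inter> B) = ennreal (measure lborel ({0..a} \<inter> B))"
  proof (rule emeasure_eq_ennreal_measure)
    have "emeasure lborel ({0..a} \<inter> B) \<le> emeasure lborel {0..a}" by (rule emeasure_mono) auto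
    then show "emeasure lborel ({0..a} \<inter> B) \<noteq> top" using a by (auto simp: top_unique)
  qed
  have "k * measure lborel ({0..a} \<inter> B) \<le> sqrt 5 * M0"
    using main unfolding finB using k M0 by (simp add: ennreal_mult'[symmetric])
  then have "measure lborel ({0..a} \<inter> B) / a \<le> sqrt 5 * (M0 / a) / k"
    using a k by (simp add: field_simps)
  then have "measure lborel ({0..a} \<inter> B) / a \<le> sqrt 5 * (M0 / a) * (1 / k)" by simp
  moreover have "M0 / a = sqrt 2 + 4 / sqrt a"
  proof -
    have "sqrt 2 * (2 * sqrt 2 * sqrt a) = 4 * sqrt a" by simp
    then have "M0 / a = sqrt 2 + 4 * (sqrt a / a)" unfolding M0_def using a by (simp add: add_divide_distrib)
    also have "sqrt a / a = 1 / sqrt a" using a by (simp add: real_div_sqrt field_simps)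
    finally show ?thesis by simp
  qed
  moreover have "measure (uniform_measure lborel {0..a}) B = measure lborel ({0..a} \<inter> B) / a"
    using a by (subst measure_uniform_measure) auto
  moreover have "1 / k = K powr (- 1 / (2 * N))" unfolding k_def by (simp add: powr_minus field_simps)
  ultimately show ?thesis by (simp only:)
qed

section \<open>Analytic functions of several variables\<close>

text \<open>
Pointwise summability in a ball implies uniform convergence in a smaller one, by comparison with the
absolutely convergent series at the corner of a polydisc.
\<close>

lemma analytic_vec_uniform_limit:
  fixes F :: "complex ^ 'n \<Rightarrow> complex"
  assumes F: "analytic_vec_on F S" and w: "w \<in> S"
  obtains \<rho> and c :: "('n \<Rightarrow> nat) \<Rightarrow> complex" where "0 < \<rho>"
    "uniform_limit (cball w \<rho>) (\<lambda>X z. \<Sum>\<alpha>\<in>X. c \<alpha> * (\<Prod>i\<in>UNIV. (z $ i - w $ i) ^ \<alpha> i)) F (finite_subsets_at_top UNIV)"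
proof -
  obtain r c where r: "0 < r" and c: "\<And>z. z \<in> ball w r \<Longrightarrow>
     ((\<lambda>\<alpha>. c \<alpha> * (\<Prod>i\<in>UNIV. (z $ i - w $ i) ^ \<alpha> i)) has_sum F z) UNIV"
    using F w unfolding analytic_vec_on_def by blast
  \<comment> \<open>the corner \<open>z1\<close> of a polydisc of radius \<open>\<rho>\<close> lies in the ball of convergence, and
    absolute convergence there dominates the series on the polydisc\<close>
  define \<rho> where "\<rho> = r / (2 * real CARD('n))"
  have card: "0 < real CARD('n)" by simp
  have \<rho>: "0 < \<rho>" using r by (simp add: \<rho>_def)
  have inball: "z \<in> ball w r" if "\<And>i. cmod (z $ i - w $ i) \<le> \<rho>" for z
  proof -
    have "norm (z - w) \<le> (\<Sum>i\<in>UNIV. norm ((z - w) $ i))" unfolding norm_vec_def by (rule L2_set_le_sum) simp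
    also have "\<dots> \<le> (\<Sum>i\<in>(UNIV::'n set). \<rho>)" by (intro sum_mono) (use that in simp)
    also have "\<dots> = r / 2" using card by (simp add: \<rho>_def)
    also have "\<dots> < r" using r by simp
    finally show ?thesis by (simp add: dist_norm norm_minus_commute)
  qed
  define z1 where "z1 = (\<chi> i. w $ i + complex_of_real \<rho>)"
  have "z1 \<in> ball w r" by (rule inball) (use \<rho> in \<open>simp add: z1_def\<close>)
  from c[OF this] have "(\<lambda>\<alpha>. c \<alpha> * (\<Prod>i\<in>UNIV. (z1 $ i - w $ i) ^ \<alpha> i)) summable_on UNIV"
    by (rule has_sum_imp_summable)
  then have sumM: "(\<lambda>\<alpha>. norm (c \<alpha> * (\<Prod>i\<in>UNIV. (z1 $ i - w $ i) ^ \<alpha> i))) summable_on UNIV"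
    by (simp add: summable_on_iff_abs_summable_on_complex)
  have ul: "uniform_limit (cball w \<rho>) (\<lambda>X z. \<Sum>\<alpha>\<in>X. c \<alpha> * (\<Prod>i\<in>UNIV. (z $ i - w $ i) ^ \<alpha> i)) F (finite_subsets_at_top UNIV)"
  proof (rule Weierstrass_m_test_general'[OF _ _ sumM])
    fix z assume "z \<in> cball w \<rho>"
    then have b: "cmod (z $ i - w $ i) \<le> \<rho>" for i
      using Finite_Cartesian_Product.norm_nth_le[of "z - w" i] by (simp add: dist_norm norm_minus_commute)
    show "((\<lambda>\<alpha>. c \<alpha> * (\<Prod>i\<in>UNIV. (z $ i - w $ i) ^ \<alpha> i)) has_sum F z) UNIV"
      by (rule c[OF inball[OF b]])
    fix \<alpha>
    show "norm (c \<alpha> * (\<Prod>i\<in>UNIV. (z $ i - w $ i) ^ \<alpha> i)) \<le> norm (c \<alpha> * (\<Prod>i\<in>UNIV. (z1 $ i - w $ i) ^ \<alpha> i))"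
      unfolding norm_mult prod_norm[symmetric] norm_power
      by (intro mult_left_mono prod_mono conjI power_mono) (use b \<rho> in \<open>auto simp: z1_def\<close>)
  qed
  show ?thesis by (rule that[OF \<rho> ul])
qed

lemma analytic_vec_isCont:
  fixes F :: "complex ^ 'n \<Rightarrow> complex"
  assumes F: "analytic_vec_on F S" and w: "w \<in> S"
  shows "isCont F w"
proof -
  obtain \<rho> c where \<rho>: "0 < \<rho>" and
    ul: "uniform_limit (cball w \<rho>) (\<lambda>X z. \<Sum>\<alpha>\<in>X. c \<alpha> * (\<Prod>i\<in>UNIV. (z $ i - w $ i) ^ \<alpha> i)) F (finite_subsets_at_top UNIV)"
    by (rule analytic_vec_uniform_limit[OF F w])
  have "continuous_on (cball w \<rho>) F"
    by (rule uniform_limit_theorem[OF _ ul]) (auto intro!: always_eventually continuous_intros)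
  then show ?thesis using \<rho> by (auto intro: continuous_on_interior)
qed

lemma analytic_vec_compose_holomorphic:
  fixes F :: "complex ^ 'n \<Rightarrow> complex" and Z :: "complex \<Rightarrow> complex ^ 'n"
  assumes F: "analytic_vec_on F S" and D: "open D"
    and Z: "\<And>i. (\<lambda>\<zeta>. Z \<zeta> $ i) holomorphic_on D" and ZS: "\<And>\<zeta>. \<zeta> \<in> D \<Longrightarrow> Z \<zeta> \<in> S"
  shows "(\<lambda>\<zeta>. F (Z \<zeta>)) holomorphic_on D"
proof -
  have "(\<lambda>\<zeta>. F (Z \<zeta>)) field_differentiable (at \<zeta>0)" if \<zeta>0: "\<zeta>0 \<in> D" for \<zeta>0
  proof -
    define w where "w = Z \<zeta>0"
    obtain \<rho> c where \<rho>: "0 < \<rho>" and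
      ul: "uniform_limit (cball w \<rho>) (\<lambda>X z. \<Sum>\<alpha>\<in>X. c \<alpha> * (\<Prod>i\<in>UNIV. (z $ i - w $ i) ^ \<alpha> i)) F (finite_subsets_at_top UNIV)"
      by (rule analytic_vec_uniform_limit[OF F ZS[OF \<zeta>0], folded w_def])
    have "continuous_on D (\<lambda>\<zeta>. \<chi> i. Z \<zeta> $ i)"
      by (intro continuous_on_vec_lambda holomorphic_on_imp_continuous_on Z)
    then have "isCont Z \<zeta>0" using D \<zeta>0 by (simp add: continuous_on_eq_continuous_at)
    then have "open (D \<inter> Z -` ball w \<rho>)"
      using \<open>continuous_on D _\<close> D by (simp add: continuous_open_preimage)
    moreover have "\<zeta>0 \<in> D \<inter> Z -` ball w \<rho>" using \<zeta>0 \<rho> by (simp add: w_def)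
    ultimately obtain d where d: "0 < d" "cball \<zeta>0 d \<subseteq> D \<inter> Z -` ball w \<rho>" unfolding open_contains_cball by blast
    let ?f = "\<lambda>X \<zeta>. \<Sum>\<alpha>\<in>X. c \<alpha> * (\<Prod>i\<in>UNIV. (Z \<zeta> $ i - w $ i) ^ \<alpha> i)"
    have ul': "uniform_limit (cball \<zeta>0 d) ?f (\<lambda>\<zeta>. F (Z \<zeta>)) (finite_subsets_at_top UNIV)"
      by (rule uniform_limit_compose'[OF ul]) (use d(2) in auto)
    obtain "(\<lambda>\<zeta>. F (Z \<zeta>)) holomorphic_on ball \<zeta>0 d"
    proof (rule holomorphic_uniform_limit[OF _ ul'])
      have h: "?f X holomorphic_on D" for X by (intro holomorphic_intros Z)
      show "\<forall>\<^sub>F X in finite_subsets_at_top UNIV. continuous_on (cball \<zeta>0 d) (?f X) \<and> ?f X holomorphic_on ball \<zeta>0 d"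
        using d by (intro always_eventually allI conjI holomorphic_on_imp_continuous_on holomorphic_on_subset[OF h]) auto
    qed auto
    then show ?thesis using d(1) by (simp add: holomorphic_on_def field_differentiable_def at_within_open_NO_MATCH)
  qed
  then show ?thesis by (auto simp: holomorphic_on_def field_differentiable_at_within)
qed

section \<open>The bending map and convexity\<close>

definition shrink :: "real \<Rightarrow> real \<Rightarrow> real" where
  "shrink e s = (1 - e - s) / (1 + e - s)"

text \<open>
The scalar depends on \<open>norm y ^ 2\<close> and not on \<open>norm y\<close>, so that it extends holomorphically to
complex lines.
\<close>

definition bend :: "real \<Rightarrow> 'a::real_inner \<Rightarrow> 'a" where
  "bend e y = shrink e ((norm y)\<^sup>2) *\<^sub>R y"

text \<open>
With \<open>p + q = 1\<close> this is the uniform convexity of the Euclidean norm, with the exact defect. Weights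
of sum greater than \<open>1\<close> occur because bent chords bulge.
\<close>

lemma norm_sq_convex_comb:
  fixes a b :: "'a::real_inner"
  shows "(norm (p *\<^sub>R a + q *\<^sub>R b))\<^sup>2 = (p + q) * (p * (norm a)\<^sup>2 + q * (norm b)\<^sup>2) - p * q * (norm (a - b))\<^sup>2"
  by (simp add: power2_norm_eq_inner inner_add_left inner_add_right inner_diff_left inner_diff_right inner_commute algebra_simps)

lemma norm_sq_bound_convex:
  fixes y z :: "'a::real_inner"
  assumes "(norm y)\<^sup>2 \<le> b" "(norm z)\<^sup>2 \<le> b" "0 \<le> t" "t \<le> 1"
  shows "(norm ((1 - t) *\<^sub>R y + t *\<^sub>R z))\<^sup>2 \<le> b"
proof -
  have "(norm ((1 - t) *\<^sub>R y + t *\<^sub>R z))\<^sup>2 = (1 - t) * (norm y)\<^sup>2 + t * (norm z)\<^sup>2 - (1 - t) * t * (norm (y - z))\<^sup>2"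
    unfolding norm_sq_convex_comb by simp
  moreover have "0 \<le> (1 - t) * t * (norm (y - z))\<^sup>2" using assms by simp
  moreover have "(1 - t) * (norm y)\<^sup>2 + t * (norm z)\<^sup>2 \<le> b" using assms by (intro convex_bound_le) auto
  ultimately show ?thesis by linarith
qed

lemma norm_sq_scaled_diff:
  fixes y z :: "'a::real_inner"
  shows "(norm (a *\<^sub>R y - b *\<^sub>R z))\<^sup>2 = a * b * (norm (y - z))\<^sup>2 + (a - b) * (a * (norm y)\<^sup>2 - b * (norm z)\<^sup>2)"
  by (simp add: power2_norm_eq_inner inner_diff_left inner_diff_right inner_commute algebra_simps)

lemma shrink_bounds:
  assumes e: "0 < e" and s: "s \<le> 1 - e - m" and m: "0 < m"
  shows "0 < shrink e s" "shrink e s < 1" "1 - 2 * e / m \<le> shrink e s"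
    "1 / shrink e s = 1 + 2 * e / (1 - e - s)"
proof -
  have p: "0 < 1 - e - s" "0 < 1 + e - s" using assms by auto
  then show "0 < shrink e s" "shrink e s < 1" "1 / shrink e s = 1 + 2 * e / (1 - e - s)"
    using e unfolding shrink_def by (auto simp: field_simps)
  have "shrink e s = 1 - 2 * e / (1 + e - s)" using p by (simp add: shrink_def field_simps)
  also have "\<dots> \<ge> 1 - 2 * e / m" using assms p by (auto intro!: divide_left_mono)
  finally show "1 - 2 * e / m \<le> shrink e s" .
qed

text \<open>
The excess of the chord of \<open>1 / x\<close> over its value at an intermediate point that is shifted by
\<open>t (1 - t) D\<close>. It measures the bulge of a bent chord, \<open>D\<close> being the defect in
the uniform convexity of the norm.
\<close>

lemma inverse_chord_excess:
  fixes a b t D :: real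
  assumes "0 < m" "m \<le> a" "m \<le> b" "0 \<le> t" "t \<le> 1" "0 \<le> D"
  shows "0 \<le> (1 - t) / a + t / b - 1 / ((1 - t) * a + t * b + t * (1 - t) * D)"
    and "(1 - t) / a + t / b - 1 / ((1 - t) * a + t * b + t * (1 - t) * D)
      \<le> t * (1 - t) * ((a - b)\<^sup>2 / m ^ 3 + D / m\<^sup>2)"
proof -
  define c where "c = (1 - t) * a + t * b"
  define T where "T = t * (1 - t)"
  have T: "0 \<le> T" using assms by (simp add: T_def)
  have pos: "0 < a" "0 < b" using assms by auto
  have c: "m \<le> c" unfolding c_def using assms convex_bound_le[of "-a" "-m" "-b" "1-t" t] by simp
  have cp: "0 < c" "0 < c + T * D" using c assms T by (auto intro!: add_pos_nonneg mult_nonneg_nonneg)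
  have cD: "m \<le> c + T * D" using c T assms by (simp add: add_increasing2)
  have e1: "(1 - t) / a + t / b - 1 / c = T * ((a - b)\<^sup>2 / (a * b * c))"
  proof -
    have "((1 - t) * b + t * a) * c - a * b = T * (a - b)\<^sup>2"
      by (simp add: c_def T_def power2_eq_square algebra_simps)
    then have "((1 - t) / a + t / b - 1 / c) * (a * b * c) = T * (a - b)\<^sup>2"
      using pos cp by (simp add: field_simps)
    then show ?thesis using pos cp by (simp add: nonzero_eq_divide_eq)
  qed
  have e2: "1 / c - 1 / (c + T * D) = T * (D / (c * (c + T * D)))"
    using cp by (simp add: field_simps)
  have eq: "(1 - t) / a + t / b - 1 / (c + T * D) = T * ((a - b)\<^sup>2 / (a * b * c) + D / (c * (c + T * D)))"
    using e1 e2 by (simp add: distrib_left)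
  show "0 \<le> (1 - t) / a + t / b - 1 / ((1 - t) * a + t * b + t * (1 - t) * D)"
    unfolding c_def[symmetric] T_def[symmetric] eq using T pos cp assms by (intro mult_nonneg_nonneg add_nonneg_nonneg divide_nonneg_pos mult_pos_pos) auto
  have "m * m * m \<le> a * b * c" using assms c pos by (intro mult_mono) auto
  then have 1: "(a - b)\<^sup>2 / (a * b * c) \<le> (a - b)\<^sup>2 / m ^ 3"
    using assms by (intro divide_left_mono) (auto simp: power3_eq_cube intro!: mult_pos_pos pos cp)
  have "m * m \<le> c * (c + T * D)" using assms c cD cp by (intro mult_mono) auto
  then have 2: "D / (c * (c + T * D)) \<le> D / m\<^sup>2"
    using assms by (intro divide_left_mono) (auto simp: power2_eq_square intro!: mult_pos_pos cp)
  show "(1 - t) / a + t / b - 1 / ((1 - t) * a + t * b + t * (1 - t) * D)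
      \<le> t * (1 - t) * ((a - b)\<^sup>2 / m ^ 3 + D / m\<^sup>2)"
    unfolding c_def[symmetric] T_def[symmetric] eq using 1 2 T by (intro mult_left_mono add_mono) auto
qed

lemma bend_distance_ge:
  fixes y z :: "'a::real_inner"
  assumes e: "0 < e" and m: "0 < m" and y: "(norm y)\<^sup>2 \<le> 1 - e - m" and z: "(norm z)\<^sup>2 \<le> 1 - e - m"
  shows "shrink e ((norm y)\<^sup>2) * shrink e ((norm z)\<^sup>2) * (1 - 8 * e * (1 - e - m) / m\<^sup>2) * (norm (y - z))\<^sup>2
    \<le> (norm (bend e y - bend e z))\<^sup>2"
proof -
  define s s' where "s = (norm y)\<^sup>2" and "s' = (norm z)\<^sup>2"
  define g g' where "g = shrink e s" and "g' = shrink e s'"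
  define D where "D = (norm (y - z))\<^sup>2"
  have s: "0 \<le> s" "0 \<le> s'" "s \<le> 1 - e - m" "s' \<le> 1 - e - m" using y z by (auto simp: s_def s'_def)
  note b = shrink_bounds[OF e s(3) m, folded g_def] and b' = shrink_bounds[OF e s(4) m, folded g'_def]
  define n n' where "n = 1 + e - s" and "n' = 1 + e - s'"
  have n: "m < n" "m < n'" "0 < n" "0 < n'" using s e m by (auto simp: n_def n'_def)
  have gn: "g = (n - 2 * e) / n" "g' = (n' - 2 * e) / n'" by (simp_all add: g_def g'_def n_def n'_def shrink_def algebra_simps)
  have nm: "m \<le> n - 2 * e" "m \<le> n' - 2 * e" using s by (auto simp: n_def n'_def)
  have eq: "(norm (bend e y - bend e z))\<^sup>2 = g * g' * D + (g - g') * (g * s - g' * s')"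
    unfolding bend_def s_def[symmetric] s'_def[symmetric] g_def[symmetric] g'_def[symmetric]
    unfolding D_def s_def s'_def by (rule norm_sq_scaled_diff)
  have ns: "s = 1 + e - n" "s' = 1 + e - n'" by (simp_all add: n_def n'_def)
  have gd: "g - g' = - 2 * e * (s - s') / (n * n')"
    unfolding gn ns using n by (simp add: field_simps)
  have gs: "g * s - g' * s' = (s - s') * (1 - 2 * e * (1 + e) / (n * n'))"
    unfolding gn ns using n by (simp add: field_simps)
  have ab: "\<bar>s - s'\<bar> \<le> norm (y - z) * (norm y + norm z)"
  proof -
    have "s - s' = (y - z) \<bullet> (y + z)" unfolding s_def s'_def
      by (simp add: power2_norm_eq_inner inner_diff_left inner_diff_right inner_add_right inner_commute)
    then have "\<bar>s - s'\<bar> \<le> norm (y - z) * norm (y + z)" using Cauchy_Schwarz_ineq2 by metis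
    also have "\<dots> \<le> norm (y - z) * (norm y + norm z)" by (intro mult_left_mono norm_triangle_ineq) auto
    finally show ?thesis .
  qed
  have "(s - s')\<^sup>2 \<le> (norm (y - z) * (norm y + norm z))\<^sup>2"
    using ab by (metis abs_ge_zero power2_abs power_mono)
  also have "\<dots> = D * (norm y + norm z)\<^sup>2" by (simp add: D_def power_mult_distrib)
  also have "(norm y + norm z)\<^sup>2 \<le> 2 * (s + s')"
  proof -
    have "0 \<le> (norm y - norm z)\<^sup>2" by simp
    then show ?thesis by (simp add: s_def s'_def power2_sum power2_diff)
  qed
  also have "2 * (s + s') \<le> 4 * (1 - e - m)" using s by simp
  finally have ds: "(s - s')\<^sup>2 \<le> D * (4 * (1 - e - m))" by (simp add: D_def mult_left_mono)
  have "(g - g') * (g * s - g' * s') = - (2 * e * (s - s')\<^sup>2 / (n * n')) * (1 - 2 * e * (1 + e) / (n * n'))"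
    unfolding gd gs by (simp add: power2_eq_square)
  also have "\<dots> \<ge> - (2 * e * (s - s')\<^sup>2 / (n * n')) * 1"
  proof (rule mult_left_mono_neg)
    show "1 - 2 * e * (1 + e) / (n * n') \<le> 1" using e n by simp
    show "- (2 * e * (s - s')\<^sup>2 / (n * n')) \<le> 0" using e n by simp
  qed
  finally have low: "- (2 * e * (s - s')\<^sup>2 / (n * n')) \<le> (g - g') * (g * s - g' * s')" by simp
  have "2 * e * (s - s')\<^sup>2 / (n * n') \<le> g * g' * (8 * e * (1 - e - m) / m\<^sup>2) * D"
  proof -
    have gg: "g * g' * (n * n') = (n - 2 * e) * (n' - 2 * e)" unfolding gn using n by simp
    have "m\<^sup>2 \<le> (n - 2 * e) * (n' - 2 * e)" unfolding power2_eq_square using nm m by (intro mult_mono) auto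
    then have "2 * e * (D * (4 * (1 - e - m))) * m\<^sup>2 \<le> 2 * e * (D * (4 * (1 - e - m))) * ((n - 2 * e) * (n' - 2 * e))"
      using e s by (intro mult_left_mono mult_nonneg_nonneg) (auto simp: D_def)
    then have "2 * e * (D * (4 * (1 - e - m))) \<le> (2 * e * (D * (4 * (1 - e - m)))) * (g * g' * (n * n')) / m\<^sup>2"
      unfolding gg using m by (simp add: pos_le_divide_eq)
    moreover have "2 * e * (s - s')\<^sup>2 \<le> 2 * e * (D * (4 * (1 - e - m)))" using ds e by simp
    ultimately have "2 * e * (s - s')\<^sup>2 \<le> (2 * e * (D * (4 * (1 - e - m)))) * (g * g' * (n * n')) / m\<^sup>2" by simp
    also have "\<dots> = g * g' * (8 * e * (1 - e - m) / m\<^sup>2) * D * (n * n')" by simp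
    finally show ?thesis using n by (simp add: pos_divide_le_eq)
  qed
  then have "g * g' * D - g * g' * (8 * e * (1 - e - m) / m\<^sup>2) * D \<le> (norm (bend e y - bend e z))\<^sup>2"
    unfolding eq using low by linarith
  then show ?thesis unfolding g_def[symmetric] g'_def[symmetric] s_def[symmetric] s'_def[symmetric] D_def[symmetric]
    by (simp add: algebra_simps)
qed

text \<open>
Points \<open>x\<close> with \<open>norm x < 1 - \<epsilon>\<close> have preimages with \<open>norm y ^ 2 \<le> 1 - e - m\<close>, and \<open>m\<close> is of order \<open>2 \<epsilon>\<close>.
The constant \<open>C\<close> bounds the bulge of bent chords relative to their squared length; it is of order
\<open>8 e / m ^ 3\<close>, that is \<open>e / \<epsilon> ^ 3\<close>. So \<open>e\<close> must be a small multiple of \<open>\<epsilon> ^ 3\<close>, and the factor \<open>1 / 3\<close> in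
\<open>e\<close> makes \<open>C\<close> about \<open>1 / 3\<close>.
\<close>

lemma bend_numerics:
  fixes \<epsilon> :: real
  assumes \<epsilon>: "0 < \<epsilon>" "\<epsilon> \<le> 1 / 4"
  defines "e \<equiv> \<epsilon> ^ 3 / 3" and "m \<equiv> 2 * \<epsilon> * (1 - \<epsilon>)"
  defines "C \<equiv> 2 * e * (4 * (1 - e - m) / m ^ 3 + 1 / m\<^sup>2)"
  shows "0 < e" "0 < m" "0 < 1 - e - m" "4 * e < m\<^sup>2"
    and "0 \<le> C" "C * (1 - \<epsilon>)\<^sup>2 \<le> 1 / 3 - \<epsilon> / 20" 
    and "1 - \<epsilon> / 9 \<le> 1 - 2 * e / m" "1 - 3 / 4 * \<epsilon> \<le> 1 - 8 * e * (1 - e - m) / m\<^sup>2"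
    and "(1 - \<epsilon>)\<^sup>2 * (m + 2 * e)\<^sup>2 \<le> (1 - e - m) * m\<^sup>2"
proof -
  have e: "0 < e" using \<epsilon> by (simp add: e_def)
  have p: "0 < 1 - \<epsilon>" "3 / 4 \<le> 1 - \<epsilon>" using \<epsilon> by auto
  have m: "0 < m" using \<epsilon> by (simp add: m_def)
  have e2: "\<epsilon>\<^sup>2 \<le> \<epsilon> / 4" unfolding power2_eq_square using \<epsilon> mult_left_mono[of \<epsilon> "1/4" \<epsilon>] by simp
  have e3: "\<epsilon> ^ 3 \<le> \<epsilon>\<^sup>2 / 4" unfolding power3_eq_cube power2_eq_square using \<epsilon> mult_left_mono[of \<epsilon> "1/4" "\<epsilon> * \<epsilon>"] by simp
  show "0 < e" "0 < m" by fact+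
  have w: "1 - e - m \<le> 1 - 2 * \<epsilon> + 2 * \<epsilon>\<^sup>2" using e unfolding m_def by (simp add: power2_eq_square algebra_simps)
  have w0: "0 < 1 - e - m"
  proof -
    have "e \<le> 1 / 48" unfolding e_def using e2 e3 \<epsilon> by linarith
    moreover have "m \<le> 2 * \<epsilon>" unfolding m_def using \<epsilon> by simp
    ultimately show ?thesis using \<epsilon> by linarith
  qed
  then show "0 < 1 - e - m" .
  have m2: "m\<^sup>2 = 4 * \<epsilon>\<^sup>2 * (1 - \<epsilon>)\<^sup>2" by (simp add: m_def power_mult_distrib)
  have p2: "9 / 16 \<le> (1 - \<epsilon>)\<^sup>2" using power_mono[OF p(2), of 2] by (simp add: power2_eq_square)
  show "4 * e < m\<^sup>2"
  proof -
    have "4 * e \<le> \<epsilon>\<^sup>2 / 3" unfolding e_def using e3 by simp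
    also have "\<dots> < 4 * \<epsilon>\<^sup>2 * (9 / 16)" using \<epsilon> by simp
    also have "\<dots> \<le> m\<^sup>2" unfolding m2 using p2 by (intro mult_left_mono) auto
    finally show ?thesis .
  qed
  show "0 \<le> C" unfolding C_def using e m w0 by simp
  have "C * (1 - \<epsilon>)\<^sup>2 = (1 - e - m) / (3 * (1 - \<epsilon>)) + \<epsilon> / 6"
  proof -
    have "2 * (x ^ 3 / 3) * (4 * Q / (2 * x * P) ^ 3 + 1 / (2 * x * P)\<^sup>2) * P\<^sup>2 = Q / (3 * P) + x / 6"
      if "0 < x" "0 < P" for x P Q :: real
      using that by (simp add: power3_eq_cube power2_eq_square field_simps)
    from this[OF \<epsilon>(1) p(1), of "1 - e - m"] show ?thesis unfolding C_def by (simp add: e_def m_def)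
  qed
  also have "\<dots> \<le> (1 - 2 * \<epsilon> + 2 * \<epsilon>\<^sup>2) / (3 * (1 - \<epsilon>)) + \<epsilon> / 6"
    using w p by (intro add_right_mono divide_right_mono) auto
  also have "\<dots> \<le> 1 / 3 - \<epsilon> / 20"
  proof -
    have "1 - 2 * \<epsilon> + 2 * \<epsilon>\<^sup>2 \<le> (1 / 3 - \<epsilon> / 20 - \<epsilon> / 6) * (3 * (1 - \<epsilon>))"
    proof -
      have "(1 / 3 - \<epsilon> / 20 - \<epsilon> / 6) * (3 * (1 - \<epsilon>)) = 1 - 33 / 20 * \<epsilon> + 13 / 20 * \<epsilon>\<^sup>2"
        by (simp add: field_simps power2_eq_square)
      then show ?thesis using e2 \<epsilon> by linarith
    qed
    then have "(1 - 2 * \<epsilon> + 2 * \<epsilon>\<^sup>2) / (3 * (1 - \<epsilon>)) \<le> 1 / 3 - \<epsilon> / 20 - \<epsilon> / 6"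
      using p by (subst pos_divide_le_eq) auto
    then show ?thesis by simp
  qed
  finally show "C * (1 - \<epsilon>)\<^sup>2 \<le> 1 / 3 - \<epsilon> / 20" .
  have "2 * e / m = \<epsilon>\<^sup>2 / (3 * (1 - \<epsilon>))"
    using \<epsilon> p by (simp add: e_def m_def power3_eq_cube power2_eq_square field_simps)
  also have "\<dots> \<le> \<epsilon> / 9"
  proof -
    have "\<epsilon>\<^sup>2 \<le> \<epsilon> / 9 * (3 * (1 - \<epsilon>))" using e2 by (simp add: power2_eq_square algebra_simps)
    then show ?thesis using p by (subst pos_divide_le_eq) auto
  qed
  finally show "1 - \<epsilon> / 9 \<le> 1 - 2 * e / m" by simp
  have "8 * e * (1 - e - m) / m\<^sup>2 = 2 / 3 * \<epsilon> * (1 - e - m) / (1 - \<epsilon>)\<^sup>2"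
  proof -
    have "8 * (x ^ 3 / 3) * Q / (4 * x\<^sup>2 * P\<^sup>2) = 2 / 3 * x * Q / P\<^sup>2" if "0 < x" "0 < P" for x P Q :: real
      using that by (simp add: power3_eq_cube power2_eq_square field_simps)
    from this[OF \<epsilon>(1) p(1), of "1 - e - m"] show ?thesis unfolding m2 by (simp add: e_def)
  qed
  also have "\<dots> \<le> 2 / 3 * \<epsilon> * (1 - 2 * \<epsilon> + 2 * \<epsilon>\<^sup>2) / (1 - \<epsilon>)\<^sup>2"
    using w \<epsilon> by (intro divide_right_mono mult_left_mono) auto
  also have "\<dots> \<le> 3 / 4 * \<epsilon>"
  proof -
    have "2 / 3 * (1 - 2 * \<epsilon> + 2 * \<epsilon>\<^sup>2) \<le> 3 / 4 * (1 - \<epsilon>)\<^sup>2"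
      unfolding power2_diff using e2 \<epsilon> by simp
    then have "\<epsilon> * (2 / 3 * (1 - 2 * \<epsilon> + 2 * \<epsilon>\<^sup>2)) \<le> \<epsilon> * (3 / 4 * (1 - \<epsilon>)\<^sup>2)"
      using \<epsilon> by (intro mult_left_mono) auto
    then show ?thesis using p by (subst pos_divide_le_eq) (auto simp: algebra_simps)
  qed
  finally show "1 - 3 / 4 * \<epsilon> \<le> 1 - 8 * e * (1 - e - m) / m\<^sup>2" by simp
  show "(1 - \<epsilon>)\<^sup>2 * (m + 2 * e)\<^sup>2 \<le> (1 - e - m) * m\<^sup>2"
  proof -
    have eq: "(1 - e - m) * m\<^sup>2 - (1 - \<epsilon>)\<^sup>2 * (m + 2 * e)\<^sup>2 = (1 - \<epsilon>)\<^sup>2 * \<epsilon> ^ 4 * (4 / 3 + 4 / 3 * \<epsilon> - 4 / 9 * \<epsilon>\<^sup>2)"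
      unfolding e_def m_def by (simp add: field_simps power2_eq_square power3_eq_cube power4_eq_xxxx)
    have "0 \<le> 4 / 3 + 4 / 3 * \<epsilon> - 4 / 9 * \<epsilon>\<^sup>2" using e2 \<epsilon> by simp
    then have "0 \<le> (1 - \<epsilon>)\<^sup>2 * \<epsilon> ^ 4 * (4 / 3 + 4 / 3 * \<epsilon> - 4 / 9 * \<epsilon>\<^sup>2)"
      by (intro mult_nonneg_nonneg) auto
    then show ?thesis using eq by linarith
  qed
qed

text \<open>
Write \<open>x\<close> for the intermediate point. Then \<open>bend e x = \<alpha> bend e y + \<beta> bend e z\<close> with \<open>\<alpha> + \<beta> = 1 + \<mu>\<close> for
some \<open>\<mu> \<ge> 0\<close>, so relative to the segment the point is pushed outwards by the factor \<open>1 + \<mu>\<close>. This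
push is at most of the order of the squared distance of the endpoints, just like the gain \<open>\<alpha> \<beta> (norm (bend e y - bend e z)) ^ 2\<close> from the uniform
convexity of the ball, and the constants are such that the gain wins.
\<close>

lemma bend_preimage_convex:
  fixes y z u :: "'a::real_inner"
  assumes \<epsilon>: "0 < \<epsilon>" "\<epsilon> \<le> 1 / 4" and e: "e = \<epsilon> ^ 3 / 3" and m: "m = 2 * \<epsilon> * (1 - \<epsilon>)"
    and y: "(norm y)\<^sup>2 \<le> 1 - e - m" and z: "(norm z)\<^sup>2 \<le> 1 - e - m"
    and r: "norm u + r \<le> 1 - \<epsilon>" and yB: "norm (bend e y - u) \<le> r" and zB: "norm (bend e z - u) \<le> r"
    and t: "0 \<le> t" "t \<le> 1"
  shows "norm (bend e ((1 - t) *\<^sub>R y + t *\<^sub>R z) - u) \<le> r"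
proof -
  note num = bend_numerics[OF \<epsilon>, folded e m]
  define C where "C = 2 * e * (4 * (1 - e - m) / m ^ 3 + 1 / m\<^sup>2)"
  define R where "R = 1 - \<epsilon>"
  define x where "x = (1 - t) *\<^sub>R y + t *\<^sub>R z"
  define d where "d = (norm (y - z))\<^sup>2"
  define T where "T = t * (1 - t)"
  have T: "0 \<le> T" "T \<le> 1 / 4" using t sum_squares_bound[of t "1 - t"] unfolding T_def
    by (auto simp: power2_eq_square algebra_simps) (metis (no_types) mult_nonneg_nonneg diff_ge_0_iff_ge mult.commute right_diff_distrib mult_1_right)
  have d0: "0 \<le> d" by (simp add: d_def)
  have r0: "0 \<le> r" using yB norm_ge_zero order_trans by blast
  have rR: "r \<le> R" "norm u + r \<le> R" "norm u \<le> R" "0 < R" "R \<le> 1"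
    using r r0 norm_ge_zero[of u] \<epsilon> unfolding R_def by linarith+
  have xs: "(norm x)\<^sup>2 = (1 - t) * (norm y)\<^sup>2 + t * (norm z)\<^sup>2 - T * d"
    unfolding x_def norm_sq_convex_comb by (simp add: T_def d_def)
  have xm: "(norm x)\<^sup>2 \<le> 1 - e - m"
    unfolding x_def using norm_sq_bound_convex[OF y z t] .
  define a b where "a = 1 - e - (norm y)\<^sup>2" and "b = 1 - e - (norm z)\<^sup>2"
  have ab: "m \<le> a" "m \<le> b" using y z by (auto simp: a_def b_def)
  have mx: "1 - e - (norm x)\<^sup>2 = (1 - t) * a + t * b + T * d"
    unfolding xs a_def b_def by (simp add: algebra_simps)
  define gy gz g where "gy = shrink e ((norm y)\<^sup>2)" and "gz = shrink e ((norm z)\<^sup>2)" and "g = shrink e ((norm x)\<^sup>2)"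
  note sy = shrink_bounds[OF num(1) y num(2), folded gy_def a_def]
  note sz = shrink_bounds[OF num(1) z num(2), folded gz_def b_def]
  note sx = shrink_bounds[OF num(1) xm num(2), folded g_def, unfolded mx]
  define \<alpha> \<beta> where "\<alpha> = (1 - t) * g / gy" and "\<beta> = t * g / gz"
  define \<mu> where "\<mu> = \<alpha> + \<beta> - 1"
  have \<alpha>\<beta>: "0 \<le> \<alpha>" "0 \<le> \<beta>" using t sy sz sx by (auto simp: \<alpha>_def \<beta>_def)
  \<comment> \<open>the bent chord bulges outwards by the relative amount \<open>\<mu>\<close>\<close>
  have \<mu>eq: "\<mu> = 2 * e * g * ((1 - t) / a + t / b - 1 / ((1 - t) * a + t * b + t * (1 - t) * d))"
  proof -
    have "\<mu> = g * ((1 - t) * (1 / gy) + t * (1 / gz) - 1 / g)"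
      unfolding \<mu>_def \<alpha>_def \<beta>_def using sx(1) by (simp add: algebra_simps)
    also have "\<dots> = g * ((1 - t) * (1 + 2 * e / a) + t * (1 + 2 * e / b) - (1 + 2 * e / ((1 - t) * a + t * b + T * d)))"
      by (simp only: sy(4) sz(4) sx(4))
    also have "\<dots> = 2 * e * g * ((1 - t) / a + t / b - 1 / ((1 - t) * a + t * b + t * (1 - t) * d))"
      unfolding T_def by (simp add: algebra_simps)
    finally show ?thesis .
  qed
  have \<mu>0: "0 \<le> \<mu>" unfolding \<mu>eq
    using inverse_chord_excess(1)[OF num(2) ab t d0] num(1) sx(1) by (intro mult_nonneg_nonneg) auto
  have abd: "(a - b)\<^sup>2 \<le> d * (4 * (1 - e - m))"
  proof -
    have "a - b = (z - y) \<bullet> (z + y)" unfolding a_def b_def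
      by (simp add: power2_norm_eq_inner inner_diff_left inner_diff_right inner_add_right inner_commute)
    then have "\<bar>a - b\<bar> \<le> norm (z - y) * norm (z + y)" using Cauchy_Schwarz_ineq2 by metis
    then have "(a - b)\<^sup>2 \<le> (norm (z - y) * norm (z + y))\<^sup>2" by (metis abs_ge_zero power2_abs power_mono)
    also have "\<dots> = d * (norm (z + y))\<^sup>2" by (simp add: d_def power_mult_distrib norm_minus_commute)
    also have "(norm (z + y))\<^sup>2 \<le> 2 * ((norm z)\<^sup>2 + (norm y)\<^sup>2)"
      using norm_sq_convex_comb[of 1 z 1 y] by simp
    also have "2 * ((norm z)\<^sup>2 + (norm y)\<^sup>2) \<le> 4 * (1 - e - m)" using y z by simp
    finally show ?thesis using d0 by (simp add: mult_left_mono)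
  qed
  have \<mu>C: "\<mu> \<le> T * g * C * d"
  proof -
    have "(1 - t) / a + t / b - 1 / ((1 - t) * a + t * b + t * (1 - t) * d) \<le> T * ((a - b)\<^sup>2 / m ^ 3 + d / m\<^sup>2)"
      unfolding T_def by (rule inverse_chord_excess(2)[OF num(2) ab t d0])
    also have "\<dots> \<le> T * (d * (4 * (1 - e - m)) / m ^ 3 + d / m\<^sup>2)"
      using abd num(2) T by (intro mult_left_mono add_right_mono divide_right_mono) auto
    finally have "\<mu> \<le> 2 * e * g * (T * (d * (4 * (1 - e - m)) / m ^ 3 + d / m\<^sup>2))"
      unfolding \<mu>eq using num(1) sx(1) by (intro mult_left_mono) auto
    also have "\<dots> = T * g * C * d" unfolding C_def by (simp add: algebra_simps)
    finally show ?thesis .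
  qed
  define X Y where "X = bend e y - u" and "Y = bend e z - u"
  define D where "D = (norm (X - Y))\<^sup>2"
  have XY: "norm X \<le> r" "norm Y \<le> r" using yB zB by (auto simp: X_def Y_def)
  define k where "k = 1 - 8 * e * (1 - e - m) / m\<^sup>2"
  have k: "1 - 3 / 4 * \<epsilon> \<le> k" unfolding k_def by (rule num(8))
  have Dge: "gy * gz * k * d \<le> D"
    using bend_distance_ge[OF num(1,2) y z] unfolding gy_def gz_def k_def d_def D_def X_def Y_def by simp
  have gl: "1 - \<epsilon> / 9 \<le> gy" "1 - \<epsilon> / 9 \<le> gz" "1 - \<epsilon> / 9 \<le> g"
    using num(7) sy(3) sz(3) sx(3) by auto
  have kp: "0 < k" using k \<epsilon> by simp
  \<comment> \<open>\<open>2153 / 2500\<close> and, below, \<open>2431 / 2500\<close> are the sums \<open>1 / 9 + 3 / 4\<close> and \<open>2 / 9 + 3 / 4\<close>, rounded up\<close>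
  have gk: "1 - 2153 / 2500 * \<epsilon> \<le> g * k"
  proof -
    have "1 - 2153 / 2500 * \<epsilon> \<le> (1 - \<epsilon> / 9) * (1 - 3 / 4 * \<epsilon>)" using \<epsilon> by (simp add: algebra_simps)
    also have "\<dots> \<le> g * k" using gl(3) k \<epsilon> sx(1) by (intro mult_mono) auto
    finally show ?thesis .
  qed
  \<comment> \<open>an upper bound for \<open>\<mu>\<close>; it has to lie in a narrow range, since the two estimates that use it are almost sharp at \<open>\<epsilon> = 1 / 4\<close>\<close>
  define q :: real where "q = 43 / 100"
  have CR: "C * R\<^sup>2 \<le> 1 / 3 - \<epsilon> / 20" unfolding C_def R_def by (rule num(6))
  have C0: "0 \<le> C" unfolding C_def by (rule num(5))
  have \<mu>R: "\<mu> * R \<le> q * r"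
  proof -
    have "norm (X - Y) \<le> 2 * r" using XY norm_triangle_ineq4[of X Y] by simp
    then have "D \<le> (2 * r)\<^sup>2" unfolding D_def by (intro power_mono) auto
    then have dr: "gy * gz * k * d \<le> 4 * r\<^sup>2" using Dge by simp
    have "(1 - 2431 / 2500 * \<epsilon>) * d \<le> 4 * r\<^sup>2"
    proof -
      have "1 - 2431 / 2500 * \<epsilon> \<le> (1 - \<epsilon> / 9) * ((1 - \<epsilon> / 9) * (1 - 3 / 4 * \<epsilon>))"
      proof -
        have eq: "(1 - \<epsilon> / 9) * ((1 - \<epsilon> / 9) * (1 - 3 / 4 * \<epsilon>)) = 1 - (2 / 9 + 3 / 4) * \<epsilon> + (1 / 81 + 1 / 6) * \<epsilon>\<^sup>2 - \<epsilon>\<^sup>2 * \<epsilon> / 108"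
          by (simp add: field_simps power2_eq_square)
        have "\<epsilon>\<^sup>2 * \<epsilon> \<le> \<epsilon>\<^sup>2 * (1 / 4)" using \<epsilon> by (intro mult_left_mono) auto
        moreover have "0 \<le> \<epsilon>\<^sup>2" by simp
        moreover have "1 - 2431 / 2500 * \<epsilon> \<le> 1 - (2 / 9 + 3 / 4) * \<epsilon> + (1 / 81 + 1 / 6) * a - b / 108"
          if "b \<le> a * (1 / 4)" "0 \<le> a" for a b
          using that \<epsilon> by (simp add: field_simps)
        ultimately show ?thesis unfolding eq by blast
      qed
      also have "\<dots> \<le> gy * (gz * k)" using gl k \<epsilon> sy(1) sz(1) kp by (intro mult_mono) auto
      finally have "(1 - 2431 / 2500 * \<epsilon>) * d \<le> gy * (gz * k) * d" using d0 by (rule mult_right_mono)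
      then show ?thesis using dr by (simp add: mult.assoc)
    qed
    then have d4: "(1 - 2431 / 2500 * \<epsilon>) * (d / 4) \<le> r * R" using mult_left_mono[OF rR(1) r0] by (simp add: power2_eq_square)
    have "\<mu> \<le> (d / 4) * C"
    proof -
      have "T * g * C * d \<le> (1 / 4) * 1 * C * d" using T sx C0 d0 by (intro mult_right_mono mult_mono) auto
      then show ?thesis using \<mu>C by (simp add: mult.commute)
    qed
    then have "(1 - 2431 / 2500 * \<epsilon>) * (\<mu> * R) \<le> (1 - 2431 / 2500 * \<epsilon>) * ((d / 4) * C * R)"
      using \<epsilon> rR by (intro mult_left_mono mult_right_mono) auto
    also have "\<dots> = ((1 - 2431 / 2500 * \<epsilon>) * (d / 4)) * (C * R)" by simp
    also have "\<dots> \<le> r * R * (C * R)" using d4 C0 rR by (intro mult_right_mono) auto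
    also have "\<dots> = r * (C * R\<^sup>2)" by (simp add: power2_eq_square)
    also have "\<dots> \<le> r * ((1 - 2431 / 2500 * \<epsilon>) * q)"
      using CR \<epsilon> r0 unfolding q_def by (intro mult_left_mono) (auto intro: order_trans)
    finally have "(1 - 2431 / 2500 * \<epsilon>) * (\<mu> * R) \<le> (1 - 2431 / 2500 * \<epsilon>) * (q * r)" by (simp add: mult_ac)
    then show ?thesis using \<epsilon> by simp
  qed
  have \<mu>q: "\<mu> \<le> q"
  proof -
    have "q * r \<le> q * R" using rR(1) by (intro mult_left_mono) (auto simp: q_def)
    then have "\<mu> * R \<le> q * R" using \<mu>R by linarith
    then show ?thesis using rR(4) by (rule mult_right_le_imp_le)
  qed
  have \<mu>u: "\<mu> * norm u \<le> r"
  proof -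
    have "\<mu> * norm u \<le> \<mu> * R" using \<mu>0 rR by (intro mult_left_mono) auto
    also have "\<dots> \<le> q * r" by (rule \<mu>R)
    also have "\<dots> \<le> r" using r0 by (simp add: q_def)
    finally show ?thesis .
  qed
  \<comment> \<open>strict convexity of the ball absorbs the bulge\<close>
  have key: "2 * \<mu> * r * R + \<mu>\<^sup>2 * r * R \<le> \<alpha> * \<beta> * D"
  proof -
    have "2 * \<mu> * r * R + \<mu>\<^sup>2 * r * R = \<mu> * (r * R * (2 + \<mu>))" by (simp add: power2_eq_square algebra_simps)
    also have "\<dots> \<le> T * g * C * d * (R * R * (2 + q))"
      using \<mu>C \<mu>0 \<mu>q rR r0 by (intro mult_mono) (auto intro!: mult_nonneg_nonneg)
    also have "\<dots> = T * g * d * ((C * R\<^sup>2) * (2 + q))" by (simp add: power2_eq_square)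
    also have "\<dots> \<le> T * g * d * (g * k)"
    proof (rule mult_left_mono)
      have "(C * R\<^sup>2) * (2 + q) \<le> (1 / 3 - \<epsilon> / 20) * (2 + q)" using CR by (intro mult_right_mono) (auto simp: q_def)
      also have "\<dots> \<le> 1 - 2153 / 2500 * \<epsilon>" using \<epsilon> by (simp add: q_def field_simps)
      also have "\<dots> \<le> g * k" by (rule gk)
      finally show "(C * R\<^sup>2) * (2 + q) \<le> g * k" .
      show "0 \<le> T * g * d" using T sx(1) d0 by simp
    qed
    also have "\<dots> = (\<alpha> * \<beta>) * (gy * gz * k * d)"
      unfolding \<alpha>_def \<beta>_def T_def using sy(1) sz(1) by (simp add: field_simps)
    also have "\<dots> \<le> \<alpha> * \<beta> * D" using Dge \<alpha>\<beta> by (intro mult_left_mono) auto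
    finally show ?thesis .
  qed
  have xeq: "bend e x - u = (\<alpha> *\<^sub>R X + \<beta> *\<^sub>R Y) + \<mu> *\<^sub>R u"
  proof -
    have "\<alpha> *\<^sub>R bend e y = ((1 - t) * g) *\<^sub>R y" "\<beta> *\<^sub>R bend e z = (t * g) *\<^sub>R z"
      using sy(1) sz(1) by (simp_all add: bend_def \<alpha>_def \<beta>_def gy_def[symmetric] gz_def[symmetric])
    moreover have "bend e x = ((1 - t) * g) *\<^sub>R y + (t * g) *\<^sub>R z"
    proof -
      have "bend e x = g *\<^sub>R x" by (simp add: bend_def g_def)
      then show ?thesis unfolding x_def by (simp add: scaleR_add_right mult.commute)
    qed
    ultimately have "bend e x = \<alpha> *\<^sub>R bend e y + \<beta> *\<^sub>R bend e z" by simp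
    then show ?thesis by (simp add: X_def Y_def \<mu>_def algebra_simps)
  qed
  define A where "A = norm (\<alpha> *\<^sub>R X + \<beta> *\<^sub>R Y)"
  have "A\<^sup>2 \<le> (r - \<mu> * norm u)\<^sup>2"
  proof -
    have "A\<^sup>2 = (\<alpha> + \<beta>) * (\<alpha> * (norm X)\<^sup>2 + \<beta> * (norm Y)\<^sup>2) - \<alpha> * \<beta> * D"
      unfolding A_def D_def by (rule norm_sq_convex_comb)
    also have "\<dots> \<le> (\<alpha> + \<beta>) * (\<alpha> * r\<^sup>2 + \<beta> * r\<^sup>2) - \<alpha> * \<beta> * D"
      using \<alpha>\<beta> XY by (intro diff_right_mono mult_left_mono add_mono power_mono) auto
    also have "\<dots> = (1 + \<mu>)\<^sup>2 * r\<^sup>2 - \<alpha> * \<beta> * D" by (simp add: \<mu>_def power2_eq_square algebra_simps)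
    also have "\<dots> \<le> (1 + \<mu>)\<^sup>2 * r\<^sup>2 - (2 * \<mu> * r * R + \<mu>\<^sup>2 * r * R)" using key by simp
    also have "\<dots> \<le> (r - \<mu> * norm u)\<^sup>2"
    proof -
      have "2 * \<mu> * r * (norm u + r) \<le> 2 * \<mu> * r * R" using rR \<mu>0 r0 by (intro mult_left_mono) auto
      moreover have "\<mu>\<^sup>2 * r * r \<le> \<mu>\<^sup>2 * r * R" using rR r0 by (intro mult_left_mono) auto
      moreover have "(1 + \<mu>)\<^sup>2 * r\<^sup>2 = r\<^sup>2 + 2 * \<mu> * r * r + \<mu>\<^sup>2 * r * r" by (simp add: power2_eq_square algebra_simps)
      moreover have "(r - \<mu> * norm u)\<^sup>2 = r\<^sup>2 - 2 * \<mu> * r * norm u + (\<mu> * norm u)\<^sup>2" by (simp add: power2_eq_square algebra_simps)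
      moreover have "0 \<le> (\<mu> * norm u)\<^sup>2" by simp
      moreover have "2 * \<mu> * r * (norm u + r) = 2 * \<mu> * r * norm u + 2 * \<mu> * r * r" by (simp add: distrib_left)
      ultimately show ?thesis by linarith
    qed
    finally show ?thesis .
  qed
  then have "A \<le> r - \<mu> * norm u" by (rule power2_le_imp_le) (use \<mu>u in simp)
  then show ?thesis
    unfolding x_def[symmetric] xeq using norm_triangle_ineq[of "\<alpha> *\<^sub>R X + \<beta> *\<^sub>R Y" "\<mu> *\<^sub>R u"] \<mu>0
    by (simp add: A_def)
qed

section \<open>The Jacobian of the bending map\<close>

text \<open>
The derivative of \<open>\<rho> * shrink e (\<rho> ^ 2)\<close> with respect to \<open>\<rho>\<close>, at \<open>\<rho> ^ 2 = s\<close>.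
\<close>

definition radial_stretch :: "real \<Rightarrow> real \<Rightarrow> real" where
  "radial_stretch e s = 1 - 2 * e * (1 + e + s) / (1 + e - s)\<^sup>2"

text \<open>
The Jacobian determinant of \<open>bend e\<close> in dimension \<open>n\<close>: one radial direction, \<open>n - 1\<close> tangential ones.
\<close>

definition bend_density :: "nat \<Rightarrow> real \<Rightarrow> 'a::real_inner \<Rightarrow> real" where
  "bend_density n e y = shrink e ((norm y)\<^sup>2) ^ (n - 1) * radial_stretch e ((norm y)\<^sup>2)"

lemma radial_stretch_bounds:
  assumes e: "0 < e" and m: "0 < m" "4 * e < m\<^sup>2" and s: "0 \<le> s" "s \<le> 1 - e - m"
  shows "1 - 4 * e / m\<^sup>2 \<le> radial_stretch e s" "radial_stretch e s \<le> 1" "0 < radial_stretch e s"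
proof -
  have n: "m \<le> 1 + e - s" "1 + e + s \<le> 2" using s m e by auto
  have "m\<^sup>2 \<le> (1 + e - s)\<^sup>2" using n m by (intro power_mono) auto
  then have "2 * e * (1 + e + s) / (1 + e - s)\<^sup>2 \<le> 2 * e * 2 / m\<^sup>2"
    using n m e s by (intro frac_le mult_left_mono) auto
  then show *: "1 - 4 * e / m\<^sup>2 \<le> radial_stretch e s" by (simp add: radial_stretch_def)
  show "radial_stretch e s \<le> 1" using e s by (simp add: radial_stretch_def)
  have "4 * e / m\<^sup>2 < 1" using m by simp
  then show "0 < radial_stretch e s" using * by linarith
qed

text \<open>
Concave and decreasing functions of a convex function are concave.
\<close>

lemma concave_in_norm_sq:
  fixes y z :: "'a::real_inner"
  assumes conc: "concave_on {0..<b} \<phi>" and anti: "\<And>s s'. 0 \<le> s \<Longrightarrow> s \<le> s' \<Longrightarrow> s' < b \<Longrightarrow> \<phi> s' \<le> \<phi> s"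
    and y: "(norm y)\<^sup>2 < b" and z: "(norm z)\<^sup>2 < b" and t: "0 \<le> t" "t \<le> 1"
  shows "(1 - t) * \<phi> ((norm y)\<^sup>2) + t * \<phi> ((norm z)\<^sup>2) \<le> \<phi> ((norm ((1 - t) *\<^sub>R y + t *\<^sub>R z))\<^sup>2)"
proof -
  have b: "(1 - t) * (norm y)\<^sup>2 + t * (norm z)\<^sup>2 < b"
    using convex_bound_lt[OF y z] t by auto
  have "(1 - t) * \<phi> ((norm y)\<^sup>2) + t * \<phi> ((norm z)\<^sup>2) \<le> \<phi> ((1 - t) * (norm y)\<^sup>2 + t * (norm z)\<^sup>2)"
    using conc y z t by (auto simp: concave_on_iff)
  also have "\<dots> \<le> \<phi> ((norm ((1 - t) *\<^sub>R y + t *\<^sub>R z))\<^sup>2)"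
    by (rule anti[OF zero_le_power2 _ b]) (use t in \<open>simp add: norm_sq_convex_comb\<close>)
  finally show ?thesis .
qed

lemma convex_on_constant: "convex_on {0..<b::real} (\<lambda>_. c::real)"
  by (auto simp: convex_on_def distrib_right[symmetric] convex_real_interval)

lemma convex_on_eq:
  fixes f g :: "real \<Rightarrow> real"
  assumes "convex_on S f" "\<And>s. s \<in> S \<Longrightarrow> g s = f s"
  shows "convex_on S g"
proof -
  have "u * x + v * y \<in> S" if "x \<in> S" "y \<in> S" "0 \<le> u" "0 \<le> v" "u + v = 1" for x y u v
    using assms(1) that unfolding convex_on_def convex_def by simp
  then show ?thesis using assms unfolding convex_on_def by simp
qed

lemma convex_on_pole: "convex_on {0..<A} (\<lambda>s::real. 1 / (A - s))"
proof (rule convex_onI)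
  fix t x y :: real assume t: "0 < t" "t < 1" and xy: "x \<in> {0..<A}" "y \<in> {0..<A}"
  have "0 \<le> (1 - t) / (A - x) + t / (A - y) - 1 / ((1 - t) * (A - x) + t * (A - y) + t * (1 - t) * 0)"
    by (rule inverse_chord_excess(1)[of "min (A - x) (A - y)"]) (use t xy in auto)
  moreover have "(1 - t) * (A - x) + t * (A - y) + t * (1 - t) * 0 = A - ((1 - t) *\<^sub>R x + t *\<^sub>R y)"
    by (simp add: algebra_simps)
  ultimately show "1 / (A - ((1 - t) *\<^sub>R x + t *\<^sub>R y)) \<le> (1 - t) * (1 / (A - x)) + t * (1 / (A - y))"
    by simp
qed simp

lemma mono_on_pole: "mono_on {0..<A} (\<lambda>s::real. 1 / (A - s))"
  by (rule mono_onI) (auto intro!: divide_left_mono)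

lemma shrink_concave:
  assumes e: "0 < e"
  shows "concave_on {0..<1 + e} (shrink e)" "0 \<le> s \<Longrightarrow> s \<le> s' \<Longrightarrow> s' < 1 + e \<Longrightarrow> shrink e s' \<le> shrink e s"
proof -
  have eq: "- shrink e s = 2 * e * (1 / (1 + e - s)) + (- 1)" if "s < 1 + e" for s
    using that by (simp add: shrink_def field_simps)
  have "convex_on {0..<1 + e} (\<lambda>s. 2 * e * (1 / (1 + e - s)) + (- 1))"
    using e by (intro convex_on_add convex_on_cmul convex_on_pole convex_on_constant) auto
  then have "convex_on {0..<1 + e} (\<lambda>s. - shrink e s)"
    by (rule convex_on_eq) (use eq in auto)
  then show "concave_on {0..<1 + e} (shrink e)" by (simp add: concave_on_def)
  show "shrink e s' \<le> shrink e s" if "0 \<le> s" "s \<le> s'" "s' < 1 + e"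
  proof -
    have "1 / (1 + e - s) \<le> 1 / (1 + e - s')" using that by (intro divide_left_mono) auto
    then have "2 * e * (1 / (1 + e - s)) \<le> 2 * e * (1 / (1 + e - s'))" using e by (intro mult_left_mono) auto
    then show ?thesis using eq[of s] eq[of s'] that by simp
  qed
qed

lemma radial_stretch_concave:
  assumes e: "0 < e"
  shows "concave_on {0..<1 + e} (radial_stretch e)"
    "0 \<le> s \<Longrightarrow> s \<le> s' \<Longrightarrow> s' < 1 + e \<Longrightarrow> radial_stretch e s' \<le> radial_stretch e s"
proof -
  let ?p = "\<lambda>s. 1 / (1 + e - s)"
  let ?q = "\<lambda>s. 2 * (1 + e) * ?p s + (- 1)"
  have eq: "- radial_stretch e s = 2 * e * (?p s * ?q s) + (- 1)" if "s < 1 + e" for s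
  proof -
    define n where "n = 1 + e - s"
    have n: "0 < n" "s = 1 + e - n" using that by (auto simp: n_def)
    show ?thesis unfolding radial_stretch_def n(2) using n(1) by (simp add: field_simps power2_eq_square)
  qed
  have q: "convex_on {0..<1 + e} ?q" using e by (intro convex_on_add convex_on_cmul convex_on_pole convex_on_constant) auto
  have qm: "mono_on {0..<1 + e} ?q"
  proof (rule mono_onI)
    fix r s assume rs: "r \<in> {0..<1 + e}" "s \<in> {0..<1 + e}" "r \<le> s"
    then have "?p r \<le> ?p s" by (rule mono_onD[OF mono_on_pole])
    then have "2 * (1 + e) * ?p r \<le> 2 * (1 + e) * ?p s" using e by (intro mult_left_mono) auto
    then show "?q r \<le> ?q s" by simp
  qed
  have q0: "0 \<le> ?q s" "0 \<le> ?p s" if "s \<in> {0..<1 + e}" for s using that e by (auto simp: field_simps)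
  have "convex_on {0..<1 + e} (\<lambda>s. ?p s * ?q s)"
    by (rule convex_on_mul[OF convex_on_pole q mono_on_pole qm]) (use q0 in auto)
  then have "convex_on {0..<1 + e} (\<lambda>s. 2 * e * (?p s * ?q s) + (- 1))"
    using e by (intro convex_on_add convex_on_cmul convex_on_constant) auto
  then have "convex_on {0..<1 + e} (\<lambda>s. - radial_stretch e s)"
    by (rule convex_on_eq) (use eq in auto)
  then show "concave_on {0..<1 + e} (radial_stretch e)" by (simp add: concave_on_def)
  show "radial_stretch e s' \<le> radial_stretch e s" if "0 \<le> s" "s \<le> s'" "s' < 1 + e"
  proof -
    have "?p s \<le> ?p s'" "?q s \<le> ?q s'" using that mono_onD[OF mono_on_pole[of "1 + e"], of s s'] mono_onD[OF qm, of s s'] by auto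
    then have "?p s * ?q s \<le> ?p s' * ?q s'" using q0(1)[of s] q0(2)[of s'] that by (intro mult_mono) auto
    then have "2 * e * (?p s * ?q s) \<le> 2 * e * (?p s' * ?q s')" using e by (intro mult_left_mono) auto
    then show ?thesis using eq[of s] eq[of s'] that by linarith
  qed
qed

lemma bend_density_log_concave:
  fixes y z :: "'a::real_inner"
  assumes e: "0 < e" and m: "0 < m" "4 * e < m\<^sup>2"
    and y: "(norm y)\<^sup>2 \<le> 1 - e - m" and z: "(norm z)\<^sup>2 \<le> 1 - e - m" and t: "0 \<le> t" "t \<le> 1"
  shows "(1 - t) * ln (bend_density n e y) + t * ln (bend_density n e z)
      \<le> ln (bend_density n e ((1 - t) *\<^sub>R y + t *\<^sub>R z))"
proof -
  let ?x = "(1 - t) *\<^sub>R y + t *\<^sub>R z"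
  have x: "(norm ?x)\<^sup>2 \<le> 1 - e - m"
    using norm_sq_bound_convex[OF y z t] .
  have lt: "(norm y)\<^sup>2 < 1 + e" "(norm z)\<^sup>2 < 1 + e" using y z e m by auto
  let ?g = "\<lambda>y::'a. shrink e ((norm y)\<^sup>2)" and ?h = "\<lambda>y::'a. radial_stretch e ((norm y)\<^sup>2)"
  have gp: "0 < ?g v" and hp: "0 < ?h v" if "(norm v)\<^sup>2 \<le> 1 - e - m" for v
    using shrink_bounds(1)[OF e that m(1)] radial_stretch_bounds(3)[OF e m _ that] by auto
  have ln1: "(1 - t) * ln a + t * ln b \<le> ln c" if "0 < a" "0 < b" "(1 - t) * a + t * b \<le> c" for a b c :: real
  proof -
    have "(1 - t) * ln a + t * ln b \<le> ln ((1 - t) * a + t * b)"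
      using ln_concave that t by (auto simp: concave_on_iff)
    also have "\<dots> \<le> ln c"
    proof (rule ln_mono)
      show "0 < (1 - t) * a + t * b"
        using that t by (cases "t = 1") (auto intro!: add_pos_nonneg mult_pos_pos)
    qed (use that in auto)
    finally show ?thesis .
  qed
  have G: "(1 - t) * ln (?g y) + t * ln (?g z) \<le> ln (?g ?x)"
    by (intro ln1 gp y z concave_in_norm_sq[OF shrink_concave[OF e] lt t])
  have H: "(1 - t) * ln (?h y) + t * ln (?h z) \<le> ln (?h ?x)"
    by (intro ln1 hp y z concave_in_norm_sq[OF radial_stretch_concave[OF e] lt t])
  have w: "ln (bend_density n e v) = real (n - 1) * ln (?g v) + ln (?h v)" if "(norm v)\<^sup>2 \<le> 1 - e - m" for v
    unfolding bend_density_def using gp[OF that] hp[OF that] by (simp add: ln_mult ln_realpow)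
  have "real (n - 1) * ((1 - t) * ln (?g y) + t * ln (?g z)) \<le> real (n - 1) * ln (?g ?x)"
    using G by (intro mult_left_mono) auto
  then show ?thesis unfolding w[OF y] w[OF z] w[OF x] using H by (simp add: algebra_simps)
qed

lemma bend_density_bounds:
  fixes y :: "'a::real_inner"
  assumes e: "0 < e" and m: "0 < m" "4 * e < m\<^sup>2" and y: "(norm y)\<^sup>2 \<le> 1 - e - m"
  shows "shrink e (1 - e - m) ^ (n - 1) * radial_stretch e (1 - e - m) \<le> bend_density n e y"
    "0 < shrink e (1 - e - m) ^ (n - 1) * radial_stretch e (1 - e - m)"
    "bend_density n e y \<le> 1" "0 < bend_density n e y"
proof -
  have s: "0 \<le> (norm y)\<^sup>2" "(norm y)\<^sup>2 < 1 + e" "0 \<le> 1 - e - m" "1 - e - m < 1 + e"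
    using y e m order_trans[OF zero_le_power2 y] by auto
  have 1: "0 < shrink e (1 - e - m)" "0 < radial_stretch e (1 - e - m)"
    using shrink_bounds(1)[OF e order_refl m(1)] radial_stretch_bounds(3)[OF e m s(3) order_refl] by auto
  have 2: "shrink e (1 - e - m) \<le> shrink e ((norm y)\<^sup>2)" "radial_stretch e (1 - e - m) \<le> radial_stretch e ((norm y)\<^sup>2)"
    by (intro shrink_concave(2) radial_stretch_concave(2) e s y)+
  have 3: "shrink e ((norm y)\<^sup>2) \<le> 1" "radial_stretch e ((norm y)\<^sup>2) \<le> 1"
    using shrink_bounds(2)[OF e y m(1)] radial_stretch_bounds(2)[OF e m s(1) y] by auto
  show low: "shrink e (1 - e - m) ^ (n - 1) * radial_stretch e (1 - e - m) \<le> bend_density n e y"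
    unfolding bend_density_def using 1 2 by (intro mult_mono power_mono) auto
  show pos: "0 < shrink e (1 - e - m) ^ (n - 1) * radial_stretch e (1 - e - m)" using 1 by simp
  then show "0 < bend_density n e y" using low by linarith
  show "bend_density n e y \<le> 1"
    unfolding bend_density_def using 1 2 3 by (intro mult_le_one power_le_one) auto
qed


text \<open>
\<open>bend e\<close> preserves rays, so only the monotonicity and the range of the radial function
\<open>\<phi> \<rho> = \<rho> * shrink e (\<rho> ^ 2)\<close> matter.
\<close>

lemma bend_inj_surj:
  assumes \<epsilon>: "0 < \<epsilon>" "\<epsilon> \<le> 1 / 4" and e: "e = \<epsilon> ^ 3 / 3" and m: "m = 2 * \<epsilon> * (1 - \<epsilon>)"
  shows "inj_on (bend e :: 'a::real_inner \<Rightarrow> 'a) {y. (norm y)\<^sup>2 < 1 - e - m}"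
    and "norm (x::'a) < 1 - \<epsilon> \<Longrightarrow> \<exists>y. (norm y)\<^sup>2 < 1 - e - m \<and> bend e y = x"
proof -
  note num = bend_numerics[OF \<epsilon>, folded e m]
  define \<phi> where "\<phi> \<rho> = \<rho> * shrink e (\<rho>\<^sup>2)" for \<rho>
  have \<phi>eq: "\<phi> \<rho> = \<rho> - 2 * e * (\<rho> / (1 + e - \<rho>\<^sup>2))" if "\<rho>\<^sup>2 < 1 - e - m" for \<rho>
  proof -
    have "shrink e (\<rho>\<^sup>2) = 1 - 2 * e / (1 + e - \<rho>\<^sup>2)"
      using that num(1,2) unfolding shrink_def by (simp add: field_simps)
    then show ?thesis by (simp add: \<phi>_def right_diff_distrib)
  qed
  have mono: "\<phi> \<rho> < \<phi> \<rho>'" if r: "0 \<le> \<rho>" "\<rho> < \<rho>'" "\<rho>'\<^sup>2 < 1 - e - m" for \<rho> \<rho>'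
  proof -
    have r2: "\<rho>\<^sup>2 < 1 - e - m" using r power_strict_mono[of \<rho> \<rho>' 2] by simp
    define n n' where "n = 1 + e - \<rho>\<^sup>2" and "n' = 1 + e - \<rho>'\<^sup>2"
    have n: "m < n" "m < n'" "0 < n" "0 < n'" using r r2 num(1,2) by (auto simp: n_def n'_def)
    have "\<rho>' / n' - \<rho> / n = (\<rho>' - \<rho>) * ((1 + e + \<rho> * \<rho>') / (n * n'))"
    proof -
      have "\<rho>' * n - \<rho> * n' = (\<rho>' - \<rho>) * (1 + e + \<rho> * \<rho>')"
        by (simp add: n_def n'_def power2_eq_square algebra_simps)
      then show ?thesis using n by (simp add: diff_frac_eq mult.commute)
    qed
    also have "\<dots> < (\<rho>' - \<rho>) * (1 / (2 * e))"
    proof (rule mult_strict_left_mono)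
      have "\<rho> * \<rho>' \<le> \<rho>'\<^sup>2" unfolding power2_eq_square using r by (intro mult_right_mono) auto
      then have "1 + e + \<rho> * \<rho>' < 2" using r(3) num(1,2) by linarith
      then have "(1 + e + \<rho> * \<rho>') * (2 * e) < 4 * e" using num(1) by simp
      also have "\<dots> < m * m" using num(4) by (simp add: power2_eq_square)
      also have "\<dots> \<le> n * n'" using n num(2) by (intro mult_mono) auto
      finally show "(1 + e + \<rho> * \<rho>') / (n * n') < 1 / (2 * e)" using n num(1) by (simp add: field_simps)
    qed (use r in simp)
    finally have "2 * e * (\<rho>' / n' - \<rho> / n) < \<rho>' - \<rho>" using num(1) by (simp add: field_simps)
    then show ?thesis unfolding \<phi>eq[OF r2] \<phi>eq[OF r(3)] n_def n'_def by (simp add: right_diff_distrib)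
  qed
  have nb: "norm (bend e y) = \<phi> (norm y)" and gp: "0 < shrink e ((norm y)\<^sup>2)" if "(norm y)\<^sup>2 < 1 - e - m" for y :: 'a
  proof -
    show "0 < shrink e ((norm y)\<^sup>2)" using shrink_bounds(1)[OF num(1) less_imp_le[OF that] num(2)] .
    then show "norm (bend e y) = \<phi> (norm y)" by (simp add: bend_def \<phi>_def)
  qed
  show "inj_on (bend e :: 'a \<Rightarrow> 'a) {y. (norm y)\<^sup>2 < 1 - e - m}"
  proof (rule inj_onI)
    fix y z :: 'a assume yz: "y \<in> {y. (norm y)\<^sup>2 < 1 - e - m}" "z \<in> {y. (norm y)\<^sup>2 < 1 - e - m}" "bend e y = bend e z"
    then have "\<phi> (norm y) = \<phi> (norm z)" using nb[of y] nb[of z] by simp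
    then have n: "norm y = norm z"
      using mono[of "norm y" "norm z"] mono[of "norm z" "norm y"] yz by (cases "norm y" "norm z" rule: linorder_cases) auto
    then show "y = z" using yz(3) gp[of z] yz(2) by (simp add: bend_def)
  qed
  show "\<exists>y. (norm y)\<^sup>2 < 1 - e - m \<and> bend e y = x" if x: "norm (x::'a) < 1 - \<epsilon>" for x
  proof (cases "x = 0")
    case True
    then show ?thesis using num(3) by (intro exI[of _ 0]) (auto simp: bend_def)
  next
    case False
    define b where "b = sqrt (1 - e - m)"
    have b: "b\<^sup>2 = 1 - e - m" "0 \<le> b" using num(3) by (auto simp: b_def)
    have sb: "shrink e (b\<^sup>2) = m / (m + 2 * e)" unfolding b by (simp add: shrink_def algebra_simps)
    have "((1 - \<epsilon>) * (m + 2 * e))\<^sup>2 \<le> (b * m)\<^sup>2" using num(9) by (simp add: power_mult_distrib b)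
    then have "(1 - \<epsilon>) * (m + 2 * e) \<le> b * m" by (rule power2_le_imp_le) (use b num(2) in auto)
    then have endb: "1 - \<epsilon> \<le> \<phi> b" unfolding \<phi>_def sb using num(1,2) by (simp add: field_simps)
    have cont: "continuous_on {0..b} \<phi>"
      unfolding \<phi>_def shrink_def
    proof (intro continuous_intros ballI)
      fix r assume "r \<in> {0..b}"
      then have "r\<^sup>2 \<le> b\<^sup>2" by (intro power_mono) auto
      then show "1 + e - r\<^sup>2 \<noteq> 0" using b num(1,2) by auto
    qed
    obtain \<rho> where \<rho>: "0 \<le> \<rho>" "\<rho> \<le> b" "\<phi> \<rho> = norm x"
      using IVT'[of \<phi> 0 "norm x" b] endb x cont b by (auto simp: \<phi>_def)
    have "\<rho> \<noteq> b" using \<rho> endb x by auto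
    then have \<rho>2: "\<rho>\<^sup>2 < 1 - e - m" using \<rho> b power_strict_mono[of \<rho> b 2] by auto
    let ?y = "(\<rho> / norm x) *\<^sub>R x"
    have ny: "norm ?y = \<rho>" using False \<rho> by simp
    have "bend e ?y = (shrink e (\<rho>\<^sup>2) * \<rho> / norm x) *\<^sub>R x" unfolding bend_def ny by simp
    also have "shrink e (\<rho>\<^sup>2) * \<rho> = norm x" using \<rho>(3) by (simp add: \<phi>_def mult.commute)
    finally show ?thesis using \<rho>2 ny False by (intro exI[of _ ?y]) auto
  qed
qed

section \<open>Change of variables\<close>

text \<open>
A rotation takes \<open>y\<close> to a multiple of a coordinate vector, and then the matrix is diagonal.
\<close>

lemma det_scale_plus_rank_one:
  fixes y :: "real ^ 'n"
  shows "det (matrix (\<lambda>v. a *\<^sub>R v + (c * (y \<bullet> v)) *\<^sub>R y)) = a ^ (CARD('n) - 1) * (a + c * (norm y)\<^sup>2)"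
proof -
  obtain k :: 'n where True by simp
  define u where "u = norm y *\<^sub>R axis k (1::real)"
  have "norm u = norm y" by (simp add: u_def)
  then obtain Q where Q: "orthogonal_transformation Q" "Q u = y"
    using orthogonal_transformation_exists[of u y] by blast
  have Ql: "linear Q" and Qi: "\<And>v w. Q v \<bullet> Q w = v \<bullet> w"
    using Q(1) by (auto simp: orthogonal_transformation_def)
  let ?L = "\<lambda>v. a *\<^sub>R v + (c * (y \<bullet> v)) *\<^sub>R y" and ?M = "\<lambda>v. a *\<^sub>R v + (c * (u \<bullet> v)) *\<^sub>R u"
  have Ll: "linear ?L" and Ml: "linear ?M"
    by (auto intro!: linearI simp: inner_add_right algebra_simps)
  have "?L \<circ> Q = Q \<circ> ?M"
  proof
    fix v
    have "y \<bullet> Q v = u \<bullet> v" using Qi[of u v] unfolding Q(2) .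
    then show "(?L \<circ> Q) v = (Q \<circ> ?M) v"
      by (simp only: comp_apply linear_add[OF Ql] linear_scale[OF Ql] Q(2))
  qed
  then have "matrix ?L ** matrix Q = matrix Q ** matrix ?M"
    using matrix_compose[OF Ql Ll] matrix_compose[OF Ml Ql] by (simp only:)
  then have "det (matrix ?L ** matrix Q) = det (matrix Q ** matrix ?M)" by (simp only:)
  then have "det (matrix ?L) * det (matrix Q) = det (matrix Q) * det (matrix ?M)"
    by (simp only: det_mul)
  moreover have "det (matrix Q) \<noteq> 0"
    using orthogonal_transformation_det[OF Q(1)] by auto
  ultimately have 1: "det (matrix ?L) = det (matrix ?M)" by (simp add: mult.commute)
  have uu: "u $ i = (if i = k then norm y else 0)" for i by (simp add: u_def axis_def)
  have ax: "u \<bullet> axis j 1 = u $ j" for j by (simp add: inner_axis)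
  have ent: "matrix ?M $ i $ j = (if i = j then (if i = k then a + c * (norm y)\<^sup>2 else a) else 0)" for i j
    unfolding matrix_def by (simp add: ax uu) (auto simp: axis_def power2_eq_square)
  have "det (matrix ?M) = (\<Prod>i\<in>UNIV. matrix ?M $ i $ i)"
    by (rule det_diagonal) (simp add: ent)
  also have "\<dots> = (\<Prod>i\<in>UNIV. if i = k then a + c * (norm y)\<^sup>2 else a)" by (simp add: ent)
  also have "\<dots> = (a + c * (norm y)\<^sup>2) * (\<Prod>i\<in>UNIV - {k}. if i = k then a + c * (norm y)\<^sup>2 else a)"
    by (subst prod.remove[of _ k]) auto
  also have "(\<Prod>i\<in>UNIV - {k}. if i = k then a + c * (norm y)\<^sup>2 else a) = (\<Prod>i\<in>UNIV - {k}. a)"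
    by (rule prod.cong) auto
  also have "\<dots> = a ^ (CARD('n) - 1)" by simp
  finally show ?thesis using 1 by (simp add: mult.commute)
qed

lemma bend_has_derivative:
  fixes y :: "'a::real_inner"
  assumes y: "(norm y)\<^sup>2 < 1 + e"
  shows "(bend e has_derivative
    (\<lambda>v. shrink e ((norm y)\<^sup>2) *\<^sub>R v + (- 4 * e / (1 + e - (norm y)\<^sup>2)\<^sup>2 * (y \<bullet> v)) *\<^sub>R y)) (at y within S)"
proof -
  let ?s = "(norm y)\<^sup>2"
  have n: "1 + e - ?s \<noteq> 0" using y by simp
  have "((\<lambda>s. (1 - e - s) / (1 + e - s)) has_real_derivative - 2 * e / (1 + e - ?s)\<^sup>2) (at ?s)"
    using n by (auto intro!: derivative_eq_intros simp: power2_eq_square diff_divide_distrib[symmetric])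
  then have 1: "(shrink e has_derivative (\<lambda>h. - 2 * e / (1 + e - ?s)\<^sup>2 * h)) (at ?s)"
    unfolding has_field_derivative_def shrink_def .
  have 2: "((\<lambda>y::'a. (norm y)\<^sup>2) has_derivative (\<lambda>v. 2 * (y \<bullet> v))) (at y within S)"
    unfolding power2_norm_eq_inner
    by (auto intro!: derivative_eq_intros simp: inner_commute)
  have 3: "((\<lambda>y::'a. shrink e ((norm y)\<^sup>2)) has_derivative (\<lambda>v. - 2 * e / (1 + e - ?s)\<^sup>2 * (2 * (y \<bullet> v)))) (at y within S)"
    using has_derivative_compose[OF 2 1] .
  have "((\<lambda>y::'a. shrink e ((norm y)\<^sup>2) *\<^sub>R y) has_derivative
     (\<lambda>v. shrink e ?s *\<^sub>R v + (- 2 * e / (1 + e - ?s)\<^sup>2 * (2 * (y \<bullet> v))) *\<^sub>R y)) (at y within S)"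
    by (rule has_derivative_scaleR[OF 3 has_derivative_ident])
  then show ?thesis unfolding bend_def by (simp add: mult.assoc)
qed

lemma bend_density_measurable [measurable]: "bend_density n e \<in> borel_measurable (borel :: 'a::euclidean_space measure)"
  unfolding bend_density_def shrink_def radial_stretch_def by measurable

text \<open>
The integral formula for the change of variables is formulated for well-ordered index types.
\<close>

lemma measure_bend_image_wellorder:
  fixes S :: "(real ^ 'n::{finite,wellorder}) set"
  assumes e: "0 < e" and m: "0 < m" "4 * e < m\<^sup>2" and inj: "inj_on (bend e) S"
    and S: "S \<in> sets borel" "\<And>y. y \<in> S \<Longrightarrow> (norm y)\<^sup>2 < 1 - e - m"
  shows "measure lebesgue (bend e ` S) = (LINT y:S|lborel. bend_density CARD('n::_) e y)"
proof -
  let ?f' = "\<lambda>y v. shrink e ((norm y)\<^sup>2) *\<^sub>R v + (- 4 * e / (1 + e - (norm y)\<^sup>2)\<^sup>2 * (y \<bullet> v)) *\<^sub>R (y::real^'n::_)"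
  have det: "\<bar>det (matrix (?f' y))\<bar> = bend_density CARD('n::_) e y" if "y \<in> S" for y
  proof -
    have y: "(norm y)\<^sup>2 \<le> 1 - e - m" using S(2)[OF that] by simp
    have n: "1 + e - (norm y)\<^sup>2 \<noteq> 0" using y e m by simp
    have "shrink e ((norm y)\<^sup>2) + - 4 * e / (1 + e - (norm y)\<^sup>2)\<^sup>2 * (norm y)\<^sup>2 = radial_stretch e ((norm y)\<^sup>2)"
    proof -
      define k where "k = 1 + e - (norm y)\<^sup>2"
      have k: "k \<noteq> 0" "(norm y)\<^sup>2 = 1 + e - k" using n by (auto simp: k_def)
      show ?thesis unfolding k(2) shrink_def radial_stretch_def using k(1) by (simp add: field_simps power2_eq_square)
    qed
    then have "det (matrix (?f' y)) = bend_density CARD('n::_) e y"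
      unfolding det_scale_plus_rank_one bend_density_def by simp
    then show ?thesis using bend_density_bounds(4)[OF e m y, of "CARD('n::_)"] by simp
  qed
  have bdd: "S \<subseteq> ball 0 1"
  proof
    fix y assume "y \<in> S"
    then have "(norm y)\<^sup>2 < 1" using S(2) e m by fastforce
    then show "y \<in> ball 0 1" by (simp add: abs_square_less_1)
  qed
  have fin: "emeasure lborel S < \<infinity>"
    using emeasure_mono[OF bdd, of lborel] emeasure_lborel_ball_finite[of "0::real^'n::_" 1] by (auto simp: less_top[symmetric] top_unique)
  have int: "set_integrable lborel S (bend_density CARD('n::_) e)"
    unfolding set_integrable_def
  proof (rule Bochner_Integration.integrable_bound[where f="\<lambda>y. indicator S y *\<^sub>R (1::real)"])
    show "integrable lborel (\<lambda>y. indicator S y *\<^sub>R (1::real))" using fin S by simp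
    show "AE y in lborel. norm (indicator S y *\<^sub>R bend_density CARD('n::_) e y) \<le> norm (indicator S y *\<^sub>R (1::real))"
    proof (rule AE_I2)
      fix y :: "real^'n::_"
      show "norm (indicator S y *\<^sub>R bend_density CARD('n::_) e y) \<le> norm (indicator S y *\<^sub>R (1::real))"
      proof (cases "y \<in> S")
        case True
        have y: "(norm y)\<^sup>2 \<le> 1 - e - m" using S(2)[OF True] by simp
        show ?thesis using True bend_density_bounds(3,4)[OF e m y, of "CARD('n::_)"] by simp
      qed simp
    qed
  qed (use S in measurable)
  have "measure lebesgue (bend e ` S) = integral S (\<lambda>y. \<bar>det (matrix (?f' y))\<bar>)"
  proof (rule measure_differentiable_image_eq[OF _ _ inj])
    show "S \<in> sets lebesgue" using S by simp
    show "(bend e has_derivative ?f' y) (at y within S)" if "y \<in> S" for y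
      using S(2)[OF that] e m by (intro bend_has_derivative) auto
    have "bend_density CARD('n::_) e integrable_on S" by (rule set_borel_integral_eq_integral(1)[OF int])
    then show "(\<lambda>y. \<bar>det (matrix (?f' y))\<bar>) integrable_on S"
      using integrable_cong[of S "\<lambda>y. \<bar>det (matrix (?f' y))\<bar>" "bend_density CARD('n::_) e"] det by simp
  qed
  also have "\<dots> = integral S (bend_density CARD('n::_) e)"
    by (rule Henstock_Kurzweil_Integration.integral_cong) (rule det)
  also have "\<dots> = (LINT y:S|lborel. bend_density CARD('n::_) e y)"
    using set_borel_integral_eq_integral(2)[OF int] by simp
  finally show ?thesis .
qed

typedef 'a wellordered = "UNIV :: 'a set" by simp

lemma bij_Abs_wellordered: "bij Abs_wellordered"
  by (rule o_bij[of Rep_wellordered]) (auto simp: comp_def Rep_wellordered_inverse Abs_wellordered_inverse)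

instance wellordered :: (finite) finite
proof
  have "UNIV = Abs_wellordered ` (UNIV :: 'a set)"
    by (rule bij_is_surj[OF bij_Abs_wellordered, symmetric])
  moreover have "finite (Abs_wellordered ` (UNIV :: 'a set))" by (rule finite_imageI) (rule finite)
  ultimately show "finite (UNIV :: 'a wellordered set)" by (simp only:)
qed

instantiation wellordered :: (finite) wellorder
begin

definition rank_wellordered :: "'a wellordered \<Rightarrow> nat" where
  "rank_wellordered = (SOME f. inj f)"

definition less_eq_wellordered :: "'a wellordered \<Rightarrow> 'a wellordered \<Rightarrow> bool" where
  "less_eq_wellordered x y \<longleftrightarrow> rank_wellordered x \<le> rank_wellordered y"

definition less_wellordered :: "'a wellordered \<Rightarrow> 'a wellordered \<Rightarrow> bool" where
  "less_wellordered x y \<longleftrightarrow> rank_wellordered x < rank_wellordered y"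

instance
proof
  have "\<exists>f :: 'a wellordered \<Rightarrow> nat. inj f"
    using finite_imp_inj_to_nat_seg[of "UNIV :: 'a wellordered set"] by auto
  then have inj: "inj (rank_wellordered :: 'a wellordered \<Rightarrow> nat)"
    unfolding rank_wellordered_def by (rule someI_ex)
  fix x y z :: "'a wellordered"
  show "(x < y) = (x \<le> y \<and> \<not> y \<le> x)" "x \<le> x" "x \<le> y \<or> y \<le> x"
    by (auto simp: less_eq_wellordered_def less_wellordered_def)
  show "x \<le> y \<Longrightarrow> y \<le> z \<Longrightarrow> x \<le> z" by (simp add: less_eq_wellordered_def)
  show "x \<le> y \<Longrightarrow> y \<le> x \<Longrightarrow> x = y"
    using inj by (auto simp: less_eq_wellordered_def inj_def)
  fix P :: "'a wellordered \<Rightarrow> bool" and a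
  assume H: "\<And>x. (\<And>y. y < x \<Longrightarrow> P y) \<Longrightarrow> P x"
  show "P a"
  proof (induction a rule: measure_induct_rule[where f=rank_wellordered])
    case (less a)
    show ?case by (rule H) (rule less, simp add: less_wellordered_def)
  qed
qed

end

definition reindex :: "real ^ 'n \<Rightarrow> real ^ ('n wellordered)" where
  "reindex x = (\<chi> i. x $ Rep_wellordered i)"

definition unreindex :: "real ^ ('n wellordered) \<Rightarrow> real ^ 'n" where
  "unreindex x = (\<chi> i. x $ Abs_wellordered i)"

lemma reindex_inverse [simp]: "unreindex (reindex x) = x" "reindex (unreindex z) = z"
  by (auto simp: reindex_def unreindex_def vec_eq_iff Abs_wellordered_inverse Rep_wellordered_inverse)

lemma inner_reindex: "reindex x \<bullet> reindex y = x \<bullet> y"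
proof -
  have "(\<Sum>i\<in>UNIV. x $ Rep_wellordered i * y $ Rep_wellordered i) = (\<Sum>j\<in>UNIV. x $ j * y $ j)"
    by (rule sum.reindex_bij_witness[of _ Abs_wellordered Rep_wellordered])
       (auto simp: Abs_wellordered_inverse Rep_wellordered_inverse)
  then show ?thesis by (simp add: inner_vec_def reindex_def)
qed

lemma norm_reindex [simp]: "norm (reindex x) = norm x"
  by (simp add: norm_eq_sqrt_inner inner_reindex)

lemma reindex_scaleR: "reindex (c *\<^sub>R x) = c *\<^sub>R reindex x"
  by (simp add: reindex_def vec_eq_iff)

lemma CARD_wellordered: "CARD('n wellordered) = CARD('n)"
  by (rule bij_betw_same_card[OF bij_Abs_wellordered, symmetric])

lemma continuous_reindex: "continuous_on UNIV reindex" "continuous_on UNIV unreindex"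
  unfolding reindex_def unreindex_def by (intro continuous_intros)+

lemma measurable_reindex [measurable]: "reindex \<in> borel_measurable borel" "unreindex \<in> borel_measurable borel"
  using borel_measurable_continuous_onI[OF continuous_reindex(1)] borel_measurable_continuous_onI[OF continuous_reindex(2)] by auto

lemma lborel_reindex: "distr lborel borel (reindex :: real ^ 'n \<Rightarrow> _) = lborel"
proof (rule lborel_eqI[symmetric])
  fix l u :: "real ^ ('n wellordered)" assume le: "\<And>b. b \<in> Basis \<Longrightarrow> l \<bullet> b \<le> u \<bullet> b"
  have prod: "(\<Prod>b\<in>Basis. (w - v) \<bullet> b) = (\<Prod>i\<in>UNIV. (w - v) $ i)" for v w :: "real ^ 'm"
    by (subst prod.reindex_bij_betw[of "\<lambda>i. axis i 1" UNIV Basis "\<lambda>b. (w - v) \<bullet> b", symmetric])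
       (auto simp: bij_betw_def inj_on_def axis_eq_axis Basis_vec_def inner_axis)
  have le': "l $ i \<le> u $ i" for i using le[of "axis i 1"] by (auto simp: Basis_vec_def inner_axis)
  have "reindex -` box l u = box (unreindex l) (unreindex u)"
    by (auto simp: mem_box_cart reindex_def unreindex_def) (metis Abs_wellordered_inverse UNIV_I Rep_wellordered_inverse)+
  then have "emeasure (distr lborel borel reindex) (box l u) = emeasure lborel (box (unreindex l) (unreindex u))"
    by (subst emeasure_distr) auto
  also have "\<dots> = (\<Prod>b\<in>Basis. (unreindex u - unreindex l) \<bullet> b)"
    by (rule emeasure_lborel_box) (use le' in \<open>auto simp: Basis_vec_def inner_axis unreindex_def\<close>)
  also have "(\<Prod>b\<in>Basis. (unreindex u - unreindex l) \<bullet> b) = (\<Prod>b\<in>Basis. (u - l) \<bullet> b)"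
    unfolding prod
    by (rule prod.reindex_bij_witness[of _ Rep_wellordered Abs_wellordered])
       (auto simp: unreindex_def Abs_wellordered_inverse Rep_wellordered_inverse)
  finally show "emeasure (distr lborel borel reindex) (box l u) = ennreal (\<Prod>b\<in>Basis. (u - l) \<bullet> b)" .
qed simp

lemma bend_reindex: "bend e (reindex y) = reindex (bend e y)"
  by (simp add: bend_def reindex_scaleR)

text \<open>
An arbitrary finite index type is in bijection with its well-ordered copy, and the induced isometry
of the Euclidean spaces preserves Lebesgue measure and commutes with \<open>bend e\<close>.
\<close>

lemma measure_bend_image:
  fixes S :: "(real ^ 'n) set"
  assumes e: "0 < e" and m: "0 < m" "4 * e < m\<^sup>2" and inj: "inj_on (bend e) S"
    and S [measurable]: "S \<in> sets borel" and Sm: "\<And>y. y \<in> S \<Longrightarrow> (norm y)\<^sup>2 < 1 - e - m"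
    and im: "bend e ` S \<in> sets borel"
  shows "measure lebesgue (bend e ` S) = (LINT y:S|lborel. bend_density CARD('n) e y)"
proof -
  have ri: "reindex ` T = unreindex -` T" for T :: "(real ^ 'n) set"
    by (auto simp: image_iff) (metis reindex_inverse(2))
  have rb: "reindex ` T \<in> sets borel" if "T \<in> sets borel" for T :: "(real ^ 'n) set"
    unfolding ri using measurable_sets[OF measurable_reindex(2) that] by simp
  have rv: "reindex -` reindex ` T = T" for T :: "(real ^ 'n) set"
    unfolding ri by auto
  have mr: "measure lebesgue (reindex ` T) = measure lebesgue T" if T: "T \<in> sets borel" for T :: "(real ^ 'n) set"
  proof -
    have "measure lborel (reindex ` T) = measure (distr lborel borel reindex) (reindex ` T)"
      by (simp only: lborel_reindex)
    also have "\<dots> = measure lborel T" using rb[OF T] by (subst measure_distr) (auto simp: rv)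
    finally show ?thesis using T rb[OF T] by simp
  qed
  have injr: "inj_on (bend e) (reindex ` S)"
  proof (rule inj_onI)
    fix a b assume "a \<in> reindex ` S" "b \<in> reindex ` S" "bend e a = bend e b"
    then obtain y z where "y \<in> S" "z \<in> S" "a = reindex y" "b = reindex z" "reindex (bend e y) = reindex (bend e z)"
      by (auto simp: bend_reindex)
    then show "a = b" using inj by (metis inj_onD reindex_inverse(1))
  qed
  have "measure lebesgue (bend e ` S) = measure lebesgue (bend e ` (reindex ` S))"
    unfolding image_image bend_reindex using mr[OF im] by (simp add: image_image)
  also have "\<dots> = (LINT y:reindex ` S|lborel. bend_density CARD('n wellordered) e y)"
    by (rule measure_bend_image_wellorder[OF e m injr rb[OF S]]) (use Sm in auto)
  also have "\<dots> = (\<integral>y. indicator (reindex ` S) y *\<^sub>R bend_density CARD('n) e y \<partial>distr lborel borel reindex)"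
    unfolding set_lebesgue_integral_def CARD_wellordered lborel_reindex ..
  also have "\<dots> = (\<integral>y. indicator (reindex ` S) (reindex y) *\<^sub>R bend_density CARD('n) e (reindex y) \<partial>lborel)"
    using rb[OF S] by (subst integral_distr) auto
  also have "\<dots> = (LINT y:S|lborel. bend_density CARD('n) e y)"
  proof -
    have "indicator (reindex ` S) (reindex y) = (indicator S y :: real)" for y
      using rv[of S] by (auto simp: indicator_def)
    moreover have "bend_density n e (reindex y) = bend_density n e y" for n and y :: "real ^ 'n"
      by (simp add: bend_density_def)
    ultimately show ?thesis by (simp add: set_lebesgue_integral_def)
  qed
  finally show ?thesis .
qed

section \<open>Remez inequality along bent chords\<close>

text \<open>
On the line through \<open>y\<close> and \<open>z\<close>, in orthogonal coordinates \<open>p + x q\<close>, the function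
\<open>F (bend e (p + \<zeta> q))\<close> is holomorphic for \<open>\<bar>\<zeta>\<bar> ^ 2 < 1 - norm p ^ 2\<close>, because \<open>\<bar>shrink e s\<bar> \<le> 1\<close> for
\<open>Re s < 1\<close> keeps the argument in the unit ball. At \<open>\<zeta> ^ 2 = 1 - e - norm p ^ 2\<close> the argument of \<open>F\<close> is
\<open>0\<close>. After rescaling the disc, the one-dimensional Remez inequality applies.
\<close>

lemma remez_along_bent_chord:
  fixes F :: "complex ^ 'n \<Rightarrow> complex" and y z :: "real ^ 'n" and e m L N :: real
  assumes F: "analytic_vec_on F (ball 0 1)" and le: "\<And>z. z \<in> ball 0 1 \<Longrightarrow> cmod (F z) \<le> 1"
    and F0: "cmod (F 0) = exp (- L)" and e: "0 < e" and m: "0 < m" and N: "e * N = 4 * L"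
    and y: "(norm y)\<^sup>2 \<le> 1 - e - m" and z: "(norm z)\<^sup>2 \<le> 1 - e - m" and yz: "y \<noteq> z"
  obtains cs :: "real list" where "real (length cs) \<le> N"
    "\<And>t. 0 \<le> t \<Longrightarrow> t \<le> 1 / 8 \<Longrightarrow> t \<notin> set cs \<Longrightarrow>
       cmod (F (of_real_vec (bend e z))) \<le>
         5 powr N * (\<Prod>c\<leftarrow>cs. 2 + 2 / \<bar>t - c\<bar>) * cmod (F (of_real_vec (bend e ((1 - t) *\<^sub>R y + t *\<^sub>R z))))"
proof -
  \<comment> \<open>orthogonal coordinates \<open>y = p + x q\<close>, \<open>z = p + x' q\<close> on the line through \<open>y\<close> and \<open>z\<close>\<close>
  define q where "q = (z - y) /\<^sub>R norm (z - y)"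
  define x where "x = y \<bullet> q"
  define x' where "x' = z \<bullet> q"
  define p where "p = y - x *\<^sub>R q"
  have qn: "q \<bullet> q = 1" using yz by (simp add: q_def dot_square_norm power2_eq_square)
  have zy: "z - y = norm (z - y) *\<^sub>R q" using yz by (simp add: q_def)
  have x'x: "x' - x = norm (z - y)" unfolding x_def x'_def inner_diff_left[symmetric]
    by (subst zy) (simp add: qn)
  have pq: "p \<bullet> q = 0" by (simp add: p_def inner_diff_left x_def qn)
  have yp: "y = p + x *\<^sub>R q" by (simp add: p_def)
  have zp: "z = p + x' *\<^sub>R q"
  proof -
    have "z = y + (x' - x) *\<^sub>R q" using zy x'x by (simp add: algebra_simps)
    then show ?thesis by (simp add: yp algebra_simps)
  qed
  define P where "P = (norm p)\<^sup>2"
  have nsq: "(norm (p + r *\<^sub>R q))\<^sup>2 = P + r\<^sup>2" for r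
    unfolding P_def power2_norm_eq_inner using pq qn
    by (simp add: inner_add_left inner_add_right inner_commute power2_eq_square)
  have xx': "x\<^sup>2 \<le> 1 - e - m - P" "x'\<^sup>2 \<le> 1 - e - m - P"
    using y z nsq[of x] nsq[of x'] yp zp by auto
  have P: "0 \<le> P" "P \<le> 1 - e - m" using xx'(1) zero_le_power2[of x] by (simp add: P_def, linarith)
  define D where "D = ball (0::complex) (sqrt (1 - P))"
  define g where "g \<zeta> = (1 - of_real e - (of_real P + \<zeta>\<^sup>2)) / (1 + of_real e - (of_real P + \<zeta>\<^sup>2))" for \<zeta> :: complex
  define Z where "Z \<zeta> = (\<chi> i. g \<zeta> * (of_real (p $ i) + \<zeta> * of_real (q $ i)))" for \<zeta>
  have D2: "P + (cmod \<zeta>)\<^sup>2 < 1" if "\<zeta> \<in> D" for \<zeta>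
  proof -
    have "cmod \<zeta> < sqrt (1 - P)" using that by (simp add: D_def)
    then have "(cmod \<zeta>)\<^sup>2 < (sqrt (1 - P))\<^sup>2" by (intro power_strict_mono) auto
    then show ?thesis using P e m by simp
  qed
  have Re: "Re (of_real P + \<zeta>\<^sup>2) < 1" if "\<zeta> \<in> D" for \<zeta>
    using D2[OF that] complex_Re_le_cmod[of "\<zeta>\<^sup>2"] by (simp add: norm_power)
  have den: "1 + of_real e - (of_real P + \<zeta>\<^sup>2) \<noteq> 0" if "\<zeta> \<in> D" for \<zeta>
  proof
    assume "1 + of_real e - (of_real P + \<zeta>\<^sup>2) = 0"
    then have "Re (1 + of_real e - (of_real P + \<zeta>\<^sup>2)) = 0" by simp
    then show False using Re[OF that] e by simp
  qed
  have g1: "cmod (g \<zeta>) \<le> 1" if "\<zeta> \<in> D" for \<zeta>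
  proof -
    define s where "s = of_real P + \<zeta>\<^sup>2"
    have "(1 - e - Re s)\<^sup>2 \<le> (1 + e - Re s)\<^sup>2"
    proof -
      have "(1 + e - Re s)\<^sup>2 - (1 - e - Re s)\<^sup>2 = 4 * e * (1 - Re s)" by (simp add: power2_eq_square algebra_simps)
      moreover have "0 \<le> 4 * e * (1 - Re s)" using Re[OF that] e by (simp add: s_def)
      ultimately show ?thesis by linarith
    qed
    then have "(cmod (1 - of_real e - s))\<^sup>2 \<le> (cmod (1 + of_real e - s))\<^sup>2"
      unfolding cmod_power2 by simp
    then have "cmod (1 - of_real e - s) \<le> cmod (1 + of_real e - s)" by (rule power2_le_imp_le) simp
    then show ?thesis using den[OF that] unfolding g_def s_def by (simp add: norm_divide divide_le_eq_1)
  qed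
  have nZ: "Z \<zeta> \<in> ball 0 1" if "\<zeta> \<in> D" for \<zeta>
  proof -
    have comp: "(cmod (of_real (p $ i) + \<zeta> * of_real (q $ i)))\<^sup>2 = (p $ i)\<^sup>2 + 2 * Re \<zeta> * (p $ i * q $ i) + (cmod \<zeta>)\<^sup>2 * (q $ i)\<^sup>2" for i
      unfolding cmod_power2 by (simp add: power2_eq_square algebra_simps)
    have "(norm (Z \<zeta>))\<^sup>2 = (\<Sum>i\<in>UNIV. (cmod (Z \<zeta> $ i))\<^sup>2)"
      by (simp add: norm_vec_def L2_set_def sum_nonneg)
    also have "\<dots> = (cmod (g \<zeta>))\<^sup>2 * (\<Sum>i\<in>UNIV. (p $ i)\<^sup>2 + 2 * Re \<zeta> * (p $ i * q $ i) + (cmod \<zeta>)\<^sup>2 * (q $ i)\<^sup>2)"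
      by (simp add: Z_def norm_mult power_mult_distrib comp sum_distrib_left)
    also have "(\<Sum>i\<in>UNIV. (p $ i)\<^sup>2 + 2 * Re \<zeta> * (p $ i * q $ i) + (cmod \<zeta>)\<^sup>2 * (q $ i)\<^sup>2) = P + (cmod \<zeta>)\<^sup>2"
    proof -
      have "(\<Sum>i\<in>UNIV. (p $ i)\<^sup>2) = P" unfolding P_def power2_norm_eq_inner inner_vec_def by (simp add: power2_eq_square)
      moreover have "(\<Sum>i\<in>UNIV. p $ i * q $ i) = 0" using pq by (simp add: inner_vec_def)
      moreover have "(\<Sum>i\<in>UNIV. (q $ i)\<^sup>2) = 1" using qn by (simp add: inner_vec_def power2_eq_square)
      ultimately show ?thesis by (simp add: sum.distrib sum_distrib_left[symmetric])
    qed
    also have "(cmod (g \<zeta>))\<^sup>2 * (P + (cmod \<zeta>)\<^sup>2) \<le> 1 * (P + (cmod \<zeta>)\<^sup>2)"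
      using g1[OF that] P by (intro mult_right_mono) (auto simp: power_le_one)
    also have "\<dots> < 1" using D2[OF that] by simp
    finally have "norm (Z \<zeta>) < 1" by (simp add: abs_square_less_1)
    then show ?thesis by simp
  qed
  have hol: "(\<lambda>\<zeta>. F (Z \<zeta>)) holomorphic_on D"
  proof (rule analytic_vec_compose_holomorphic[OF F _ _ nZ])
    show "open D" by (simp add: D_def)
    show "(\<lambda>\<zeta>. Z \<zeta> $ i) holomorphic_on D" for i
      unfolding Z_def g_def using den by (auto intro!: holomorphic_intros)
  qed
  have real: "Z (of_real r) = of_real_vec (bend e (p + r *\<^sub>R q))" for r
  proof -
    have "g (of_real r) = of_real (shrink e (P + r\<^sup>2))" by (simp add: g_def shrink_def)
    then show ?thesis by (simp add: Z_def of_real_vec_def bend_def nsq vec_eq_iff)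
  qed
  \<comment> \<open>the radius is taken slightly smaller than that of \<open>D\<close> so that the function extends past the unit circle\<close>
  define b where "b = sqrt (1 - P - e / 28)"
  have b2: "b\<^sup>2 = 1 - P - e / 28" and b: "0 < b" "b \<le> 1" "b < sqrt (1 - P)"
    using P e m by (auto simp: b_def)
  define f where "f \<zeta> = F (Z (of_real b * \<zeta>))" for \<zeta>
  define R where "R = sqrt (1 - P) / b"
  have R: "R > 1" using b by (simp add: R_def)
  have bD: "of_real b * \<zeta> \<in> D" if "\<zeta> \<in> ball 0 R" for \<zeta>
    using that b by (simp add: D_def R_def norm_mult pos_less_divide_eq mult.commute)
  have fh: "f holomorphic_on ball 0 R"
  proof -
    have "(\<lambda>\<zeta>. of_real b * \<zeta>) holomorphic_on ball 0 R" by (intro holomorphic_intros)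
    moreover have "(\<lambda>\<zeta>. of_real b * \<zeta>) ` ball 0 R \<subseteq> D" using bD by auto
    ultimately show ?thesis
      using holomorphic_on_compose_gen[OF _ hol] unfolding f_def comp_def by blast
  qed
  have fle: "cmod (f \<zeta>) \<le> 1" if "cmod \<zeta> < 1" for \<zeta>
    unfolding f_def by (rule le[OF nZ[OF bD]]) (use that R in simp)
  define \<zeta>0 where "\<zeta>0 = sqrt (1 - e - P)"
  define \<tau> where "\<tau> = \<zeta>0 / b"
  have \<zeta>0: "0 < \<zeta>0" "\<zeta>0\<^sup>2 = 1 - e - P" using P m by (auto simp: \<zeta>0_def)
  have \<tau>0: "0 < \<tau>" using \<zeta>0 b by (simp add: \<tau>_def)
  have \<tau>2: "27 / 28 * e \<le> 1 - \<tau>\<^sup>2"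
  proof -
    have "1 - \<tau>\<^sup>2 = (b\<^sup>2 - \<zeta>0\<^sup>2) / b\<^sup>2"
      using b by (simp add: \<tau>_def power_divide diff_divide_distrib)
    also have "b\<^sup>2 - \<zeta>0\<^sup>2 = 27 / 28 * e" using b2 \<zeta>0 by simp
    finally have "1 - \<tau>\<^sup>2 = (27 / 28 * e) / b\<^sup>2" .
    moreover have "27 / 28 * e / 1 \<le> (27 / 28 * e) / b\<^sup>2"
      using b e by (intro divide_left_mono) (auto simp: power_le_one)
    ultimately show ?thesis by simp
  qed
  have \<tau>1: "\<tau> < 1"
  proof -
    have "\<tau>\<^sup>2 < 1" using \<tau>2 e by simp
    then show ?thesis using \<tau>0 by (simp add: abs_square_less_1)
  qed
  have zero: "Z (of_real r) = 0" if "r\<^sup>2 = 1 - e - P" for r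
    using that by (simp add: real bend_def nsq shrink_def of_real_vec_def vec_eq_iff)
  have fL: "cmod (f (of_real \<tau>)) = exp (- L)" "cmod (f (- of_real \<tau>)) = exp (- L)"
  proof -
    have "of_real b * of_real \<tau> = complex_of_real \<zeta>0" "of_real b * (- of_real \<tau>) = complex_of_real (- \<zeta>0)"
      using b by (simp_all add: \<tau>_def)
    then show "cmod (f (of_real \<tau>)) = exp (- L)" "cmod (f (- of_real \<tau>)) = exp (- L)"
      unfolding f_def using zero[of \<zeta>0] zero[of "- \<zeta>0"] \<zeta>0 F0 by (simp_all only: power2_minus)
  qed
  have in\<tau>: "- \<tau> \<le> r / b" "r / b \<le> \<tau>" if "r\<^sup>2 \<le> 1 - e - m - P" for r
  proof -
    have "r\<^sup>2 \<le> \<zeta>0\<^sup>2" using that \<zeta>0 m by simp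
    then have "\<bar>r\<bar> \<le> \<bar>\<zeta>0\<bar>" by (simp only: abs_le_square_iff)
    then have "\<bar>r\<bar> \<le> \<zeta>0" using \<zeta>0 by simp
    then have "- \<zeta>0 \<le> r" "r \<le> \<zeta>0" by auto
    then show "- \<tau> \<le> r / b" "r / b \<le> \<tau>" unfolding \<tau>_def
      using divide_right_mono[of "- \<zeta>0" r b] divide_right_mono[of r \<zeta>0 b] b by simp_all
  qed
  have e27: "0 < 27 / 28 * e" using e by simp
  have xne: "x / b \<noteq> x' / b" using x'x yz b by auto
  have N': "27 * L \<le> 7 * (27 / 28 * e) * N"
  proof -
    have "7 * (27 / 28 * e) * N = 27 / 4 * (e * N)" by simp
    then show ?thesis unfolding N by simp
  qed
  have fr: "f (of_real (r / b)) = F (of_real_vec (bend e (p + r *\<^sub>R q)))" for r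
  proof -
    have "of_real b * of_real (r / b) = complex_of_real r" using b by simp
    then show ?thesis unfolding f_def by (simp only: real)
  qed
  obtain cs :: "real list" where cs: "real (length cs) \<le> N"
    "\<And>t. 0 \<le> t \<Longrightarrow> t \<le> 1 / 8 \<Longrightarrow> t \<notin> set cs \<Longrightarrow>
       cmod (f (of_real (x' / b))) \<le> 5 powr N * (\<Prod>c\<leftarrow>cs. 2 + 2 / \<bar>t - c\<bar>) * cmod (f (of_real (x / b + t * (x' / b - x / b))))"
    by (rule remez_product[OF fh R _ \<tau>0 \<tau>1 e27 \<tau>2 fL N' in\<tau>[OF xx'(1)] in\<tau>[OF xx'(2)] xne])
      (erule fle, erule that, blast)
  show ?thesis
  proof (rule that[OF cs(1)])
    fix t :: real assume t: "0 \<le> t" "t \<le> 1/8" "t \<notin> set cs"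
    have eq: "x / b + t * (x' / b - x / b) = (x + t * (x' - x)) / b" using b by (simp add: field_simps)
    have "(1 - t) *\<^sub>R y + t *\<^sub>R z = p + (x + t * (x' - x)) *\<^sub>R q" unfolding yp zp by (simp add: algebra_simps)
    then show "cmod (F (of_real_vec (bend e z))) \<le>
         5 powr N * (\<Prod>c\<leftarrow>cs. 2 + 2 / \<bar>t - c\<bar>) * cmod (F (of_real_vec (bend e ((1 - t) *\<^sub>R y + t *\<^sub>R z))))"
      using cs(2)[OF t] unfolding eq fr zp[symmetric] by simp
  qed
qed

section \<open>Interpolation of volumes\<close>

lemma integral_unit_cube:
  fixes q :: "'a::euclidean_space \<Rightarrow> real"
  assumes [measurable]: "q \<in> borel_measurable borel"
  shows "(\<integral>x. q x \<partial>unit_cube) = (\<integral>x. indicator (box (- One) One) x * q x \<partial>lborel) / 2 ^ DIM('a)"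
proof -
  have "unit_cube = density lborel (\<lambda>x::'a. ennreal (indicator (box (- One) One) x / 2 ^ DIM('a)))"
    unfolding unit_cube_def uniform_measure_def emeasure_big_box
  proof (rule density_cong)
    show "AE x in lborel. (indicator (box (- One) One) (x::'a) :: ennreal) / ennreal (2 ^ DIM('a)) = ennreal (indicator (box (- One) One) x / 2 ^ DIM('a))"
      by (rule AE_I2) (auto simp: indicator_def divide_ennreal[symmetric] ennreal_1[symmetric] simp del: ennreal_1)
  qed auto
  then have "(\<integral>x. q x \<partial>unit_cube) = (\<integral>x. q x \<partial>density lborel (\<lambda>x::'a. ennreal (indicator (box (- One) One) x / 2 ^ DIM('a))))"
    by (simp only:)
  also have "\<dots> = (\<integral>x. (indicator (box (- One) One) x / 2 ^ DIM('a)) *\<^sub>R q x \<partial>lborel)"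
    by (rule integral_density) auto
  finally have "(\<integral>x. q x \<partial>unit_cube) = (\<integral>x. (indicator (box (- One) One) x * q x) / 2 ^ DIM('a) \<partial>lborel)"
    by simp
  then show ?thesis by simp
qed

text \<open>
The setting in which sets in the ball are replaced by their preimages under \<open>bend e\<close>; Lebesgue measure
on the ball then has the log-concave density \<open>w\<close> on the convex set \<open>pull UNIV\<close>.
\<close>

locale bent_ball =
  fixes \<epsilon> r :: real and u :: "real ^ 'n" and e m :: real
  assumes \<epsilon>: "0 < \<epsilon>" "\<epsilon> \<le> 1 / 4" and r: "0 < r" and sub: "ball u r \<subseteq> ball 0 (1 - \<epsilon>)"
    and e_eq: "e = \<epsilon> ^ 3 / 3" and m_eq: "m = 2 * \<epsilon> * (1 - \<epsilon>)"
begin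

lemmas num = bend_numerics[OF \<epsilon>, folded e_eq m_eq]

definition pull :: "(real ^ 'n) set \<Rightarrow> (real ^ 'n) set" where
  "pull E = {y. (norm y)\<^sup>2 < 1 - e - m \<and> bend e y \<in> ball u r \<inter> E}"

abbreviation w :: "real ^ 'n \<Rightarrow> real" where "w \<equiv> bend_density CARD('n) e"

lemma bend_measurable [measurable]: "(bend e :: real ^ 'n \<Rightarrow> _) \<in> borel_measurable borel"
  unfolding bend_def shrink_def by measurable

lemma pull_measurable [measurable]: "E \<in> sets borel \<Longrightarrow> pull E \<in> sets borel"
proof -
  assume [measurable]: "E \<in> sets borel"
  have "pull E = {y \<in> space borel. (norm y)\<^sup>2 < 1 - e - m} \<inter> (bend e -` (ball u r \<inter> E) \<inter> space borel)"
    by (auto simp: pull_def)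
  also have "\<dots> \<in> sets borel" by measurable
  finally show ?thesis .
qed

lemma bend_pull: "bend e ` pull E = ball u r \<inter> E"
proof
  show "ball u r \<inter> E \<subseteq> bend e ` pull E"
  proof
    fix x assume x: "x \<in> ball u r \<inter> E"
    then have "norm x < 1 - \<epsilon>" using sub by auto
    then obtain y where "(norm y)\<^sup>2 < 1 - e - m" "bend e y = x" using bend_inj_surj(2)[OF \<epsilon> e_eq m_eq] by blast
    then show "x \<in> bend e ` pull E" using x by (auto simp: pull_def)
  qed
qed (auto simp: pull_def)

lemma pull_bound: "y \<in> pull E \<Longrightarrow> (norm y)\<^sup>2 \<le> 1 - e - m"
  by (simp add: pull_def)

lemma pull_subset_cube: "pull E \<subseteq> box (- One) One"
proof
  fix y assume "y \<in> pull E"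
  then have "(norm y)\<^sup>2 < 1" using num(1,2) by (auto simp: pull_def)
  then have n: "norm y < 1" by (simp add: abs_square_less_1)
  have "\<bar>y \<bullet> b\<bar> < 1" if "b \<in> Basis" for b using Basis_le_norm[OF that, of y] n by simp
  then show "y \<in> box (- One) One" by (auto simp: mem_box abs_less_iff)
qed

lemma integral_pull:
  assumes [measurable]: "E \<in> sets borel"
  shows "(\<integral>y. indicator (pull E) y * w y \<partial>unit_cube) = measure lebesgue (ball u r \<inter> E) / 2 ^ CARD('n)"
    and "integrable unit_cube (\<lambda>y. indicator (pull E) y * w y)"
proof -
  have m: "measure lebesgue (bend e ` pull E) = (LINT y:pull E|lborel. w y)"
  proof (rule measure_bend_image[OF num(1,2,4)])
    show "inj_on (bend e) (pull E)"
      by (rule inj_on_subset[OF bend_inj_surj(1)[OF \<epsilon> e_eq m_eq]]) (auto simp: pull_def)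
    show "bend e ` pull E \<in> sets borel" unfolding bend_pull by measurable
  qed (auto simp: pull_def)
  have "(\<integral>y. indicator (pull E) y * w y \<partial>unit_cube) = (\<integral>x. indicator (box (- One) One) x * (indicator (pull E) x * w x) \<partial>lborel) / 2 ^ DIM(real ^ 'n)"
    by (rule integral_unit_cube) measurable
  also have "(\<lambda>x. indicator (box (- One) One) x * (indicator (pull E) x * w x)) = (\<lambda>x. indicator (pull E) x *\<^sub>R w x)"
    using pull_subset_cube[of E] by (auto simp: indicator_def fun_eq_iff)
  finally show "(\<integral>y. indicator (pull E) y * w y \<partial>unit_cube) = measure lebesgue (ball u r \<inter> E) / 2 ^ CARD('n)"
    using m unfolding bend_pull set_lebesgue_integral_def by simp
  interpret U: prob_space "unit_cube :: (real ^ 'n) measure" by (rule prob_space_unit_cube)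
  show "integrable unit_cube (\<lambda>y. indicator (pull E) y * w y)"
  proof (rule U.integrable_const_bound[where B=1])
    show "AE y in unit_cube. norm (indicator (pull E) y * w y) \<le> 1"
    proof (rule AE_I2)
      fix y show "norm (indicator (pull E) y * w y) \<le> 1"
        using bend_density_bounds(3,4)[OF num(1,2,4) pull_bound, of y E "CARD('n)"] by (cases "y \<in> pull E") auto
    qed
  qed measurable
qed

lemma norm_center: "norm u + r \<le> 1 - \<epsilon>"
  using sub r \<epsilon> by (simp add: ball_subset_ball_iff)

lemma pull_convex:
  assumes "y \<in> pull UNIV" "z \<in> pull UNIV" "0 \<le> t" "t \<le> 1"
  shows "(1 - t) *\<^sub>R y + t *\<^sub>R z \<in> pull UNIV"
proof -
  let ?x = "(1 - t) *\<^sub>R y + t *\<^sub>R z"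
  have yz: "(norm y)\<^sup>2 < 1 - e - m" "(norm z)\<^sup>2 < 1 - e - m" "norm (bend e y - u) < r" "norm (bend e z - u) < r"
    using assms by (auto simp: pull_def dist_norm norm_minus_commute)
  define b where "b = max ((norm y)\<^sup>2) ((norm z)\<^sup>2)"
  have "(norm ?x)\<^sup>2 \<le> b" by (rule norm_sq_bound_convex) (use assms in \<open>auto simp: b_def\<close>)
  then have x1: "(norm ?x)\<^sup>2 < 1 - e - m" using yz by (simp add: b_def)
  define r' where "r' = max (norm (bend e y - u)) (norm (bend e z - u))"
  have "norm (bend e ?x - u) \<le> r'"
    by (rule bend_preimage_convex[OF \<epsilon> e_eq m_eq _ _ _ _ _ assms(3,4)])
       (use yz norm_center in \<open>auto simp: r'_def\<close>)
  also have "r' < r" using yz by (simp add: r'_def)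
  finally show ?thesis using x1 by (simp add: pull_def dist_norm norm_minus_commute)
qed

text \<open>
The averaged Prekopa-Leindler inequality for the Jacobian density \<open>w\<close>, restricted to the preimages of
the ball (as \<open>f\<close>) and of \<open>S\<close> (as \<open>g\<close>); \<open>h\<close> is \<open>w\<close> over the ball, halved over \<open>E\<close>. Along a chord the
halving costs at most \<open>\<theta> ln 2\<close> on average, which the factor \<open>2 powr \<theta>\<close> in \<open>h\<close> compensates.
The functions have to be bounded away from \<open>0\<close>, whence the auxiliary values \<open>\<eta>\<close> and \<open>\<zeta>\<close> outside the
sets. Parameters outside \<open>[0, 1]\<close> have probability \<open>0\<close>; they are truncated since the interpolation
parameter has to be in \<open>[0, 1]\<close> everywhere.
\<close>

lemma volume_interpolation:
  fixes S E :: "(real ^ 'n) set" and a \<theta> :: real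
  assumes [measurable]: "S \<in> sets borel" "E \<in> sets borel" and a: "0 < a" "a \<le> 1" and \<theta>: "0 \<le> \<theta>" "\<theta> \<le> 1"
    and pos: "0 < measure lebesgue (ball u r \<inter> S)"
    and bad: "\<And>y z. y \<in> pull UNIV \<Longrightarrow> z \<in> pull S \<Longrightarrow>
      measure (uniform_measure lborel {0..a}) {t. (1 - min 1 (max 0 t)) *\<^sub>R y + min 1 (max 0 t) *\<^sub>R z \<in> pull E} \<le> \<theta>"
  shows "measure lebesgue (ball u r) powr (1 - a / 2) * measure lebesgue (ball u r \<inter> S) powr (a / 2)
    \<le> 2 powr \<theta> * (measure lebesgue (ball u r) - measure lebesgue (ball u r \<inter> E) / 2)"
proof -
  let ?P = "uniform_measure lborel {0..a}"
  define c where "c t = min 1 (max 0 t)" for t :: real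
  have c01: "0 \<le> c t" "c t \<le> 1" for t by (auto simp: c_def)
  have cm [measurable]: "c \<in> borel_measurable borel" unfolding c_def by measurable
  interpret P: prob_space ?P by (rule prob_space_uniform_measure) (use a in auto)
  interpret U: prob_space "unit_cube :: (real ^ 'n) measure" by (rule prob_space_unit_cube)
  define \<tau> where "\<tau> = a / 2"
  have \<tau>: "0 < \<tau>" "\<tau> \<le> 1 / 2" using a by (auto simp: \<tau>_def)
  have cint: "integrable ?P c" by (rule P.integrable_const_bound[where B=1]) (use c01 in auto)
  have \<tau>eq: "(\<integral>t. c t \<partial>?P) = \<tau>"
  proof -
    have "?P = density lborel (\<lambda>t. ennreal (indicator {0..a} t / a))"
      unfolding uniform_measure_def
    proof (rule density_cong)
      show "AE t in lborel. indicator {0..a} t / emeasure lborel {0..a} = ennreal (indicator {0..a} t / a)"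
        by (rule AE_I2) (use a in \<open>auto simp: indicator_def divide_ennreal[symmetric] ennreal_1[symmetric] simp del: ennreal_1\<close>)
    qed auto
    then have "(\<integral>t. c t \<partial>?P) = (\<integral>t. (indicator {0..a} t / a) * c t \<partial>lborel)"
      using a by (simp add: integral_density)
    also have "\<dots> = (\<integral>t. indicator {0..a} t *\<^sub>R t \<partial>lborel) / a"
      by (subst integral_divide_zero[symmetric], rule Bochner_Integration.integral_cong)
         (use a in \<open>auto simp: indicator_def c_def\<close>)
    also have "(\<integral>t. indicator {0..a} t *\<^sub>R t \<partial>lborel) = (LBINT t:{0..a}. t)" by (simp add: set_lebesgue_integral_def)
    also have "\<dots> = a\<^sup>2 / 2"
    proof -
      have "(\<integral>t. indicator {0..a} t *\<^sub>R t \<partial>lborel) = a\<^sup>2 / 2 - 0\<^sup>2 / 2"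
        by (rule integral_FTC_atLeastAtMost)
           (use a in \<open>auto intro!: derivative_eq_intros continuous_intros simp: has_real_derivative_iff_has_vector_derivative[symmetric]\<close>)
      then show ?thesis by (simp add: set_lebesgue_integral_def)
    qed
    finally show ?thesis using a by (simp add: \<tau>_def power2_eq_square)
  qed
  define w0 where "w0 = shrink e (1 - e - m) ^ (CARD('n) - 1) * radial_stretch e (1 - e - m)"
  have w0: "0 < w0" unfolding w0_def
    by (rule bend_density_bounds(2)[OF num(1,2,4), of "0::real ^ 'n"]) (use num(3) in simp)
  have wb: "w0 \<le> w y" "w y \<le> 1" "0 < w y" if "(norm y)\<^sup>2 \<le> 1 - e - m" for y
    unfolding w0_def using bend_density_bounds(1,3,4)[OF num(1,2,4) that] by auto
  let ?K = "pull UNIV"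
  have sub: "pull T \<subseteq> ?K" for T by (auto simp: pull_def)
  have Kb: "y \<in> pull T \<Longrightarrow> (norm y)\<^sup>2 \<le> 1 - e - m" for y T by (rule pull_bound)
  define WK WS WE where "WK = measure lebesgue (ball u r)" and "WS = measure lebesgue (ball u r \<inter> S)"
    and "WE = measure lebesgue (ball u r \<inter> E)"
  define n2 :: real where "n2 = 2 ^ CARD('n)"
  have n2: "0 < n2" by (simp add: n2_def)
  have WS: "0 < WS" using pos by (simp add: WS_def)
  have le: "WS \<le> WK" "WE \<le> WK"
    unfolding WS_def WE_def WK_def by (rule measure_mono_fmeasurable; simp)+
  have two: "1 \<le> 2 powr \<theta>" "2 powr \<theta> \<le> 2"
    using powr_mono[of 0 \<theta> 2] powr_mono[of \<theta> 1 2] \<theta> by auto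
  have approx: "(WK / n2) powr (1 - \<tau>) * (WS / n2) powr \<tau> \<le> 2 powr \<theta> * (WK - WE / 2) / n2 + \<zeta>"
    if \<zeta>: "0 < \<zeta>" "\<zeta> \<le> 1" for \<zeta>
  proof -
    define h0 where "h0 = min \<zeta> (w0 / 2)"
    have h0: "0 < h0" "h0 \<le> 1" "h0 \<le> \<zeta>" "h0 \<le> w0 / 2" using \<zeta> w0 by (auto simp: h0_def)
    \<comment> \<open>the value outside the sets is so small that pairs leaving them are harmless\<close>
    define \<eta> where "\<eta> = h0 powr (1 / \<tau>)"
    have \<eta>: "0 < \<eta>" "\<eta> \<le> h0" "\<tau> * ln \<eta> = ln h0"
    proof -
      show "0 < \<eta>" using h0 by (simp add: \<eta>_def)
      have "h0 powr (1 / \<tau>) \<le> h0 powr 1" using h0 \<tau> by (intro powr_mono') auto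
      then show "\<eta> \<le> h0" using h0 by (simp add: \<eta>_def)
      show "\<tau> * ln \<eta> = ln h0" using h0 \<tau> by (simp add: \<eta>_def ln_powr)
    qed
    have ln\<eta>: "ln \<eta> \<le> 0" using \<eta> h0 by simp
    define f where "f y = (if y \<in> ?K then w y else \<eta>)" for y
    define g where "g y = (if y \<in> pull S then w y else \<eta>)" for y
    define h where "h y = (if y \<in> ?K then 2 powr \<theta> * w y * (if y \<in> pull E then 1 / 2 else 1) else \<zeta>)" for y
    have [measurable]: "?K \<in> sets borel" "pull S \<in> sets borel" "pull E \<in> sets borel" by auto
    have fm [measurable]: "f \<in> borel_measurable borel" and gm [measurable]: "g \<in> borel_measurable borel"
      and hm [measurable]: "h \<in> borel_measurable borel"
      unfolding f_def g_def h_def by measurable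
    have \<eta>w: "\<eta> \<le> w y" if "y \<in> pull T" for y T using wb(1)[OF Kb[OF that]] \<eta> h0 w0 by linarith
    have fb: "\<eta> \<le> f y" "f y \<le> 1" and gb: "\<eta> \<le> g y" "g y \<le> 1" for y
      using wb(2)[OF Kb, of y] \<eta>w \<eta>(2) h0 by (auto simp: f_def g_def)
    have hb: "h0 \<le> h y" "h y \<le> 2" for y
    proof -
      show "h0 \<le> h y"
      proof (cases "y \<in> ?K")
        case True
        have "1 * (w0 / 2) \<le> 2 powr \<theta> * (w y * (if y \<in> pull E then 1 / 2 else 1))"
          using wb[OF Kb[OF True]] two w0 by (intro mult_mono) auto
        then show ?thesis using True h0 by (simp add: h_def mult.assoc)
      qed (use h0 in \<open>simp add: h_def\<close>)
      show "h y \<le> 2"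
      proof (cases "y \<in> ?K")
        case True
        have "2 powr \<theta> * (w y * (if y \<in> pull E then 1 / 2 else 1)) \<le> 2 * 1"
          using wb[OF Kb[OF True]] two by (intro mult_mono) auto
        then show ?thesis using True by (simp add: h_def mult.assoc)
      qed (use \<zeta> in \<open>simp add: h_def\<close>)
    qed
    have PL: "(1 - (\<integral>t. c t \<partial>?P)) * ln (\<integral>x. f x \<partial>unit_cube) + (\<integral>t. c t \<partial>?P) * ln (\<integral>x. g x \<partial>unit_cube)
      \<le> ln (\<integral>x. h x \<partial>unit_cube)"
    proof (rule prekopa_leindler_euclidean[where c=\<eta> and C=2])
      show "prob_space ?P" by unfold_locales
      show "c \<in> borel_measurable ?P" by simp
      show "\<eta> \<le> h x" "f x \<le> 2" "g x \<le> 2" for x using hb[of x] fb[of x] gb[of x] \<eta> by auto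
      fix x y :: "real ^ 'n"
      let ?z = "\<lambda>t. (1 - c t) *\<^sub>R x + c t *\<^sub>R y"
      have zm [measurable]: "?z \<in> borel_measurable borel" by measurable
      have hz: "integrable ?P (\<lambda>t. ln (h (?z t)))"
      proof (rule P.integrable_const_bound[where B="\<bar>ln h0\<bar> + ln 2"])
        show "AE t in ?P. norm (ln (h (?z t))) \<le> \<bar>ln h0\<bar> + ln 2"
        proof (rule AE_I2)
          fix t
          have "ln h0 \<le> ln (h (?z t))" "ln (h (?z t)) \<le> ln 2"
            using hb[of "?z t"] h0 by (auto intro!: ln_mono less_le_trans[OF h0(1)])
          moreover have "0 \<le> ln (2::real)" by simp
          ultimately show "norm (ln (h (?z t))) \<le> \<bar>ln h0\<bar> + ln 2" unfolding real_norm_def by linarith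
        qed
      qed measurable
      show "(1 - (\<integral>t. c t \<partial>?P)) * ln (f x) + (\<integral>t. c t \<partial>?P) * ln (g y) \<le> (\<integral>t. ln (h (?z t)) \<partial>?P)"
        unfolding \<tau>eq
      proof (cases "x \<in> ?K \<and> y \<in> pull S")
        case True
        then have x: "x \<in> ?K" and y: "y \<in> pull S" "y \<in> ?K" using sub by auto
        let ?B = "{t. ?z t \<in> pull E}"
        have Bm [measurable]: "?B \<in> sets borel" by measurable
        have Bint: "integrable ?P (\<lambda>t. indicator ?B t :: real)"
          by (rule P.integrable_const_bound[where B=1]) auto
        have pt: "\<theta> * ln 2 + (1 - c t) * ln (w x) + c t * ln (w y) - ln 2 * indicator ?B t \<le> ln (h (?z t))" for t
        proof -
          have zK: "?z t \<in> ?K" by (rule pull_convex[OF x y(2) c01])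
          have lw: "(1 - c t) * ln (w x) + c t * ln (w y) \<le> ln (w (?z t))"
            by (rule bend_density_log_concave[OF num(1,2,4) Kb[OF x] Kb[OF y(1)] c01])
          have wz: "0 < w (?z t)" by (rule wb(3)[OF Kb[OF zK]])
          have "ln (h (?z t)) = \<theta> * ln 2 + ln (w (?z t)) - ln 2 * indicator ?B t"
            using zK wz by (auto simp: h_def ln_mult ln_div ln_powr indicator_def)
          then show ?thesis using lw by linarith
        qed
        have "(1 - \<tau>) * ln (w x) + \<tau> * ln (w y) \<le> \<theta> * ln 2 + (1 - \<tau>) * ln (w x) + \<tau> * ln (w y) - ln 2 * P.prob ?B"
        proof -
          have "P.prob ?B \<le> \<theta>" using bad[OF x y(1)] by (simp add: c_def)
          then have "ln 2 * P.prob ?B \<le> ln 2 * \<theta>" by (intro mult_left_mono) auto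
          then show ?thesis by (simp add: mult.commute)
        qed
        also have "\<dots> = (\<integral>t. \<theta> * ln 2 + (1 - c t) * ln (w x) + c t * ln (w y) - ln 2 * indicator ?B t \<partial>?P)"
          using cint Bint by (simp add: P.prob_space[simplified] \<tau>eq)
        also have "\<dots> \<le> (\<integral>t. ln (h (?z t)) \<partial>?P)"
          by (rule integral_mono[OF _ hz pt]) (use cint Bint in auto)
        finally show "(1 - \<tau>) * ln (f x) + \<tau> * ln (g y) \<le> (\<integral>t. ln (h (?z t)) \<partial>?P)"
          using x y by (simp add: f_def g_def)
      next
        case False
        have "(1 - \<tau>) * ln (f x) + \<tau> * ln (g y) \<le> \<tau> * ln \<eta>"
        proof -
          have lf: "ln (f x) \<le> 0" and lg: "ln (g y) \<le> 0"
            using fb[of x] gb[of y] \<eta>(1) by auto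
          show ?thesis
          proof (cases "x \<in> ?K")
            case True
            then have "g y = \<eta>" using False by (simp add: g_def)
            moreover have "(1 - \<tau>) * ln (f x) \<le> 0" using lf \<tau> by (intro mult_nonneg_nonpos) auto
            ultimately show ?thesis by simp
          next
            case False
            then have "f x = \<eta>" by (simp add: f_def)
            moreover have "\<tau> * ln (g y) \<le> 0" using lg \<tau> by (intro mult_nonneg_nonpos) auto
            moreover have "(1 - \<tau>) * ln \<eta> \<le> \<tau> * ln \<eta>" using ln\<eta> \<tau> by (intro mult_right_mono_neg) auto
            ultimately show ?thesis by simp
          qed
        qed
        also have "\<dots> = ln h0" by (rule \<eta>(3))
        also have "\<dots> \<le> (\<integral>t. ln (h (?z t)) \<partial>?P)"
          by (rule P.integral_ge_const[OF hz]) (use hb h0 in \<open>auto intro!: AE_I2 ln_mono less_le_trans[OF h0(1)]\<close>)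
        finally show "(1 - \<tau>) * ln (f x) + \<tau> * ln (g y) \<le> (\<integral>t. ln (h (?z t)) \<partial>?P)" .
      qed
    qed (use \<eta> fb gb hb c01 in auto)
    have ib: "integrable unit_cube q" if "q \<in> borel_measurable borel" "\<And>y. 0 \<le> q y" "\<And>y. q y \<le> 2" for q :: "real ^ 'n \<Rightarrow> real"
      by (rule U.integrable_const_bound[where B=2]) (use that in auto)
    have f0: "0 \<le> f y" "0 \<le> g y" "0 \<le> h y" for y
      using fb[of y] gb[of y] hb[of y] \<eta> h0 by auto
    have fint: "integrable unit_cube f" and gint: "integrable unit_cube g" and hint: "integrable unit_cube h"
      by (rule ib; use fm gm hm f0 fb gb hb in \<open>auto intro: order_trans[of _ 1]\<close>)+
    have fi: "WK / n2 \<le> (\<integral>x. f x \<partial>unit_cube)"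
    proof -
      have "(\<integral>y. indicator ?K y * w y \<partial>unit_cube) \<le> (\<integral>x. f x \<partial>unit_cube)"
        by (rule integral_mono[OF integral_pull(2) fint]) (use \<eta>(1) in \<open>auto simp: indicator_def f_def\<close>)
      then show ?thesis using integral_pull(1)[of UNIV] by (simp add: WK_def n2_def)
    qed
    have gi: "WS / n2 \<le> (\<integral>x. g x \<partial>unit_cube)"
    proof -
      have "(\<integral>y. indicator (pull S) y * w y \<partial>unit_cube) \<le> (\<integral>x. g x \<partial>unit_cube)"
        by (rule integral_mono[OF integral_pull(2) gint]) (use \<eta>(1) in \<open>auto simp: indicator_def g_def\<close>)
      then show ?thesis using integral_pull(1)[of S] by (simp add: WS_def n2_def)
    qed
    have hi: "(\<integral>x. h x \<partial>unit_cube) \<le> 2 powr \<theta> * (WK - WE / 2) / n2 + \<zeta>"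
    proof -
      let ?q = "\<lambda>y. 2 powr \<theta> * (indicator ?K y * w y) - 2 powr \<theta> / 2 * (indicator (pull E) y * w y) + \<zeta>"
      have "(\<integral>x. h x \<partial>unit_cube) \<le> (\<integral>y. ?q y \<partial>unit_cube)"
      proof (rule integral_mono)
        show "integrable unit_cube h" by (rule hint)
        show "integrable unit_cube ?q" using integral_pull(2)[of UNIV] integral_pull(2)[of E] by simp
        show "h y \<le> ?q y" for y using sub[of E] \<zeta> by (auto simp: h_def indicator_def)
      qed
      also have "\<dots> = 2 powr \<theta> * (WK / n2) - 2 powr \<theta> / 2 * (WE / n2) + \<zeta>"
        using integral_pull[of UNIV] integral_pull[of E] by (simp add: U.prob_space[simplified] WK_def WE_def n2_def)
      finally show ?thesis by (simp add: algebra_simps add_divide_distrib diff_divide_distrib)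
    qed
    have WKp: "0 < WK / n2" "0 < WS / n2" using WS le n2 by auto
    have hp: "0 < (\<integral>x. h x \<partial>unit_cube)"
    proof -
      have "h0 \<le> (\<integral>x. h x \<partial>unit_cube)" by (rule U.integral_ge_const[OF hint]) (use hb in auto)
      then show ?thesis using h0 by simp
    qed
    have "(1 - \<tau>) * ln (WK / n2) + \<tau> * ln (WS / n2) \<le> ln (\<integral>x. h x \<partial>unit_cube)"
    proof -
      have "(1 - \<tau>) * ln (WK / n2) \<le> (1 - \<tau>) * ln (\<integral>x. f x \<partial>unit_cube)"
        using \<tau> ln_mono[OF fi WKp(1)] by (intro mult_left_mono) auto
      moreover have "\<tau> * ln (WS / n2) \<le> \<tau> * ln (\<integral>x. g x \<partial>unit_cube)"
        using \<tau> ln_mono[OF gi WKp(2)] by (intro mult_left_mono) auto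
      ultimately show ?thesis using PL unfolding \<tau>eq by linarith
    qed
    then have "exp ((1 - \<tau>) * ln (WK / n2) + \<tau> * ln (WS / n2)) \<le> exp (ln (\<integral>x. h x \<partial>unit_cube))" by simp
    then have "(WK / n2) powr (1 - \<tau>) * (WS / n2) powr \<tau> \<le> (\<integral>x. h x \<partial>unit_cube)"
      using WKp hp by (simp add: powr_def exp_add)
    then show ?thesis using hi by simp
  qed
  have "(WK / n2) powr (1 - \<tau>) * (WS / n2) powr \<tau> \<le> 2 powr \<theta> * (WK - WE / 2) / n2"
  proof (rule field_le_epsilon)
    fix \<zeta> :: real assume "0 < \<zeta>"
    then show "(WK / n2) powr (1 - \<tau>) * (WS / n2) powr \<tau> \<le> 2 powr \<theta> * (WK - WE / 2) / n2 + \<zeta>"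
      using approx[of "min \<zeta> 1"] by simp
  qed
  moreover have "(WK / n2) powr (1 - \<tau>) * (WS / n2) powr \<tau> = WK powr (1 - \<tau>) * WS powr \<tau> / n2"
  proof -
    have "n2 powr (1 - \<tau>) * n2 powr \<tau> = n2" using n2 by (simp add: powr_add[symmetric])
    then show ?thesis using n2 WS le by (simp add: powr_divide)
  qed
  ultimately have "WK powr (1 - \<tau>) * WS powr \<tau> \<le> 2 powr \<theta> * (WK - WE / 2)"
    using n2 by (simp add: divide_le_cancel)
  then show ?thesis by (simp add: WK_def WS_def WE_def \<tau>_def)
qed

end

section \<open>Level sets\<close>

lemma norm_of_real_vec [simp]: "norm (of_real_vec x) = norm x"
  by (simp add: norm_vec_def of_real_vec_def)

lemma analytic_vec_restrict_measurable:
  fixes F :: "complex ^ 'n \<Rightarrow> complex"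
  assumes F: "analytic_vec_on F (ball 0 1)"
  shows "superlevel F c \<in> sets borel" "sublevel F c \<in> sets borel"
proof -
  have "continuous_on UNIV (of_real_vec :: real ^ 'n \<Rightarrow> _)"
    unfolding of_real_vec_def by (intro continuous_intros continuous_on_vec_lambda)
  then have rv: "continuous_on (ball 0 1) (of_real_vec :: real ^ 'n \<Rightarrow> _)" by (rule continuous_on_subset) simp
  have "continuous_on (ball 0 1) F"
    using analytic_vec_isCont[OF F] by (simp add: continuous_at_imp_continuous_on)
  moreover have "of_real_vec ` ball (0 :: real ^ 'n) 1 \<subseteq> ball 0 1" by auto
  ultimately have "continuous_on (ball 0 1) (\<lambda>x::real ^ 'n. F (of_real_vec x))"
    using continuous_on_compose2[OF _ rv] by blast
  then have c: "continuous_on (ball 0 1) (\<lambda>x::real ^ 'n. cmod (F (of_real_vec x)))"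
    by (rule continuous_on_norm)
  have eq: "superlevel F c = ball 0 1 - {x \<in> ball 0 1. cmod (F (of_real_vec x)) < c}"
    "sublevel F c = ball 0 1 - {x \<in> ball 0 1. c < cmod (F (of_real_vec x))}"
    by (auto simp: superlevel_def sublevel_def)
  have "open {x \<in> ball (0 :: real ^ 'n) 1. cmod (F (of_real_vec x)) < c}"
    "open {x \<in> ball (0 :: real ^ 'n) 1. c < cmod (F (of_real_vec x))}"
    using continuous_open_preimage[OF c open_ball open_lessThan[of c]]
      continuous_open_preimage[OF c open_ball open_greaterThan[of c]]
    by (auto simp: vimage_def Int_def)
  then show "superlevel F c \<in> sets borel" "sublevel F c \<in> sets borel"
    unfolding eq by (auto intro: borel_open)
qed

text \<open>
The maximum principle on the complex lines through \<open>0\<close>.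
\<close>

lemma analytic_vec_modulus_less_1:
  fixes F :: "complex ^ 'n \<Rightarrow> complex"
  assumes F: "analytic_vec_on F (ball 0 1)" and le: "\<And>z. z \<in> ball 0 1 \<Longrightarrow> cmod (F z) \<le> 1"
    and nc: "\<not> F constant_on ball 0 1"
  shows "cmod (F 0) < 1"
proof (rule ccontr)
  assume "\<not> cmod (F 0) < 1"
  then have F0: "1 \<le> cmod (F 0)" by simp
  have "F z = F 0" if z: "z \<in> ball 0 1" for z
  proof (cases "z = 0")
    case False
    define D where "D = ball (0::complex) (1 / norm z)"
    define Z where "Z \<zeta> = (\<chi> i. \<zeta> * z $ i)" for \<zeta>
    have Zn: "norm (Z \<zeta>) = cmod \<zeta> * norm z" for \<zeta>
      by (simp add: Z_def norm_vec_def norm_mult L2_set_right_distrib)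
    have ZD: "Z \<zeta> \<in> ball 0 1" if "\<zeta> \<in> D" for \<zeta>
      using that False by (simp add: Zn D_def field_simps)
    have "(\<lambda>\<zeta>. F (Z \<zeta>)) holomorphic_on D"
      by (rule analytic_vec_compose_holomorphic[OF F _ _ ZD]) (auto simp: D_def Z_def intro!: holomorphic_intros)
    then have "(\<lambda>\<zeta>. F (Z \<zeta>)) constant_on D"
    proof (rule maximum_modulus_principle[where U=D and \<xi>=0])
      have "Z 0 = 0" by (simp add: Z_def vec_eq_iff)
      then show "cmod (F (Z \<zeta>)) \<le> cmod (F (Z 0))" if "\<zeta> \<in> D" for \<zeta>
        using le[OF ZD[OF that]] F0 by simp
    qed (use False in \<open>auto simp: D_def\<close>)
    moreover have "0 \<in> D" "1 \<in> D" using z False by (auto simp: D_def field_simps)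
    ultimately have "F (Z 1) = F (Z 0)" by (auto simp: constant_on_def)
    moreover have "Z 1 = z" "Z 0 = 0" by (simp_all add: Z_def vec_eq_iff)
    ultimately show ?thesis by simp
  qed simp
  then show False using nc unfolding constant_on_def by blast
qed

context bent_ball
begin

text \<open>
At a parameter \<open>t\<close> for which the intermediate point lies over \<open>E\<close>, the value of \<open>\<bar>F\<bar>\<close> has dropped by
the factor \<open>\<Lambda>\<close> compared with \<open>z\<close>, so the Remez factors at \<open>t\<close> must multiply up to \<open>\<Lambda>\<close>.
\<close>

lemma bad_fraction:
  fixes F :: "complex ^ 'n \<Rightarrow> complex" and L N a v \<Lambda> :: real
  assumes F: "analytic_vec_on F (ball 0 1)" and le: "\<And>z. z \<in> ball 0 1 \<Longrightarrow> cmod (F z) \<le> 1"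
    and F0: "cmod (F 0) = exp (- L)" and N: "0 < N" "e * N = 4 * L"
    and a: "0 < a" "a \<le> 1 / 8" and v: "0 < v" and \<Lambda>: "1 < \<Lambda>"
    and E [measurable]: "E \<in> sets borel"
    and SE: "\<And>x. x \<in> S \<Longrightarrow> v \<le> cmod (F (of_real_vec x))"
      "\<And>x. x \<in> ball u r \<Longrightarrow> x \<in> E \<Longrightarrow> \<Lambda> * cmod (F (of_real_vec x)) \<le> v"
    and y: "y \<in> pull UNIV" and z: "z \<in> pull S"
  shows "measure (uniform_measure lborel {0..a}) {t. (1 - min 1 (max 0 t)) *\<^sub>R y + min 1 (max 0 t) *\<^sub>R z \<in> pull E}
    \<le> sqrt 5 * (sqrt 2 + 4 / sqrt a) * \<Lambda> powr (- 1 / (2 * N))"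
    (is "measure ?P ?B \<le> ?R")
proof (cases "y = z")
  case True
  have "x \<notin> E" if "x \<in> ball u r" "x \<in> S" for x
  proof
    assume "x \<in> E"
    then have "\<Lambda> * cmod (F (of_real_vec x)) \<le> cmod (F (of_real_vec x))"
      using SE(1)[OF that(2)] SE(2)[OF that(1)] by simp
    then have "(\<Lambda> - 1) * cmod (F (of_real_vec x)) \<le> 0" by (simp add: algebra_simps)
    then show False using \<Lambda> v SE(1)[OF that(2)] by (simp add: mult_le_0_iff)
  qed
  then have "z \<notin> pull E" using z by (auto simp: pull_def)
  moreover have "(1 - t) *\<^sub>R z + t *\<^sub>R z = z" for t by (simp add: algebra_simps)
  ultimately have "?B = {}" using True by simp
  then show ?thesis using a by simp
next
  case False
  obtain cs :: "real list" where cs: "real (length cs) \<le> N"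
    "\<And>t. 0 \<le> t \<Longrightarrow> t \<le> 1 / 8 \<Longrightarrow> t \<notin> set cs \<Longrightarrow>
       cmod (F (of_real_vec (bend e z))) \<le>
         5 powr N * (\<Prod>c\<leftarrow>cs. 2 + 2 / \<bar>t - c\<bar>) * cmod (F (of_real_vec (bend e ((1 - t) *\<^sub>R y + t *\<^sub>R z))))"
    by (rule remez_along_bent_chord[OF F le F0 num(1,2) N(2) pull_bound[OF y] pull_bound[OF z] False]) (auto simp: that)
  show ?thesis
  proof (rule remez_measure[OF N(1) cs(1) a(1)])
    show "?B \<in> sets borel" by measurable
    fix t assume t: "t \<in> ?B" "0 \<le> t" "t \<le> a" "t \<notin> set cs"
    define x where "x = bend e ((1 - t) *\<^sub>R y + t *\<^sub>R z)"
    define Q where "Q = 5 powr N * (\<Prod>c\<leftarrow>cs. 2 + 2 / \<bar>t - c\<bar>)"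
    have "min 1 (max 0 t) = t" using t a by simp
    then have "x \<in> ball u r" "x \<in> E" using t(1) by (auto simp: x_def pull_def)
    then have x: "\<Lambda> * cmod (F (of_real_vec x)) \<le> v" by (rule SE(2))
    have "v \<le> cmod (F (of_real_vec (bend e z)))" using z by (intro SE(1)) (simp add: pull_def)
    also have "\<dots> \<le> Q * cmod (F (of_real_vec x))"
      unfolding Q_def x_def by (rule cs(2)) (use t a in auto)
    finally have vQ: "v \<le> Q * cmod (F (of_real_vec x))" .
    then have "cmod (F (of_real_vec x)) \<noteq> 0" using v by auto
    then have "0 < cmod (F (of_real_vec x))" by simp
    moreover have "\<Lambda> * cmod (F (of_real_vec x)) \<le> Q * cmod (F (of_real_vec x))" using x vQ by simp
    ultimately show "\<Lambda> \<le> 5 powr N * (\<Prod>c\<leftarrow>cs. 2 + 2 / \<bar>t - c\<bar>)"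
      unfolding Q_def[symmetric] by simp
  qed (use \<Lambda> in auto)
qed

text \<open>
The choices \<open>a = 1 / (8 t)\<close> and \<open>\<Lambda> = (8 t) powr (4 N)\<close> give \<open>\<Lambda> powr (- 1 / (2 N)) = (8 t) powr (- 2)\<close>, so
that \<open>\<theta>\<close> is at most of the order \<open>t powr (- 3 / 2)\<close>; the cruder bound by a multiple of \<open>1 / t\<close> suffices
since \<open>a\<close> itself is of this order.
\<close>

lemma volume_levels:
  fixes F :: "complex ^ 'n \<Rightarrow> complex" and L N t v :: real
  assumes F: "analytic_vec_on F (ball 0 1)" and le: "\<And>z. z \<in> ball 0 1 \<Longrightarrow> cmod (F z) \<le> 1"
    and F0: "cmod (F 0) = exp (- L)" and N: "0 < N" "e * N = 4 * L"
    and t: "1 \<le> t" and v: "0 < v"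
    and S [measurable]: "S \<in> sets borel" and E [measurable]: "E \<in> sets borel"
    and SE: "\<And>x. x \<in> S \<Longrightarrow> v \<le> cmod (F (of_real_vec x))"
      "\<And>x. x \<in> ball u r \<Longrightarrow> x \<in> E \<Longrightarrow> (8 * t) powr (4 * N) * cmod (F (of_real_vec x)) \<le> v"
    and s: "0 < normalized_vol (ball u r) S"
  shows "normalized_vol (ball u r) S powr (1 / (16 * t)) \<le> exp (5 / (16 * t)) * (1 - normalized_vol (ball u r) E / 2)"
proof -
  define WK WS WE where "WK = measure lebesgue (ball u r)" and "WS = measure lebesgue (ball u r \<inter> S)"
    and "WE = measure lebesgue (ball u r \<inter> E)"
  have nv: "normalized_vol (ball u r) S = WS / WK" "normalized_vol (ball u r) E = WE / WK"
    by (simp_all add: normalized_vol_def WS_def WE_def WK_def)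
  have WK: "0 < WK" using r by (simp add: WK_def content_ball_pos)
  then have WS: "0 < WS" using s by (simp add: nv zero_less_divide_iff)
  define a where "a = 1 / (8 * t)"
  have a: "0 < a" "a \<le> 1 / 8" "a \<le> 1" "a / 2 = 1 / (16 * t)" using t by (auto simp: a_def field_simps)
  define \<theta> where "\<theta> = sqrt 5 * (sqrt 2 + 4 / sqrt a) * ((8 * t) powr (4 * N)) powr (- 1 / (2 * N))"
  have \<theta>0: "0 \<le> \<theta>" using a by (simp add: \<theta>_def)
  have \<theta>t: "\<theta> \<le> 9 / 20 / t"
  proof -
    have "((8 * t) powr (4 * N)) powr (- 1 / (2 * N)) = (8 * t) powr (- 2)"
      using N by (simp add: powr_powr)
    also have "\<dots> = 1 / (8 * t)\<^sup>2" using t by (simp add: powr_minus_divide)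
    finally have p: "((8 * t) powr (4 * N)) powr (- 1 / (2 * N)) = 1 / (64 * t\<^sup>2)" by (simp add: power_mult_distrib)
    have "sqrt (8 * t) = sqrt 2 * (2 * sqrt t)"
      using real_sqrt_mult[of 4 2] by (simp add: real_sqrt_mult)
    then have "sqrt 2 + 4 / sqrt a = sqrt 2 * (1 + 8 * sqrt t)"
      using t by (simp add: a_def real_sqrt_divide algebra_simps)
    then have \<theta>eq: "\<theta> = sqrt 10 * (1 + 8 * sqrt t) / (64 * t\<^sup>2)"
      unfolding \<theta>_def p using real_sqrt_mult[of 5 2] by simp
    have "sqrt t \<le> t" using t by (simp add: real_le_lsqrt power2_eq_square)
    moreover have "sqrt 10 \<le> 16 / 5" by (rule real_le_lsqrt) (auto simp: power2_eq_square)
    ultimately have "sqrt 10 * (1 + 8 * sqrt t) \<le> 16 / 5 * (9 * t)" using t by (intro mult_mono) auto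
    then have "\<theta> \<le> 16 / 5 * (9 * t) / (64 * t\<^sup>2)" unfolding \<theta>eq by (rule divide_right_mono) simp
    also have "\<dots> = 9 / 20 / t" using t by (simp add: power2_eq_square field_simps)
    finally show ?thesis .
  qed
  also have "\<dots> \<le> 1" using t by (simp add: field_simps)
  finally have \<theta>1: "\<theta> \<le> 1" .
  have \<Lambda>: "1 < (8 * t) powr (4 * N)" using t N by (intro gr_one_powr) auto
  have VI: "WK powr (1 - a / 2) * WS powr (a / 2) \<le> 2 powr \<theta> * (WK - WE / 2)"
    unfolding WK_def WS_def WE_def
  proof (rule volume_interpolation[OF S E a(1,3) \<theta>0 \<theta>1])
    show "0 < measure lebesgue (ball u r \<inter> S)" using WS by (simp add: WS_def)
    fix y z assume "y \<in> pull UNIV" "z \<in> pull S"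
    then show "measure (uniform_measure lborel {0..a})
        {t. (1 - min 1 (max 0 t)) *\<^sub>R y + min 1 (max 0 t) *\<^sub>R z \<in> pull E} \<le> \<theta>"
      unfolding \<theta>_def by (intro bad_fraction[OF F le F0 N a(1,2) v \<Lambda> E SE])
  qed
  have le1: "WE \<le> WK" unfolding WE_def WK_def by (rule measure_mono_fmeasurable; simp)
  have "WK powr (1 - a / 2) * WS powr (a / 2) = WK * (WS / WK) powr (a / 2)"
    using WK WS by (simp add: powr_divide powr_diff)
  then have "WK * (WS / WK) powr (a / 2) \<le> WK * (2 powr \<theta> * (1 - WE / WK / 2))"
    using VI WK by (simp add: algebra_simps)
  then have "(WS / WK) powr (a / 2) \<le> 2 powr \<theta> * (1 - WE / WK / 2)" using WK by simp
  also have "\<dots> \<le> exp (5 / (16 * t)) * (1 - WE / WK / 2)"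
  proof (rule mult_right_mono)
    have "\<theta> * ln 2 \<le> 9 / 20 / t * (25 / 36)"
      using \<theta>t \<theta>0 t ln2_le_25_over_36 by (intro mult_mono) auto
    also have "\<dots> = 5 / (16 * t)" by simp
    finally show "2 powr \<theta> \<le> exp (5 / (16 * t))" by (simp add: powr_def)
    show "0 \<le> 1 - WE / WK / 2" using le1 WK by (simp add: field_simps)
  qed
  finally show ?thesis by (simp add: nv a(4))
qed

end

text \<open>
The numerical inequality behind the second claim; it leaves a margin of less than one percent.
\<close>

lemma exp_three_eighths_bound: "(1 + 1 / exp 1) / 2 < exp (- 3 / 8 :: real)"
proof -
  have e1: "exp (1::real) < 2.72" using e_less_272 by simp
  have e2: "2.71 < exp (1::real)"
    using e_approx_32 unfolding abs_le_iff by simp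
  \<comment> \<open>the eighth power of the claim is a bound for \<open>exp 1 ^ 3\<close>\<close>
  have "exp (3 / 8 :: real) \<le> 1.46"
  proof (rule power_le_imp_le_base[of _ 7])
    have "exp (3 / 8 :: real) ^ 8 = exp 1 ^ 3" by (simp add: exp_of_nat_mult[symmetric])
    also have "\<dots> \<le> 2.72 ^ 3" using e1 by (intro power_mono) auto
    also have "\<dots> \<le> 1.46 ^ 8" by (simp add: power_numeral_reduce)
    finally show "exp (3 / 8 :: real) ^ Suc 7 \<le> 1.46 ^ Suc 7" by simp
  qed simp
  then have "1 / 1.46 \<le> exp (- (3 / 8) :: real)" by (simp add: exp_minus field_simps)
  moreover have "(1 + 1 / exp 1) / 2 < (1 / 1.46 :: real)"
    using e2 by (simp add: field_simps)
  ultimately show ?thesis by simp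
qed

theorem mainTheorem1:
  fixes F :: "complex ^ 'n \<Rightarrow> complex"
    and u :: "real ^ 'n"
    and \<epsilon> r M \<sigma> t :: real
    and B :: "(real ^ 'n) set"
  assumes "analytic_vec_on F (ball 0 1)"
    and "\<not> F constant_on ball 0 1"
    and "\<And>z. z \<in> ball 0 1 \<Longrightarrow> cmod (F z) \<le> 1"
    and "F 0 \<noteq> 0"
    and "0 < \<epsilon>" and "\<epsilon> \<le> 1 / 4"
    and "r > 0" and "B = ball u r"
    and "B \<subseteq> ball 0 (1 - \<epsilon>)"
    and "M > 0"
    and "normalized_vol B (superlevel F M) = 1 / exp 1"
    and "\<sigma> = 48 * (1 / \<epsilon> ^ 3) * ln (1 / cmod (F 0))"
    and "t > 1"
  shows "normalized_vol B (sublevel F ((8 * t) powr (- \<sigma>) * M)) \<le> 1 / t \<and>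
         normalized_vol B (superlevel F ((8 * t) powr \<sigma> * M)) \<le> exp (- t)"
proof -
  note F = assms(1) and le = assms(3) and eps = assms(5,6) and B = assms(8) and M = assms(10) and t = assms(13)
  define e where "e = \<epsilon> ^ 3 / 3"
  interpret bent_ball \<epsilon> r u e "2 * \<epsilon> * (1 - \<epsilon>)"
    by unfold_locales (use assms in \<open>simp_all add: e_def\<close>)
  define L where "L = ln (1 / cmod (F 0))"
  have F0: "cmod (F 0) = exp (- L)" "0 < L"
    using analytic_vec_modulus_less_1[OF F le assms(2)] assms(4) by (simp_all add: L_def ln_div)
  define N where "N = 4 * L / e"
  have N: "0 < N" "e * N = 4 * L" and \<sigma>: "\<sigma> = 4 * N"
    using F0(2) eps by (simp_all add: N_def e_def assms(12) L_def)
  note meas [measurable] = analytic_vec_restrict_measurable[OF F]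
  define \<Lambda> where "\<Lambda> = (8 * t) powr (4 * N)"
  have \<Lambda>: "0 < \<Lambda>" using t by (simp add: \<Lambda>_def)
  have t1: "1 \<le> t" using t by simp
  have M1: "normalized_vol (ball u r) (superlevel F M) = 1 / exp 1" using assms(11) B by simp
  have WK: "0 < measure lebesgue (ball u r)" using r by (simp add: content_ball_pos)
  show ?thesis
  proof
    let ?E = "sublevel F ((8 * t) powr (- \<sigma>) * M)"
    have inv: "(8 * t) powr (- \<sigma>) * M = M / \<Lambda>" by (simp add: \<sigma> \<Lambda>_def powr_minus_divide)
    show "normalized_vol B ?E \<le> 1 / t"
    proof (rule ccontr)
      assume "\<not> normalized_vol B ?E \<le> 1 / t"
      then have big: "1 / t < normalized_vol (ball u r) ?E" by (simp add: B)
      have "normalized_vol (ball u r) (superlevel F M) powr (1 / (16 * t))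
          \<le> exp (5 / (16 * t)) * (1 - normalized_vol (ball u r) ?E / 2)"
      proof (rule volume_levels[OF F le F0(1) N t1 M])
        show "M \<le> cmod (F (of_real_vec x))" if "x \<in> superlevel F M" for x using that by (simp add: superlevel_def)
        show "(8 * t) powr (4 * N) * cmod (F (of_real_vec x)) \<le> M" if "x \<in> ?E" for x
          using that \<Lambda> unfolding inv \<Lambda>_def[symmetric] by (simp add: sublevel_def field_simps)
      qed (use M1 meas in auto)
      also have "(normalized_vol (ball u r) (superlevel F M)) powr (1 / (16 * t)) = exp (- (1 / (16 * t)))"
        unfolding M1 by (simp add: powr_def ln_div)
      also have "exp (5 / (16 * t)) * (1 - normalized_vol (ball u r) ?E / 2) < exp (5 / (16 * t)) * (1 + - (1 / (2 * t)))"
        using big by simp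
      also have "\<dots> \<le> exp (5 / (16 * t)) * exp (- (1 / (2 * t)))"
        by (intro mult_left_mono exp_ge_add_one_self) simp
      also have "\<dots> = exp (- (3 / (16 * t)))" using t by (simp add: exp_add[symmetric] field_simps)
      finally have "- (1 / (16 * t)) < - (3 / (16 * t))" by simp
      then show False using t by (simp add: field_simps)
    qed
  next
    let ?S = "superlevel F ((8 * t) powr \<sigma> * M)" and ?E = "UNIV - superlevel F M"
    show "normalized_vol B ?S \<le> exp (- t)"
    proof (rule ccontr)
      assume "\<not> normalized_vol B ?S \<le> exp (- t)"
      then have big: "exp (- t) < normalized_vol (ball u r) ?S" by (simp add: B)
      have "normalized_vol (ball u r) ?S powr (1 / (16 * t))
          \<le> exp (5 / (16 * t)) * (1 - normalized_vol (ball u r) ?E / 2)"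
      proof (rule volume_levels[OF F le F0(1) N t1])
        show "0 < \<Lambda> * M" using \<Lambda> M by simp
        show "\<Lambda> * M \<le> cmod (F (of_real_vec x))" if "x \<in> ?S" for x
          using that by (simp add: superlevel_def \<sigma> \<Lambda>_def)
        show "(8 * t) powr (4 * N) * cmod (F (of_real_vec x)) \<le> \<Lambda> * M" if "x \<in> ball u r" "x \<in> ?E" for x
        proof -
          have "x \<in> ball 0 (1 - \<epsilon>)" using that(1) sub by blast
          then have "norm x < 1" using eps by simp
          then show ?thesis using that(2) \<Lambda> by (simp add: superlevel_def \<Lambda>_def)
        qed
        show "0 < normalized_vol (ball u r) ?S" using big exp_gt_zero[of "- t"] by linarith
      qed (use meas in auto)
      moreover have "exp (- (1 / 16)) \<le> normalized_vol (ball u r) ?S powr (1 / (16 * t))"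
      proof -
        have "exp (- (1 / 16)) = exp (- t) powr (1 / (16 * t))" using t by (simp add: powr_def)
        also have "\<dots> \<le> normalized_vol (ball u r) ?S powr (1 / (16 * t))"
          using big t by (intro powr_mono2) auto
        finally show ?thesis .
      qed
      moreover have "normalized_vol (ball u r) ?E = 1 - 1 / exp 1"
      proof -
        have "measure lebesgue (ball u r - ball u r \<inter> superlevel F M)
            = measure lebesgue (ball u r) - measure lebesgue (ball u r \<inter> superlevel F M)"
          by (rule measurable_measure_Diff) (auto simp: sets_completionI_sets)
        moreover have "ball u r \<inter> ?E = ball u r - ball u r \<inter> superlevel F M" by auto
        ultimately show ?thesis using M1 WK by (simp add: normalized_vol_def diff_divide_distrib)
      qed
      moreover have "exp (5 / (16 * t)) * ((1 + 1 / exp 1) / 2) \<le> exp (5 / 16) * ((1 + 1 / exp 1) / 2)"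
        using t by (intro mult_right_mono) (auto simp: field_simps add_pos_pos intro: order_trans[of 0 1])
      moreover have "1 - (1 - 1 / exp 1) / 2 = (1 + 1 / exp (1::real)) / 2" by (simp add: field_simps)
      ultimately have "exp (- (1 / 16)) \<le> exp (5 / 16) * ((1 + 1 / exp (1::real)) / 2)"
        by simp
      also have "\<dots> < exp (5 / 16) * exp (- 3 / 8 :: real)" using exp_three_eighths_bound by simp
      also have "\<dots> = exp (- (1 / 16))" by (simp add: exp_add[symmetric])
      finally show False by simp
    qed
  qed
qed

end
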